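(* Let $A$ and $B$ be partial combinatory algebras and let $\gamma:A\to B$ be a computationally dense applicative morphism. Then $\gamma$ induces an inclusion of toposes $\mathsf{RT}(B)\to\mathsf{RT}(A)$ (that is, the geometric morphism induced by $\gamma$ is an inclusion) if and only if there is an applicative morphism $\delta:B\to A$ such that $\gamma\delta\simeq\mathrm{id}_B$.
   Context: Partial combinatory algebras. A pca is a set $A$ with a partial binary application $(a,b)\mapsto ab$ (associating to the left) for which there exist $\mathsf{k},\mathsf{s}\in A$ such that for all $a,b,c\in A$: $\mathsf{k}ab=a$; $\mathsf{s}ab$ is defined; and whenever $ac(bc)$ is defined, $\mathsf{s}abc$ is defined and equal to it. $t{\downarrow}$ means "$t$ is defined". For $b\in B$, $\beta\subseteq B$: $b\beta{\downarrow}$ means $bx{\downarrow}$ for all $x\in\beta$, and then $b\beta=\{bx\mid x\in\beta\}$. Applicative morphisms. An applicative morphism $\gamma:A\to B$ assigns to each $a\in A$ a nonempty subset $\gamma(a)\subseteq B$ such that there is $r\in B$ with: whenever $aa'{\downarrow}$, $b\in\gamma(a)$, $b'\in\gamma(a')$, then $rbb'{\downarrow}$ and $rbb'\in\gamma(aa')$. For $\gamma,\delta:A\to B$, $\gamma\leq\delta$ means there is $s\in B$ such that for all $a\in A$, $b\in\gamma(a)$: $sb{\downarrow}$ and $sb\in\delta(a)$; $\gamma\simeq\delta$ means $\gamma\leq\delta$ and $\delta\leq\gamma$. Composition is composition of relations: $(\delta\gamma)(a)=\bigcup_{b\in\gamma(a)}\delta(b)$; $\mathrm{id}_B(b)=\{b\}$.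 Computational density. $\gamma:A\to B$ is computationally dense if there is $m\in B$ such that for every $b\in B$ there is $a\in A$ such that for all $a'\in A$: if $b\gamma(a'){\downarrow}$ then $aa'{\downarrow}$, $m\gamma(aa'){\downarrow}$ and $m\gamma(aa')\subseteq b\gamma(a')$. Assemblies and toposes. $\mathrm{Ass}(A)$ has as objects pairs $(X,E)$ with $X$ a set and $E(x)\subseteq A$ nonempty for each $x\in X$; a morphism $(X,E)\to(Y,F)$ is a function $f:X\to Y$ for which some $a\in A$ satisfies $ab{\downarrow}$ and $ab\in F(f(x))$ for all $x\in X$, $b\in E(x)$. The realizability topos $\mathsf{RT}(A)$ is the exact completion of $\mathrm{Ass}(A)$ as a regular category (ex/reg completion). An applicative morphism $\gamma:A\to B$ gives a regular functor $\gamma^*:\mathrm{Ass}(A)\to\mathrm{Ass}(B)$, $(X,E)\mapsto(X,\gamma\circ E)$ with $(\gamma\circ E)(x)=\bigcup_{a\in E(x)}\gamma(a)$, identity on underlying functions, which extends essentially uniquely to a regular functor $\gamma^*:\mathsf{RT}(A)\to\mathsf{RT}(B)$. If $\gamma$ is computationally dense, $\gamma^*$ has a right adjoint (known), and the geometric morphism $\mathsf{RT}(B)\to\mathsf{RT}(A)$ induced by $\gamma$ is the one with inverse image $\gamma^*$. *)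

theory Defs
  imports Main "HOL-Library.FuncSet" "HOL-Library.Equipollence"
begin

section \<open>Partial combinatory algebras and applicative morphisms\<close>

text \<open>A partial application on the set of all elements of a type; \<open>None\<close> means undefined.\<close>

type_synonym 'a papp = "'a \<Rightarrow> 'a \<Rightarrow> 'a option"

text \<open>Application of possibly undefined terms: defined only if both arguments are.\<close>

definition tapp :: "'a papp \<Rightarrow> 'a option \<Rightarrow> 'a option \<Rightarrow> 'a option" where
  "tapp A u v = Option.bind u (\<lambda>x. Option.bind v (A x))"

definition pca :: "'a papp \<Rightarrow> bool" where
  "pca A \<longleftrightarrow> (\<exists>k s. \<forall>a b c.
      tapp A (A k a) (Some b) = Some a \<and>
      tapp A (A s a) (Some b) \<noteq> None \<and>
      (tapp A (A a c) (A b c) \<noteq> None \<longrightarrow>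
        tapp A (tapp A (A s a) (Some b)) (Some c) = tapp A (A a c) (A b c)))"

definition set_app_defined :: "'b papp \<Rightarrow> 'b \<Rightarrow> 'b set \<Rightarrow> bool" where
  "set_app_defined B b \<beta> \<longleftrightarrow> (\<forall>x\<in>\<beta>. B b x \<noteq> None)"

definition set_app :: "'b papp \<Rightarrow> 'b \<Rightarrow> 'b set \<Rightarrow> 'b set" where
  "set_app B b \<beta> = {y. \<exists>x\<in>\<beta>. B b x = Some y}"

definition applicative_morphism :: "'a papp \<Rightarrow> 'b papp \<Rightarrow> ('a \<Rightarrow> 'b set) \<Rightarrow> bool" where
  "applicative_morphism A B \<gamma> \<longleftrightarrow> (\<forall>a. \<gamma> a \<noteq> {}) \<and>
     (\<exists>r. \<forall>a a' c. A a a' = Some c \<longrightarrow>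
        (\<forall>b\<in>\<gamma> a. \<forall>b'\<in>\<gamma> a'. \<exists>y\<in>\<gamma> c. tapp B (B r b) (Some b') = Some y))"

definition morphism_le :: "'b papp \<Rightarrow> ('a \<Rightarrow> 'b set) \<Rightarrow> ('a \<Rightarrow> 'b set) \<Rightarrow> bool" where
  "morphism_le B \<gamma> \<delta> \<longleftrightarrow> (\<exists>s. \<forall>a. \<forall>b\<in>\<gamma> a. \<exists>y\<in>\<delta> a. B s b = Some y)"

definition morphism_equiv :: "'b papp \<Rightarrow> ('a \<Rightarrow> 'b set) \<Rightarrow> ('a \<Rightarrow> 'b set) \<Rightarrow> bool" where
  "morphism_equiv B \<gamma> \<delta> \<longleftrightarrow> morphism_le B \<gamma> \<delta> \<and> morphism_le B \<delta> \<gamma>"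

definition morphism_comp :: "('b \<Rightarrow> 'c set) \<Rightarrow> ('a \<Rightarrow> 'b set) \<Rightarrow> 'a \<Rightarrow> 'c set" where
  "morphism_comp \<delta> \<gamma> a = (\<Union>b\<in>\<gamma> a. \<delta> b)"

definition morphism_id :: "'b \<Rightarrow> 'b set" where
  "morphism_id b = {b}"

definition computationally_dense :: "'a papp \<Rightarrow> 'b papp \<Rightarrow> ('a \<Rightarrow> 'b set) \<Rightarrow> bool" where
  "computationally_dense A B \<gamma> \<longleftrightarrow> (\<exists>m. \<forall>b. \<exists>a. \<forall>a'.
      set_app_defined B b (\<gamma> a') \<longrightarrow>
        (\<exists>c. A a a' = Some c \<and> set_app_defined B m (\<gamma> c) \<and>
             set_app B m (\<gamma> c) \<subseteq> set_app B b (\<gamma> a')))"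


section \<open>Categories, functors and geometric morphisms\<close>

record ('o, 'm) cat =
  Obj :: "'o set"
  Arr :: "'m set"
  Dom :: "'m \<Rightarrow> 'o"
  Cod :: "'m \<Rightarrow> 'o"
  Ident :: "'o \<Rightarrow> 'm"
  Comp :: "'m \<Rightarrow> 'm \<Rightarrow> 'm"  (infixl "\<cdot>\<index>" 70)

definition Hom :: "('o, 'm) cat \<Rightarrow> 'o \<Rightarrow> 'o \<Rightarrow> 'm set" where
  "Hom C X Y = {f \<in> Arr C. Dom C f = X \<and> Cod C f = Y}"

definition category :: "('o, 'm) cat \<Rightarrow> bool" where
  "category C \<longleftrightarrow>
     (\<forall>f\<in>Arr C. Dom C f \<in> Obj C \<and> Cod C f \<in> Obj C) \<and>
     (\<forall>X\<in>Obj C. Ident C X \<in> Hom C X X) \<and>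
     (\<forall>f\<in>Arr C. \<forall>g\<in>Arr C. Cod C f = Dom C g \<longrightarrow>
        g \<cdot>\<^bsub>C\<^esub> f \<in> Hom C (Dom C f) (Cod C g)) \<and>
     (\<forall>f\<in>Arr C. f \<cdot>\<^bsub>C\<^esub> Ident C (Dom C f) = f \<and> Ident C (Cod C f) \<cdot>\<^bsub>C\<^esub> f = f) \<and>
     (\<forall>f\<in>Arr C. \<forall>g\<in>Arr C. \<forall>h\<in>Arr C. Cod C f = Dom C g \<longrightarrow> Cod C g = Dom C h \<longrightarrow>
        h \<cdot>\<^bsub>C\<^esub> (g \<cdot>\<^bsub>C\<^esub> f) = (h \<cdot>\<^bsub>C\<^esub> g) \<cdot>\<^bsub>C\<^esub> f)"

definition terminal :: "('o, 'm) cat \<Rightarrow> 'o \<Rightarrow> bool" where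
  "terminal C T \<longleftrightarrow> T \<in> Obj C \<and> (\<forall>X\<in>Obj C. \<exists>!f. f \<in> Hom C X T)"

text \<open>\<open>p\<close> and \<open>q\<close> are the projections of a pullback of \<open>f\<close> along \<open>g\<close>.\<close>

definition pullback :: "('o, 'm) cat \<Rightarrow> 'm \<Rightarrow> 'm \<Rightarrow> 'm \<Rightarrow> 'm \<Rightarrow> bool" where
  "pullback C f g p q \<longleftrightarrow>
     f \<in> Arr C \<and> g \<in> Arr C \<and> Cod C f = Cod C g \<and>
     p \<in> Arr C \<and> q \<in> Arr C \<and> Dom C p = Dom C q \<and>
     Cod C p = Dom C f \<and> Cod C q = Dom C g \<and> f \<cdot>\<^bsub>C\<^esub> p = g \<cdot>\<^bsub>C\<^esub> q \<and>
     (\<forall>x\<in>Arr C. \<forall>y\<in>Arr C.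
        Dom C x = Dom C y \<and> Cod C x = Dom C f \<and> Cod C y = Dom C g \<and>
        f \<cdot>\<^bsub>C\<^esub> x = g \<cdot>\<^bsub>C\<^esub> y \<longrightarrow>
        (\<exists>!h. h \<in> Hom C (Dom C x) (Dom C p) \<and> p \<cdot>\<^bsub>C\<^esub> h = x \<and> q \<cdot>\<^bsub>C\<^esub> h = y))"

definition coequalizer :: "('o, 'm) cat \<Rightarrow> 'm \<Rightarrow> 'm \<Rightarrow> 'm \<Rightarrow> bool" where
  "coequalizer C u v e \<longleftrightarrow>
     u \<in> Arr C \<and> v \<in> Arr C \<and> e \<in> Arr C \<and> Dom C u = Dom C v \<and>
     Cod C u = Dom C e \<and> Cod C v = Dom C e \<and> e \<cdot>\<^bsub>C\<^esub> u = e \<cdot>\<^bsub>C\<^esub> v \<and>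
     (\<forall>g\<in>Arr C. Dom C g = Dom C e \<and> g \<cdot>\<^bsub>C\<^esub> u = g \<cdot>\<^bsub>C\<^esub> v \<longrightarrow>
        (\<exists>!h. h \<in> Hom C (Cod C e) (Cod C g) \<and> h \<cdot>\<^bsub>C\<^esub> e = g))"

definition regular_epi :: "('o, 'm) cat \<Rightarrow> 'm \<Rightarrow> bool" where
  "regular_epi C e \<longleftrightarrow> (\<exists>u v. coequalizer C u v e)"

record ('o, 'm, 'p, 'n) cfunctor =
  on_obj :: "'o \<Rightarrow> 'p"
  on_arr :: "'m \<Rightarrow> 'n"

definition is_functor ::
  "('o, 'm) cat \<Rightarrow> ('p, 'n) cat \<Rightarrow> ('o, 'm, 'p, 'n) cfunctor \<Rightarrow> bool" where
  "is_functor C D F \<longleftrightarrow> category C \<and> category D \<and>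
     (\<forall>X\<in>Obj C. on_obj F X \<in> Obj D \<and> on_arr F (Ident C X) = Ident D (on_obj F X)) \<and>
     (\<forall>f\<in>Arr C. on_arr F f \<in> Hom D (on_obj F (Dom C f)) (on_obj F (Cod C f))) \<and>
     (\<forall>f\<in>Arr C. \<forall>g\<in>Arr C. Cod C f = Dom C g \<longrightarrow>
        on_arr F (g \<cdot>\<^bsub>C\<^esub> f) = on_arr F g \<cdot>\<^bsub>D\<^esub> on_arr F f)"

definition fully_faithful ::
  "('o, 'm) cat \<Rightarrow> ('p, 'n) cat \<Rightarrow> ('o, 'm, 'p, 'n) cfunctor \<Rightarrow> bool" where
  "fully_faithful C D F \<longleftrightarrow> (\<forall>X\<in>Obj C. \<forall>Y\<in>Obj C.
     bij_betw (on_arr F) (Hom C X Y) (Hom D (on_obj F X) (on_obj F Y)))"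

definition preserves_finite_limits ::
  "('o, 'm) cat \<Rightarrow> ('p, 'n) cat \<Rightarrow> ('o, 'm, 'p, 'n) cfunctor \<Rightarrow> bool" where
  "preserves_finite_limits C D F \<longleftrightarrow>
     (\<forall>T. terminal C T \<longrightarrow> terminal D (on_obj F T)) \<and>
     (\<forall>f g p q. pullback C f g p q \<longrightarrow>
        pullback D (on_arr F f) (on_arr F g) (on_arr F p) (on_arr F q))"

definition left_adjoint ::
  "('o, 'm) cat \<Rightarrow> ('p, 'n) cat \<Rightarrow> ('o, 'm, 'p, 'n) cfunctor \<Rightarrow> ('p, 'n, 'o, 'm) cfunctor \<Rightarrow> bool"
where
  "left_adjoint C D F G \<longleftrightarrow> is_functor C D F \<and> is_functor D C G \<and>
     (\<exists>\<Phi>.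
       (\<forall>X\<in>Obj C. \<forall>Y\<in>Obj D.
          bij_betw (\<Phi> X Y) (Hom D (on_obj F X) Y) (Hom C X (on_obj G Y))) \<and>
       (\<forall>X\<in>Obj C. \<forall>X'\<in>Obj C. \<forall>Y\<in>Obj D. \<forall>Y'\<in>Obj D.
          \<forall>g\<in>Hom C X' X. \<forall>f\<in>Hom D (on_obj F X) Y. \<forall>h\<in>Hom D Y Y'.
          \<Phi> X' Y' (h \<cdot>\<^bsub>D\<^esub> f \<cdot>\<^bsub>D\<^esub> on_arr F g) = on_arr G h \<cdot>\<^bsub>C\<^esub> \<Phi> X Y f \<cdot>\<^bsub>C\<^esub> g))"

text \<open>A geometric morphism from \<open>E\<close> to \<open>F\<close> is given by its inverse image \<open>f_inv\<close>, going from
  \<open>F\<close> to \<open>E\<close>, and its direct image \<open>f_dir\<close>, going from \<open>E\<close> to \<open>F\<close>.\<close>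

definition geometric_morphism ::
  "('p, 'n) cat \<Rightarrow> ('o, 'm) cat \<Rightarrow> ('o, 'm, 'p, 'n) cfunctor \<Rightarrow> ('p, 'n, 'o, 'm) cfunctor \<Rightarrow> bool"
where
  "geometric_morphism E F f_inv f_dir \<longleftrightarrow>
     left_adjoint F E f_inv f_dir \<and> preserves_finite_limits F E f_inv"

definition geometric_inclusion ::
  "('p, 'n) cat \<Rightarrow> ('o, 'm) cat \<Rightarrow> ('o, 'm, 'p, 'n) cfunctor \<Rightarrow> ('p, 'n, 'o, 'm) cfunctor \<Rightarrow> bool"
where
  "geometric_inclusion E F f_inv f_dir \<longleftrightarrow>
     geometric_morphism E F f_inv f_dir \<and> fully_faithful E F f_dir"


section \<open>The exact completion of a regular category\<close>

text \<open>A span is a pair of arrows with common domain.  A relation is a jointly monic span; no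
  product object has to be chosen.  The subobject it represents is its class under
  \<open>rel_iso\<close>.\<close>

type_synonym 'm span = "'m \<times> 'm"

definition is_relation :: "('o, 'm) cat \<Rightarrow> 'o \<Rightarrow> 'o \<Rightarrow> 'm span \<Rightarrow> bool" where
  "is_relation C X Y S \<longleftrightarrow> (case S of (p, q) \<Rightarrow>
     p \<in> Arr C \<and> q \<in> Arr C \<and> Dom C p = Dom C q \<and> Cod C p = X \<and> Cod C q = Y \<and>
     (\<forall>h\<in>Arr C. \<forall>h'\<in>Arr C.
        Dom C h = Dom C h' \<and> Cod C h = Dom C p \<and> Cod C h' = Dom C p \<and>
        p \<cdot>\<^bsub>C\<^esub> h = p \<cdot>\<^bsub>C\<^esub> h' \<and> q \<cdot>\<^bsub>C\<^esub> h = q \<cdot>\<^bsub>C\<^esub> h' \<longrightarrow> h = h'))"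

text \<open>The generalized elements \<open>x\<close>, \<open>y\<close> are related: \<open>(x, y)\<close> factors through the span.\<close>

definition holds :: "('o, 'm) cat \<Rightarrow> 'm span \<Rightarrow> 'm \<Rightarrow> 'm \<Rightarrow> bool" where
  "holds C S x y \<longleftrightarrow> (case S of (p, q) \<Rightarrow>
     \<exists>h\<in>Arr C. Cod C h = Dom C p \<and> p \<cdot>\<^bsub>C\<^esub> h = x \<and> q \<cdot>\<^bsub>C\<^esub> h = y)"

definition rel_iso :: "('o, 'm) cat \<Rightarrow> 'm span \<Rightarrow> 'm span \<Rightarrow> bool" where
  "rel_iso C S T \<longleftrightarrow> holds C T (fst S) (snd S) \<and> holds C S (fst T) (snd T)"

definition rel_class :: "('o, 'm) cat \<Rightarrow> 'm span \<Rightarrow> 'm span set" where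
  "rel_class C S =
     {T. is_relation C (Cod C (fst S)) (Cod C (snd S)) T \<and> rel_iso C S T}"

text \<open>\<open>R\<close> is an internal equivalence relation on \<open>X\<close>.\<close>

definition equiv_relation :: "('o, 'm) cat \<Rightarrow> 'o \<Rightarrow> 'm span \<Rightarrow> bool" where
  "equiv_relation C X R \<longleftrightarrow> X \<in> Obj C \<and> is_relation C X X R \<and>
     (\<forall>x\<in>Arr C. Cod C x = X \<longrightarrow> holds C R x x) \<and>
     (\<forall>x y. holds C R x y \<longrightarrow> holds C R y x) \<and>
     (\<forall>x y z. holds C R x y \<longrightarrow> holds C R y z \<longrightarrow> holds C R x z)"

abbreviation rel_carrier :: "('o, 'm) cat \<Rightarrow> 'm span \<Rightarrow> 'o" where
  "rel_carrier C R \<equiv> Cod C (fst R)"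

text \<open>Functional relations from \<open>(X, R)\<close> to \<open>(Y, S)\<close>: compatible with \<open>R\<close> and \<open>S\<close>,
  single-valued and total.  Totality says that the projection to \<open>X\<close> is a regular epimorphism.\<close>

definition functional_relation :: "('o, 'm) cat \<Rightarrow> 'm span \<Rightarrow> 'm span \<Rightarrow> 'm span \<Rightarrow> bool" where
  "functional_relation C R S P \<longleftrightarrow>
     is_relation C (rel_carrier C R) (rel_carrier C S) P \<and>
     (\<forall>x x' y y'. holds C R x' x \<longrightarrow> holds C P x y \<longrightarrow> holds C S y y' \<longrightarrow> holds C P x' y') \<and>
     (\<forall>x y y'. holds C P x y \<longrightarrow> holds C P x y' \<longrightarrow> holds C S y y') \<and>
     regular_epi C (fst P)"

text \<open>\<open>H\<close> represents the composite of \<open>P\<close> followed by \<open>Q\<close>: it is the regular image, as a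
  relation from the source of \<open>P\<close> to the target of \<open>Q\<close>, of the pullback of \<open>P\<close> and \<open>Q\<close>
  over the middle object.\<close>

definition rel_composite :: "('o, 'm) cat \<Rightarrow> 'm span \<Rightarrow> 'm span \<Rightarrow> 'm span \<Rightarrow> bool" where
  "rel_composite C P Q H \<longleftrightarrow>
     is_relation C (Cod C (fst P)) (Cod C (snd Q)) H \<and>
     (\<exists>\<pi>\<^sub>1 \<pi>\<^sub>2 e. pullback C (snd P) (fst Q) \<pi>\<^sub>1 \<pi>\<^sub>2 \<and>
        regular_epi C e \<and> Dom C e = Dom C \<pi>\<^sub>1 \<and> Cod C e = Dom C (fst H) \<and>
        fst H \<cdot>\<^bsub>C\<^esub> e = fst P \<cdot>\<^bsub>C\<^esub> \<pi>\<^sub>1 \<and> snd H \<cdot>\<^bsub>C\<^esub> e = snd Q \<cdot>\<^bsub>C\<^esub> \<pi>\<^sub>2)"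

text \<open>The ex/reg completion: its objects are the internal equivalence relations of \<open>C\<close>, its
  arrows the functional relations, taken up to equality of subobjects.  An arrow is stored as
  \<open>(source, class, target)\<close>.\<close>

type_synonym 'm exreg_arr = "'m span \<times> 'm span set \<times> 'm span"

definition exreg :: "('o, 'm) cat \<Rightarrow> ('m span, 'm exreg_arr) cat" where
  "exreg C = \<lparr>
     Obj = {R. equiv_relation C (rel_carrier C R) R},
     Arr = {(R, rel_class C P, S) | R P S.
              equiv_relation C (rel_carrier C R) R \<and> equiv_relation C (rel_carrier C S) S \<and>
              functional_relation C R S P},
     Dom = (\<lambda>(R, \<P>, S). R),
     Cod = (\<lambda>(R, \<P>, S). S),
     Ident = (\<lambda>R. (R, rel_class C R, R)),
     Comp = (\<lambda>(_, \<Q>, T) (R, \<P>, _). (R, {H. \<exists>P\<in>\<P>. \<exists>Q\<in>\<Q>. rel_composite C P Q H}, T)) \<rparr>"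

text \<open>The extension to ex/reg completions, into \<open>exreg D\<close>, of a regular functor with
  target \<open>D\<close>.\<close>

definition exreg_functor ::
  "('p, 'n) cat \<Rightarrow> ('o, 'm, 'p, 'n) cfunctor \<Rightarrow>
   ('m span, 'm exreg_arr, 'n span, 'n exreg_arr) cfunctor" where
  "exreg_functor D F = (let F\<^sub>s = map_prod (on_arr F) (on_arr F) in \<lparr>
     on_obj = F\<^sub>s,
     on_arr = (\<lambda>(R, \<P>, S). (F\<^sub>s R, (\<Union>P\<in>\<P>. rel_class D (F\<^sub>s P)), F\<^sub>s S)) \<rparr>)"


section \<open>Assemblies and realizability toposes\<close>

text \<open>\<open>\<U>\<close> collects the sets that may underlie assemblies.  Only closure under subsets and, up to
  bijection, binary products is imposed, so every Grothendieck universe qualifies, and so does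
  the collection of all subsets of an infinite type.  The pcas have to be small.\<close>

definition set_universe :: "'u set set \<Rightarrow> bool" where
  "set_universe \<U> \<longleftrightarrow> (\<forall>X\<in>\<U>. \<forall>Y. Y \<subseteq> X \<longrightarrow> Y \<in> \<U>) \<and>
     (\<forall>X\<in>\<U>. \<forall>Y\<in>\<U>. \<exists>Z\<in>\<U>. X \<times> Y \<approx> Z)"

definition small :: "'u set set \<Rightarrow> 'x set \<Rightarrow> bool" where
  "small \<U> S \<longleftrightarrow> (\<exists>Z\<in>\<U>. S \<approx> Z)"

text \<open>In an assembly \<open>(X, E)\<close> the function \<open>E\<close> is normalized to be empty outside \<open>X\<close>; an arrow
  \<open>(source, f, target)\<close> has its function normalized by \<open>\<rightarrow>\<^sub>E\<close>.\<close>

type_synonym ('u, 'a) assembly = "'u set \<times> ('u \<Rightarrow> 'a set)"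
type_synonym ('u, 'a) assembly_arr = "('u, 'a) assembly \<times> ('u \<Rightarrow> 'u) \<times> ('u, 'a) assembly"

definition is_assembly :: "'u set set \<Rightarrow> ('u, 'a) assembly \<Rightarrow> bool" where
  "is_assembly \<U> X \<longleftrightarrow> (case X of (X, E) \<Rightarrow>
     X \<in> \<U> \<and> (\<forall>x\<in>X. E x \<noteq> {}) \<and> (\<forall>x. x \<notin> X \<longrightarrow> E x = {}))"

definition tracked ::
  "'a papp \<Rightarrow> ('u, 'a) assembly \<Rightarrow> ('u, 'a) assembly \<Rightarrow> ('u \<Rightarrow> 'u) \<Rightarrow> bool" where
  "tracked A X Y f \<longleftrightarrow>
     (\<exists>a. \<forall>x\<in>fst X. \<forall>b\<in>snd X x. \<exists>c\<in>snd Y (f x). A a b = Some c)"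

definition Ass :: "'u set set \<Rightarrow> 'a papp \<Rightarrow> (('u, 'a) assembly, ('u, 'a) assembly_arr) cat" where
  "Ass \<U> A = \<lparr>
     Obj = {X. is_assembly \<U> X},
     Arr = {(X, f, Y) | X f Y. is_assembly \<U> X \<and> is_assembly \<U> Y \<and>
              f \<in> fst X \<rightarrow>\<^sub>E fst Y \<and> tracked A X Y f},
     Dom = (\<lambda>(X, f, Y). X),
     Cod = (\<lambda>(X, f, Y). Y),
     Ident = (\<lambda>X. (X, restrict id (fst X), X)),
     Comp = (\<lambda>(_, g, Z) (X, f, _). (X, compose (fst X) g f, Z)) \<rparr>"

definition assembly_image :: "('a \<Rightarrow> 'b set) \<Rightarrow> ('u, 'a) assembly \<Rightarrow> ('u, 'b) assembly" where
  "assembly_image \<gamma> X = (fst X, \<lambda>x. \<Union>a\<in>snd X x. \<gamma> a)"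

definition Ass_functor :: "('a \<Rightarrow> 'b set) \<Rightarrow>
  (('u, 'a) assembly, ('u, 'a) assembly_arr, ('u, 'b) assembly, ('u, 'b) assembly_arr) cfunctor"
where
  "Ass_functor \<gamma> = \<lparr>
     on_obj = assembly_image \<gamma>,
     on_arr = (\<lambda>(X, f, Y). (assembly_image \<gamma> X, f, assembly_image \<gamma> Y)) \<rparr>"

type_synonym ('u, 'a) rt_obj = "('u, 'a) assembly_arr span"
type_synonym ('u, 'a) rt_arr = "('u, 'a) assembly_arr exreg_arr"

definition RT :: "'u set set \<Rightarrow> 'a papp \<Rightarrow> (('u, 'a) rt_obj, ('u, 'a) rt_arr) cat" where
  "RT \<U> A = exreg (Ass \<U> A)"

definition RT_functor :: "'u set set \<Rightarrow> 'b papp \<Rightarrow> ('a \<Rightarrow> 'b set) \<Rightarrow>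
  (('u, 'a) rt_obj, ('u, 'a) rt_arr, ('u, 'b) rt_obj, ('u, 'b) rt_arr) cfunctor" where
  "RT_functor \<U> B \<gamma> = exreg_functor (Ass \<U> B) (Ass_functor \<gamma>)"

end

theory Submission imports Defs begin

text \<open>The inverse image of \<open>\<gamma>\<close> does not change underlying functions, so that everything reduces to
  entailments between families of sets of realizers.  The direct image is fully faithful iff every
  component \<open>\<epsilon>\<close> of the counit is invertible.

  If \<open>\<epsilon>\<close> has a section at the assembly of all elements of \<open>B\<close>, each \<open>b\<close> being realized by itself,
  then \<open>b\<close> can be transformed into an element of \<open>\<gamma> a\<close> for some \<open>a\<close> from which, by density, one
  computes an \<open>a'\<close> such that \<open>m\<close> maps \<open>\<gamma> a'\<close> into \<open>{b}\<close>.  So \<open>\<gamma>\<delta> \<simeq> id\<close> for the \<open>\<delta>\<close> that sends \<open>b\<close> to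
  the set of all such \<open>a'\<close>.

  Conversely, let \<open>\<gamma>\<delta> \<simeq> id\<close>.  Then \<open>\<epsilon>\<close> is a functional relation \<open>P\<close>, and its converse is functional, too.
  \<open>P\<close> is surjective, because every \<open>Z\<close> is a quotient of an assembly \<open>Y\<close>, and the quotient map
  precomposed with \<open>\<gamma>\<delta>Y \<cong> Y\<close> factors through \<open>\<epsilon>\<close>.  \<open>P\<close> is injective, because its kernel pair is covered
  by the image of an assembly over \<open>A\<close>, realized through \<open>\<delta>\<close>, whose two projections become equal when
  composed with \<open>\<epsilon>\<close> and so are already equal by adjointness.  This never describes the direct
  image explicitly, which would need power sets in the universe.\<close>

section \<open>Combinatory completeness\<close>

text \<open>The laws of a category for \<open>RT\<close> and the functoriality of the inverse image
  are not checked by hand: the assumed adjunction contains them. It also supplies relational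
  composites, since the class of a composite arrow is then inhabited. What remains is to read the
  diagrammatic definitions on realizers. The obstacle is that these quantify over generalized
  elements, that is, over arrows between assemblies in a universe that is closed under little. Each
  quantifier is therefore tested on a generic element, whose domain codes all tuples that satisfy
  the hypothesis; these form a subset of a product of carriers, hence a small set. After this
  translation an arrow of the topos is a family of sets of realizers up to entailment in both
  directions, and arrows with common ends agree as soon as one entails the other. Density becomes a
  rule that transposes an entailment over \<open>B\<close>, from the image of a family to
  singletons, into an entailment over \<open>A\<close>; the candidate \<open>\<delta>\<close> is
  read off from this rule.\<close>

datatype 'a pterm = PVar nat | PCon 'a | PApp "'a pterm" "'a pterm"

primrec peval :: "'a papp \<Rightarrow> (nat \<Rightarrow> 'a) \<Rightarrow> 'a pterm \<Rightarrow> 'a option" where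
  "peval A e (PVar n) = Some (e n)"
| "peval A e (PCon a) = Some a"
| "peval A e (PApp t u) = tapp A (peval A e t) (peval A e u)"

text \<open>Bracket abstraction. A subterm free of the variable is not compressed to
  \<open>k t\<close>: its evaluation may be undefined, whereas the form \<open>s t u\<close> always
  has a value.\<close>

primrec pabs :: "'a \<Rightarrow> 'a \<Rightarrow> nat \<Rightarrow> 'a pterm \<Rightarrow> 'a pterm" where
  "pabs k s n (PVar m) = (if m = n then PApp (PApp (PCon s) (PCon k)) (PCon k) else PApp (PCon k) (PVar m))"
| "pabs k s n (PCon a) = PApp (PCon k) (PCon a)"
| "pabs k s n (PApp t u) = PApp (PApp (PCon s) (pabs k s n t)) (pabs k s n u)"

definition ks_pair :: "'a papp \<Rightarrow> 'a \<Rightarrow> 'a \<Rightarrow> bool" where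
  "ks_pair A k s \<longleftrightarrow> (\<forall>a b c.
      tapp A (A k a) (Some b) = Some a \<and>
      tapp A (A s a) (Some b) \<noteq> None \<and>
      (tapp A (A a c) (A b c) \<noteq> None \<longrightarrow>
        tapp A (tapp A (A s a) (Some b)) (Some c) = tapp A (A a c) (A b c)))"

lemma tapp_simps [simp]:
  "tapp A (Some x) (Some y) = A x y" "tapp A None u = None" "tapp A u None = None"
  by (auto simp: tapp_def split: Option.bind_split)

lemma tapp_SomeE:
  assumes "tapp A u v = Some z"
  obtains x y where "u = Some x" "v = Some y" "A x y = Some z"
  using assms by (auto simp: tapp_def bind_eq_Some_conv)

lemma ks_k:
  assumes "ks_pair A k s"
  obtains d where "A k a = Some d" "\<And>b. A d b = Some a"
proof -
  have *: "tapp A (A k a) (Some b) = Some a" for b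
    using assms by (auto simp: ks_pair_def)
  show thesis
  proof (cases "A k a")
    case None
    with * show ?thesis by simp
  next
    case (Some d)
    with * show ?thesis by (intro that[of d]) auto
  qed
qed

lemma ks_s:
  assumes "ks_pair A k s"
  obtains d where "tapp A (A s a) (Some b) = Some d"
    "\<And>c z. tapp A (A a c) (A b c) = Some z \<Longrightarrow> A d c = Some z"
proof -
  obtain d where d: "tapp A (A s a) (Some b) = Some d"
    using assms by (fastforce simp: ks_pair_def)
  show thesis
  proof (rule that[OF d])
    fix c z assume "tapp A (A a c) (A b c) = Some z"
    moreover have "tapp A (A a c) (A b c) \<noteq> None \<longrightarrow>
        tapp A (tapp A (A s a) (Some b)) (Some c) = tapp A (A a c) (A b c)"
      using assms by (simp add: ks_pair_def)
    ultimately show "A d c = Some z" using d by simp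
  qed
qed

text \<open>The abstraction has a value even where \<open>t\<close> has none, because
  \<open>k a\<close> and \<open>s a b\<close> are always defined. Partiality returns only when the
  argument is supplied.\<close>

lemma peval_pabs:
  assumes "ks_pair A k s"
  shows "\<exists>d. peval A e (pabs k s n t) = Some d \<and>
    (\<forall>x z. peval A (e(n := x)) t = Some z \<longrightarrow> A d x = Some z)"
proof (induction t)
  case (PVar m)
  obtain d where d: "A k (e m) = Some d" "\<And>b. A d b = Some (e m)" using ks_k[OF assms] by metis
  obtain i where i: "tapp A (A s k) (Some k) = Some i"
     "\<And>c z. tapp A (A k c) (A k c) = Some z \<Longrightarrow> A i c = Some z" using ks_s[OF assms] by metis
  have "A i x = Some x" for x
    by (rule ks_k[OF assms, of x]) (auto intro: i)
  with d i(1) show ?case by auto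
next
  case (PCon a)
  obtain d where d: "A k a = Some d" "\<And>b. A d b = Some a" using ks_k[OF assms] by metis
  then show ?case by auto
next
  case (PApp t u)
  then obtain d1 d2 where
    1: "peval A e (pabs k s n t) = Some d1"
       "\<And>x z. peval A (e(n := x)) t = Some z \<Longrightarrow> A d1 x = Some z" and
    2: "peval A e (pabs k s n u) = Some d2"
       "\<And>x z. peval A (e(n := x)) u = Some z \<Longrightarrow> A d2 x = Some z" by blast
  obtain d where d: "tapp A (A s d1) (Some d2) = Some d"
     "\<And>c z. tapp A (A d1 c) (A d2 c) = Some z \<Longrightarrow> A d c = Some z" using ks_s[OF assms] by metis
  have *: "A d x = Some z" if "peval A (e(n := x)) (PApp t u) = Some z" for x z
  proof -
    from that have "tapp A (peval A (e(n := x)) t) (peval A (e(n := x)) u) = Some z" by simp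
    then obtain a b where "peval A (e(n := x)) t = Some a" "peval A (e(n := x)) u = Some b" "A a b = Some z"
      by (rule tapp_SomeE)
    then show ?thesis using 1(2) 2(2) by (intro d) simp
  qed
  have "peval A e (pabs k s n (PApp t u)) = Some d" using d(1) 1(1) 2(1) by simp
  with * show ?case by blast
qed

lemma pca_ks: "pca A \<Longrightarrow> \<exists>k s. ks_pair A k s"
  by (simp add: pca_def ks_pair_def)

lemma combinatory_completeness1:
  assumes "pca A"
  obtains c where "\<And>x z. peval A (\<lambda>_. x) t = Some z \<Longrightarrow> A c x = Some z"
proof -
  obtain k s where ks: "ks_pair A k s" using pca_ks[OF assms] by blast
  \<comment> \<open>All variables of \<open>t\<close> are read as the same element, so they are
    merged into the variable 0, and a single abstraction suffices.\<close>
  define t' where "t' = rec_pterm (\<lambda>_. PVar 0) PCon (\<lambda>_ _. PApp) t"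
  have t': "peval A e t' = peval A (\<lambda>_. e 0) t" for e
    unfolding t'_def by (induction t) auto
  obtain c where "\<And>x z. peval A ((\<lambda>_. undefined)(0 := x)) t' = Some z \<Longrightarrow> A c x = Some z"
    using peval_pabs[OF ks] by blast
  then show thesis by (intro that[of c]) (simp add: t')
qed

lemma combinatory_completeness2:
  assumes "pca A"
  obtains c where
    "\<And>x. \<exists>d. A c x = Some d \<and>
      (\<forall>y z. peval A (\<lambda>n. if n = 0 then x else if n = 1 then y else undefined) t = Some z \<longrightarrow> A d y = Some z)"
proof -
  obtain k s where ks: "ks_pair A k s" using pca_ks[OF assms] by blast
  \<comment> \<open>Environments are total, so the variables that do not matter need some
    value.\<close>
  define u where "u = (\<lambda>_::nat. undefined :: 'a)"
  obtain c where c: "\<And>x z. peval A (u(0 := x)) (pabs k s 1 t) = Some z \<Longrightarrow> A c x = Some z"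
    using peval_pabs[OF ks, of u 0 "pabs k s 1 t"] by blast
  show thesis
  proof (rule that[of c])
    fix x
    obtain d where d: "peval A (u(0 := x)) (pabs k s 1 t) = Some d"
      "\<And>y z. peval A (u(0 := x, 1 := y)) t = Some z \<Longrightarrow> A d y = Some z"
      using peval_pabs[OF ks, of "u(0 := x)" 1 t] by blast
    have "u(0 := x, 1 := y) = (\<lambda>n. if n = 0 then x else if n = 1 then y else undefined)" for y
      by (auto simp: u_def)
    with d c show "\<exists>d. A c x = Some d \<and>
      (\<forall>y z. peval A (\<lambda>n. if n = 0 then x else if n = 1 then y else undefined) t = Some z \<longrightarrow> A d y = Some z)"
      by metis
  qed
qed

section \<open>Pairing and conjunction of sets of realizers\<close>

definition is_pairing :: "'a papp \<Rightarrow> ('a \<Rightarrow> 'a \<Rightarrow> 'a) \<Rightarrow> bool" where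
  "is_pairing A f \<longleftrightarrow> (\<exists>p. \<forall>x y. tapp A (A p x) (Some y) = Some (f x y)) \<and>
     (\<exists>l. \<forall>x y. A l (f x y) = Some x) \<and> (\<exists>r. \<forall>x y. A r (f x y) = Some y)"

text \<open>Fixing one pairing function for each pca makes \<open>both\<close> an operation on sets
  that does not mention combinators; it is used only through \<open>is_pairing\<close>.\<close>

definition pairing :: "'a papp \<Rightarrow> 'a \<Rightarrow> 'a \<Rightarrow> 'a" where
  "pairing A = (SOME f. is_pairing A f)"

text \<open>The Church pair, which sends a selector w to w x y. Applied to \<open>k\<close> or to
  \<open>q\<close> it yields a component. The selector is variable 2 and is abstracted first, so
  that the pair itself is always defined.\<close>

lemma is_pairing_pairing:
  assumes "pca A"
  shows "is_pairing A (pairing A)"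
proof -
  obtain k s where ks: "ks_pair A k s" using pca_ks[OF assms] by blast
  define e where "e = (\<lambda>x y (n::nat). if n = 0 then x else if n = 1 then y else (undefined :: 'a))"
  define t :: "'a pterm" where "t = PApp (PApp (PVar 2) (PVar 0)) (PVar 1)"
  obtain c where c:
    "\<And>x. \<exists>d. A c x = Some d \<and> (\<forall>y z. peval A (e x y) (pabs k s 2 t) = Some z \<longrightarrow> A d y = Some z)"
    unfolding e_def using combinatory_completeness2[OF assms] by metis
  have "\<exists>d. peval A (e x y) (pabs k s 2 t) = Some d \<and>
      (\<forall>w z. tapp A (A w x) (Some y) = Some z \<longrightarrow> A d w = Some z)" for x y
    using peval_pabs[OF ks, of "e x y" 2 t] by (simp add: t_def e_def)
  then obtain f where f: "\<And>x y. peval A (e x y) (pabs k s 2 t) = Some (f x y)"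
    "\<And>x y w z. tapp A (A w x) (Some y) = Some z \<Longrightarrow> A (f x y) w = Some z" by metis
  have 1: "tapp A (A c x) (Some y) = Some (f x y)" for x y
    using c[of x] f(1)[of x y] by auto
  obtain q where q: "\<And>x. \<exists>d. A q x = Some d \<and> (\<forall>y z. peval A (e x y) (PVar 1) = Some z \<longrightarrow> A d y = Some z)"
    unfolding e_def using combinatory_completeness2[OF assms] by metis
  have q': "tapp A (A q x) (Some y) = Some y" for x y
    using q[of x] by (auto simp: e_def)
  have k': "tapp A (A k x) (Some y) = Some x" for x y
    using ks by (simp add: ks_pair_def)
  have sel: "\<exists>l. \<forall>x y. A l (f x y) = Some (g x y)" if "\<And>x y. tapp A (A w x) (Some y) = Some (g x y)" for w g
  proof -
    obtain l where l: "\<And>x z. peval A (\<lambda>_. x) (PApp (PVar 0) (PCon w)) = Some z \<Longrightarrow> A l x = Some z"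
      using combinatory_completeness1[OF assms] by blast
    then show ?thesis using f(2)[OF that] by (intro exI[of _ l]) simp
  qed
  have "is_pairing A f"
    unfolding is_pairing_def using 1 sel[OF k'] sel[OF q'] by blast
  then show ?thesis unfolding pairing_def by (rule someI[of "is_pairing A"])
qed

definition both :: "'a papp \<Rightarrow> 'a set \<Rightarrow> 'a set \<Rightarrow> 'a set" where
  "both A S T = (\<lambda>(x, y). pairing A x y) ` (S \<times> T)"

lemma both_empty [simp]: "both A {} T = {}" "both A S {} = {}"
  by (auto simp: both_def)

lemma both_eq_empty_iff [simp]: "both A S T = {} \<longleftrightarrow> S = {} \<or> T = {}"
  by (auto simp: both_def)

section \<open>Entailment between families of sets of realizers\<close>

text \<open>Over an arbitrary index type, \<^const>\<open>morphism_le\<close> is entailment between predicates valued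
  in sets of realizers; \<^const>\<open>both\<close> is conjunction and union is existential quantification.\<close>

lemma morphism_leI:
  "(\<And>i b. b \<in> \<phi> i \<Longrightarrow> \<exists>y\<in>\<psi> i. A s b = Some y) \<Longrightarrow> morphism_le A \<phi> \<psi>"
  by (auto simp: morphism_le_def)

lemma morphism_leE:
  assumes "morphism_le A \<phi> \<psi>"
  obtains s where "\<And>i b. b \<in> \<phi> i \<Longrightarrow> \<exists>y\<in>\<psi> i. A s b = Some y"
  using assms by (auto simp: morphism_le_def)

lemma le_ne: "morphism_le A \<phi> \<psi> \<Longrightarrow> \<phi> i \<noteq> {} \<Longrightarrow> \<psi> i \<noteq> {}"
  by (auto simp: morphism_le_def)

lemma le_reindex: "morphism_le A \<phi> \<psi> \<Longrightarrow> morphism_le A (\<lambda>i. \<phi> (f i)) (\<lambda>i. \<psi> (f i))"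
  by (auto simp: morphism_le_def)

lemma le_sub:
  assumes "pca A" "\<And>i. \<phi> i \<subseteq> \<psi> i"
  shows "morphism_le A \<phi> \<psi>"
proof -
  obtain c where "\<And>x z. peval A (\<lambda>_. x) (PVar 0) = Some z \<Longrightarrow> A c x = Some z"
    using combinatory_completeness1[OF assms(1)] by blast
  with assms(2) show ?thesis by (intro morphism_leI[of _ _ _ c]) fastforce
qed

lemma le_refl: "pca A \<Longrightarrow> morphism_le A \<phi> \<phi>"
  by (rule le_sub) auto

lemma le_const:
  assumes "pca A" "\<And>i. \<phi> i \<noteq> {} \<Longrightarrow> a \<in> \<psi> i"
  shows "morphism_le A \<phi> \<psi>"
proof -
  obtain c where "\<And>x z. peval A (\<lambda>_. x) (PCon a) = Some z \<Longrightarrow> A c x = Some z"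
    using combinatory_completeness1[OF assms(1)] by blast
  with assms(2) show ?thesis by (intro morphism_leI[of _ _ _ c]) fastforce
qed

lemma le_trans:
  assumes "pca A" "morphism_le A \<phi> \<psi>" "morphism_le A \<psi> \<chi>"
  shows "morphism_le A \<phi> \<chi>"
proof -
  obtain s t where s: "\<And>i b. b \<in> \<phi> i \<Longrightarrow> \<exists>y\<in>\<psi> i. A s b = Some y"
    and t: "\<And>i b. b \<in> \<psi> i \<Longrightarrow> \<exists>y\<in>\<chi> i. A t b = Some y"
    using assms(2,3) by (elim morphism_leE) blast
  obtain c where "\<And>x z. peval A (\<lambda>_. x) (PApp (PCon t) (PApp (PCon s) (PVar 0))) = Some z \<Longrightarrow> A c x = Some z"
    using combinatory_completeness1[OF assms(1)] by blast
  with s t show ?thesis by (intro morphism_leI[of _ _ _ c]) fastforce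
qed

lemma le_bothI:
  assumes "pca A" "morphism_le A \<phi> \<psi>" "morphism_le A \<phi> \<chi>"
  shows "morphism_le A \<phi> (\<lambda>i. both A (\<psi> i) (\<chi> i))"
proof -
  obtain s t where s: "\<And>i b. b \<in> \<phi> i \<Longrightarrow> \<exists>y\<in>\<psi> i. A s b = Some y"
    and t: "\<And>i b. b \<in> \<phi> i \<Longrightarrow> \<exists>y\<in>\<chi> i. A t b = Some y"
    using assms(2,3) by (elim morphism_leE) blast
  obtain p where p: "\<And>x y. tapp A (A p x) (Some y) = Some (pairing A x y)"
    using is_pairing_pairing[OF assms(1)] by (auto simp: is_pairing_def)
  obtain c where c: "\<And>x z. peval A (\<lambda>_. x) (PApp (PApp (PCon p) (PApp (PCon s) (PVar 0))) (PApp (PCon t) (PVar 0))) = Some z \<Longrightarrow> A c x = Some z"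
    using combinatory_completeness1[OF assms(1)] by blast
  show ?thesis
  proof (rule morphism_leI[of _ _ _ c])
    fix i b assume "b \<in> \<phi> i"
    then obtain y z where yz: "y \<in> \<psi> i" "A s b = Some y" "z \<in> \<chi> i" "A t b = Some z" using s t by blast
    then have "A c b = Some (pairing A y z)" by (intro c) (simp add: p)
    with yz show "\<exists>y\<in>both A (\<psi> i) (\<chi> i). A c b = Some y" by (auto simp: both_def)
  qed
qed

lemma both_le1: "pca A \<Longrightarrow> morphism_le A (\<lambda>i. both A (\<phi> i) (\<psi> i)) \<phi>"
  using is_pairing_pairing[of A] by (fastforce simp: is_pairing_def both_def morphism_le_def)

lemma both_le2: "pca A \<Longrightarrow> morphism_le A (\<lambda>i. both A (\<phi> i) (\<psi> i)) \<psi>"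
  using is_pairing_pairing[of A] by (fastforce simp: is_pairing_def both_def morphism_le_def)

lemma le_both1: "pca A \<Longrightarrow> morphism_le A \<phi> (\<lambda>i. both A (\<psi> i) (\<chi> i)) \<Longrightarrow> morphism_le A \<phi> \<psi>"
  by (rule le_trans[OF _ _ both_le1])

lemma le_both2: "pca A \<Longrightarrow> morphism_le A \<phi> (\<lambda>i. both A (\<psi> i) (\<chi> i)) \<Longrightarrow> morphism_le A \<phi> \<chi>"
  by (rule le_trans[OF _ _ both_le2])

text \<open>A realizer of a union does not reveal the index \<open>j\<close>, so the hypothesis asks
  for one realizer uniform in both indices.\<close>

lemma le_ex_left:
  "morphism_le A (\<lambda>p. \<phi> (fst p) (snd p)) (\<lambda>p. \<chi> (fst p)) \<Longrightarrow> morphism_le A (\<lambda>i. \<Union>j. \<phi> i j) \<chi>"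
  by (fastforce simp: morphism_le_def)

text \<open>Elimination of an existential in a context. The context survives because conjunction
  distributes over unions, here even as an equality of sets.\<close>

lemma le_exE:
  assumes "pca A" "morphism_le A \<phi> (\<lambda>i. \<Union>j. \<psi> i j)"
    "morphism_le A (\<lambda>p. both A (\<phi> (fst p)) (\<psi> (fst p) (snd p))) (\<lambda>p. \<chi> (fst p))"
  shows "morphism_le A \<phi> \<chi>"
proof -
  have "morphism_le A \<phi> (\<lambda>i. both A (\<phi> i) (\<Union>j. \<psi> i j))"
    by (rule le_bothI[OF assms(1) le_refl[OF assms(1)] assms(2)])
  also have "(\<lambda>i. both A (\<phi> i) (\<Union>j. \<psi> i j)) = (\<lambda>i. \<Union>j. both A (\<phi> i) (\<psi> i j))"
    by (auto simp: both_def fun_eq_iff)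
  finally show ?thesis by (rule le_trans[OF assms(1) _ le_ex_left[OF assms(3)]])
qed

text \<open>The witness \<open>f\<close> may be any function, computable or not, as realizers of a
  union carry no information on the index.\<close>

lemma le_exI:
  assumes "pca A" "morphism_le A \<phi> (\<lambda>i. \<psi> i (f i))"
  shows "morphism_le A \<phi> (\<lambda>i. \<Union>j. \<psi> i j)"
  by (rule le_trans[OF assms le_sub[OF assms(1)]]) auto

section \<open>Transport of entailments along an applicative morphism\<close>

lemma img_le:
  assumes "pca B" "applicative_morphism A B \<gamma>" "morphism_le A \<phi> \<psi>"
  shows "morphism_le B (\<lambda>i. \<Union>(\<gamma> ` \<phi> i)) (\<lambda>i. \<Union>(\<gamma> ` \<psi> i))"
proof -
  obtain s where s: "\<And>i b. b \<in> \<phi> i \<Longrightarrow> \<exists>y\<in>\<psi> i. A s b = Some y"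
    using assms(3) by (elim morphism_leE) blast
  obtain r where r: "\<And>a a' c b b'. A a a' = Some c \<Longrightarrow> b \<in> \<gamma> a \<Longrightarrow> b' \<in> \<gamma> a' \<Longrightarrow> \<exists>y\<in>\<gamma> c. tapp B (B r b) (Some b') = Some y"
    and ne: "\<And>a. \<gamma> a \<noteq> {}"
    using assms(2) unfolding applicative_morphism_def by blast
  \<comment> \<open>An element of \<open>\<gamma> s\<close> represents the realizer \<open>s\<close>
    inside \<open>B\<close>; applying \<open>r\<close> to it simulates \<open>s\<close>.\<close>
  obtain t where t: "t \<in> \<gamma> s" using ne by blast
  obtain c where c: "\<And>x z. peval B (\<lambda>_. x) (PApp (PApp (PCon r) (PCon t)) (PVar 0)) = Some z \<Longrightarrow> B c x = Some z"
    using combinatory_completeness1[OF assms(1)] by blast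
  show ?thesis
  proof (rule morphism_leI[of _ _ _ c])
    fix i b assume "b \<in> \<Union>(\<gamma> ` \<phi> i)"
    then obtain a where a: "a \<in> \<phi> i" "b \<in> \<gamma> a" by auto
    then obtain d where d: "d \<in> \<psi> i" "A s a = Some d" using s by blast
    obtain y where y: "y \<in> \<gamma> d" "tapp B (B r t) (Some b) = Some y" using r[OF d(2) t a(2)] by blast
    then have "B c b = Some y" by (intro c) simp
    with y d show "\<exists>y\<in>\<Union>(\<gamma> ` \<psi> i). B c b = Some y" by auto
  qed
qed

text \<open>Two uses of \<open>r\<close> simulate in \<open>B\<close> the pairing combinator of
  \<open>A\<close>. This is the substantial half of the preservation of conjunctions; the other half
  is monotonicity of the image.\<close>

lemma img_both_le:
  assumes "pca A" "pca B" "applicative_morphism A B \<gamma>"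
  shows "morphism_le B (\<lambda>i. both B (\<Union>(\<gamma> ` \<phi> i)) (\<Union>(\<gamma> ` \<psi> i)))
    (\<lambda>i. \<Union>(\<gamma> ` both A (\<phi> i) (\<psi> i)))"
proof -
  obtain p where p: "\<And>x y. tapp A (A p x) (Some y) = Some (pairing A x y)"
    using is_pairing_pairing[OF assms(1)] by (auto simp: is_pairing_def)
  obtain r where r: "\<And>a a' c b b'. A a a' = Some c \<Longrightarrow> b \<in> \<gamma> a \<Longrightarrow> b' \<in> \<gamma> a' \<Longrightarrow> \<exists>y\<in>\<gamma> c. tapp B (B r b) (Some b') = Some y"
    and ne: "\<And>a. \<gamma> a \<noteq> {}"
    using assms(3) unfolding applicative_morphism_def by blast
  obtain t where t: "t \<in> \<gamma> p" using ne by blast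
  obtain l where l: "\<And>x y. B l (pairing B x y) = Some x"
    using is_pairing_pairing[OF assms(2)] by (auto simp: is_pairing_def)
  obtain q where q: "\<And>x y. B q (pairing B x y) = Some y"
    using is_pairing_pairing[OF assms(2)] by (auto simp: is_pairing_def)
  obtain c where c: "\<And>x z. peval B (\<lambda>_. x)
     (PApp (PApp (PCon r) (PApp (PApp (PCon r) (PCon t)) (PApp (PCon l) (PVar 0)))) (PApp (PCon q) (PVar 0))) = Some z \<Longrightarrow> B c x = Some z"
    using combinatory_completeness1[OF assms(2)] by blast
  show ?thesis
  proof (rule morphism_leI[of _ _ _ c])
    fix i b assume "b \<in> both B (\<Union>(\<gamma> ` \<phi> i)) (\<Union>(\<gamma> ` \<psi> i))"
    then obtain a a' x x' where a: "a \<in> \<phi> i" "x \<in> \<gamma> a" "a' \<in> \<psi> i" "x' \<in> \<gamma> a'" "b = pairing B x x'"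
      by (auto simp: both_def)
    obtain d where d: "A p a = Some d" "A d a' = Some (pairing A a a')"
      using p[of a a'] by (auto elim: tapp_SomeE)
    obtain y where y: "y \<in> \<gamma> d" "tapp B (B r t) (Some x) = Some y" using r[OF d(1) t a(2)] by blast
    obtain z where z: "z \<in> \<gamma> (pairing A a a')" "tapp B (B r y) (Some x') = Some z"
      using r[OF d(2) y(1) a(4)] by blast
    have "B c b = Some z" using y z by (intro c) (simp add: a l q)
    with z a show "\<exists>y\<in>\<Union>(\<gamma> ` both A (\<phi> i) (\<psi> i)). B c b = Some y"
      by (auto simp: both_def)
  qed
qed

section \<open>Relations between assemblies\<close>

abbreviation src :: "('u, 'a) assembly_arr \<Rightarrow> ('u, 'a) assembly" where "src f \<equiv> fst f"
abbreviation trg :: "('u, 'a) assembly_arr \<Rightarrow> ('u, 'a) assembly" where "trg f \<equiv> snd (snd f)"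
abbreviation fn :: "('u, 'a) assembly_arr \<Rightarrow> 'u \<Rightarrow> 'u" where "fn f \<equiv> fst (snd f)"
abbreviation pts :: "('u, 'a) assembly \<Rightarrow> 'u set" where "pts X \<equiv> fst X"
abbreviation rz :: "('u, 'a) assembly \<Rightarrow> 'u \<Rightarrow> 'a set" where "rz X \<equiv> snd X"

text \<open>The realizers of the statement that \<open>x\<close> and \<open>y\<close> are related by \<open>S\<close>.  Here and below, points
  outside an assembly have no realizers, so that membership need not be mentioned.\<close>

definition span_rz :: "('u, 'a) assembly_arr span \<Rightarrow> 'u \<Rightarrow> 'u \<Rightarrow> 'a set" where
  "span_rz S x y = {b. \<exists>w. b \<in> rz (src (fst S)) w \<and> fn (fst S) w = x \<and> fn (snd S) w = y}"

definition rel_le :: "'a papp \<Rightarrow> ('u \<Rightarrow> 'u \<Rightarrow> 'a set) \<Rightarrow> ('u \<Rightarrow> 'u \<Rightarrow> 'a set) \<Rightarrow> bool" where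
  "rel_le A \<rho> \<sigma> \<longleftrightarrow> morphism_le A (\<lambda>p. \<rho> (fst p) (snd p)) (\<lambda>p. \<sigma> (fst p) (snd p))"

lemma rel_leD: "rel_le A \<rho> \<sigma> \<Longrightarrow> morphism_le A (\<lambda>i. \<rho> (f i) (g i)) (\<lambda>i. \<sigma> (f i) (g i))"
  unfolding rel_le_def by (drule le_reindex[where f = "\<lambda>i. (f i, g i)"]) simp

text \<open>Indices without realizers on the left impose nothing, so a function may be exchanged for
  another that agrees with it on the points, such as its restriction.\<close>

lemma le_cong_ne:
  "(\<And>i. \<phi> i \<noteq> {} \<Longrightarrow> \<psi> i = \<chi> i) \<Longrightarrow> morphism_le A \<phi> \<psi> \<longleftrightarrow> morphism_le A \<phi> \<chi>"
  unfolding morphism_le_def by (metis equals0D)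

lemma small_Times:
  assumes "set_universe \<U>" "small \<U> S" "small \<U> T"
  shows "small \<U> (S \<times> T)"
proof -
  obtain X Y where "X \<in> \<U>" "Y \<in> \<U>" "S \<approx> X" "T \<approx> Y" using assms(2,3) by (auto simp: small_def)
  moreover from this(1,2) obtain Z where "Z \<in> \<U>" "X \<times> Y \<approx> Z"
    using assms(1) unfolding set_universe_def by metis
  ultimately show ?thesis unfolding small_def using eqpoll_trans[OF times_eqpoll_cong] by blast
qed

lemma small_subset:
  assumes "set_universe \<U>" "small \<U> T" "S \<subseteq> T"
  shows "small \<U> S"
proof -
  obtain Z f where Z: "Z \<in> \<U>" "bij_betw f T Z" using assms(2) by (auto simp: small_def eqpoll_def)
  then have "f ` S \<subseteq> Z" using assms(3) by (auto simp: bij_betw_def)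
  with Z(1) have "f ` S \<in> \<U>" using assms(1) unfolding set_universe_def by metis
  moreover have "S \<approx> f ` S"
    unfolding eqpoll_def using Z(2) assms(3) by (intro exI[of _ f]) (auto simp: bij_betw_def intro: inj_on_subset)
  ultimately show ?thesis by (auto simp: small_def)
qed

lemma small_mem: "X \<in> \<U> \<Longrightarrow> small \<U> X"
  by (auto simp: small_def)

section \<open>Assemblies, their arrows and presented families\<close>

locale assemblies =
  fixes \<U> :: "'u set set" and A :: "'a papp"
  assumes univ: "set_universe \<U>" and pca: "pca A"
begin

abbreviation C where "C \<equiv> Ass \<U> A"

lemma Ass_simps [simp]:
  "Dom C f = src f" "Cod C f = trg f"
  "g \<cdot>\<^bsub>C\<^esub> f = (src f, compose (pts (src f)) (fn g) (fn f), trg g)"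
  "Ident C X = (X, restrict id (pts X), X)"
  "X \<in> Obj C \<longleftrightarrow> is_assembly \<U> X"
  by (auto simp: Ass_def split: prod.splits)

lemma asm_mem: "is_assembly \<U> X \<Longrightarrow> x \<in> pts X \<longleftrightarrow> rz X x \<noteq> {}"
  by (auto simp: is_assembly_def split: prod.splits)

lemma tracked_iff:
  assumes "is_assembly \<U> X"
  shows "tracked A X Y f \<longleftrightarrow> morphism_le A (rz X) (\<lambda>x. rz Y (f x))"
  using asm_mem[OF assms] unfolding tracked_def morphism_le_def by fastforce

lemma arr_iff: "f \<in> Arr C \<longleftrightarrow> is_assembly \<U> (src f) \<and> is_assembly \<U> (trg f) \<and>
    fn f \<in> pts (src f) \<rightarrow>\<^sub>E pts (trg f) \<and> morphism_le A (rz (src f)) (\<lambda>x. rz (trg f) (fn f x))"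
  by (cases f) (auto simp: Ass_def tracked_iff)

text \<open>That \<open>f\<close> maps points to points is a consequence: an entailment preserves
  inhabitedness, and the points are exactly the elements that have realizers.\<close>

lemma mk_arr:
  assumes "is_assembly \<U> X" "is_assembly \<U> Y" "morphism_le A (rz X) (\<lambda>x. rz Y (f x))"
  shows "(X, restrict f (pts X), Y) \<in> Arr C"
proof -
  have "f x \<in> pts Y" if "x \<in> pts X" for x
    using le_ne[OF assms(3)] that assms(1,2) asm_mem by blast
  moreover have "morphism_le A (rz X) (\<lambda>x. rz Y (restrict f (pts X) x))"
    using assms(3) by (subst le_cong_ne[where \<chi> = "\<lambda>x. rz Y (f x)"]) (auto simp: asm_mem[OF assms(1)])
  ultimately show ?thesis using assms by (auto simp: arr_iff)
qed

lemma arr_eqI: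
  assumes "f \<in> Arr C" "g \<in> Arr C" "src f = src g" "trg f = trg g"
    "\<And>x. x \<in> pts (src f) \<Longrightarrow> fn f x = fn g x"
  shows "f = g"
proof -
  have "fn f = fn g" using assms by (intro PiE_ext[of _ "pts (src f)" "\<lambda>_. pts (trg f)"]) (auto simp: arr_iff)
  with assms show ?thesis by (simp add: prod_eq_iff)
qed

lemma arr_mem: "f \<in> Arr C \<Longrightarrow> x \<in> pts (src f) \<Longrightarrow> fn f x \<in> pts (trg f)"
  by (auto simp: arr_iff)

lemma arr_le: "f \<in> Arr C \<Longrightarrow> morphism_le A (rz (src f)) (\<lambda>x. rz (trg f) (fn f x))"
  by (auto simp: arr_iff)

lemma arr_asm: "f \<in> Arr C \<Longrightarrow> is_assembly \<U> (src f)" "f \<in> Arr C \<Longrightarrow> is_assembly \<U> (trg f)"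
  by (auto simp: arr_iff)

lemma comp_arr:
  assumes "f \<in> Arr C" "g \<in> Arr C" "trg f = src g"
  shows "g \<cdot>\<^bsub>C\<^esub> f \<in> Arr C"
proof -
  have "morphism_le A (rz (src f)) (\<lambda>x. rz (trg g) (fn g (fn f x)))"
    using arr_le[OF assms(1)] le_reindex[OF arr_le[OF assms(2)], of "fn f"] assms(3)
    by (auto intro: le_trans[OF pca])
  then have "(src f, restrict (\<lambda>x. fn g (fn f x)) (pts (src f)), trg g) \<in> Arr C"
    using assms by (intro mk_arr) (auto simp: arr_iff)
  then show ?thesis by (simp add: compose_def)
qed

text \<open>The pair \<open>T, j\<close> codes the family \<open>\<phi>\<close> as an assembly with points in the universe.\<close>

definition presents :: "('i \<Rightarrow> 'a set) \<Rightarrow> ('u, 'a) assembly \<Rightarrow> ('i \<Rightarrow> 'u) \<Rightarrow> bool" where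
  "presents \<phi> T j \<longleftrightarrow> is_assembly \<U> T \<and> inj_on j {i. \<phi> i \<noteq> {}} \<and> pts T = j ` {i. \<phi> i \<noteq> {}} \<and>
     (\<forall>i. \<phi> i \<noteq> {} \<longrightarrow> rz T (j i) = \<phi> i)"

text \<open>Only inhabited indices are coded, so the index type may be too large for the universe as
  long as the support of the family is small.\<close>

lemma presents_exists:
  assumes "small \<U> {i. \<phi> i \<noteq> {}}"
  obtains T j where "presents \<phi> T j"
proof -
  let ?I = "{i. \<phi> i \<noteq> {}}"
  obtain Z j where Z: "Z \<in> \<U>" "bij_betw j ?I Z" using assms by (auto simp: small_def eqpoll_def)
  define E where "E = (\<lambda>z. if z \<in> Z then \<phi> (inv_into ?I j z) else {})"
  have E: "E (j i) = \<phi> i" if "\<phi> i \<noteq> {}" for i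
    using that Z(2) by (auto simp: E_def bij_betw_def)
  have "E z \<noteq> {}" if "z \<in> Z" for z
    using that Z(2) inv_into_into[of z j ?I] by (auto simp: E_def bij_betw_def)
  then have "is_assembly \<U> (Z, E)" using Z(1) by (auto simp: is_assembly_def E_def)
  then have "presents \<phi> (Z, E) j"
    using Z(2) E unfolding presents_def bij_betw_def by simp
  then show thesis by (rule that)
qed

lemma presentsD:
  assumes "presents \<phi> T j"
  shows "is_assembly \<U> T" "\<phi> i \<noteq> {} \<Longrightarrow> rz T (j i) = \<phi> i"
    "t \<in> pts T \<Longrightarrow> \<exists>i. \<phi> i \<noteq> {} \<and> t = j i" "\<phi> i \<noteq> {} \<Longrightarrow> j i \<in> pts T"
    "\<phi> i \<noteq> {} \<Longrightarrow> inv_into {i. \<phi> i \<noteq> {}} j (j i) = i"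
  using assms unfolding presents_def by (simp, simp, force, simp, simp add: inv_into_f_f)

lemma presents_arr:
  assumes T: "presents \<phi> T j" and "is_assembly \<U> X" "morphism_le A \<phi> (\<lambda>i. rz X (f i))"
  obtains a where "a \<in> Arr C" "src a = T" "trg a = X" "\<And>i. \<phi> i \<noteq> {} \<Longrightarrow> fn a (j i) = f i"
proof -
  let ?I = "{i. \<phi> i \<noteq> {}}"
  let ?g = "\<lambda>t. f (inv_into ?I j t)"
  note inv = presentsD(5)[OF T] and asm = presentsD(1)[OF T]
  have rz: "rz T t = \<phi> (inv_into ?I j t)" if "rz T t \<noteq> {}" for t
    using presentsD(2,3)[OF T] that asm_mem[OF asm, of t] inv by metis
  have "morphism_le A (\<lambda>t. \<phi> (inv_into ?I j t)) (\<lambda>t. rz X (?g t))"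
    by (rule le_reindex[OF assms(3)])
  then have "morphism_le A (rz T) (\<lambda>t. rz X (?g t))"
    using rz unfolding morphism_le_def by (metis equals0D)
  then have "(T, restrict ?g (pts T), X) \<in> Arr C" using asm assms(2) by (intro mk_arr) auto
  moreover have "restrict ?g (pts T) (j i) = f i" if "\<phi> i \<noteq> {}" for i
    using presentsD(4)[OF T that] inv[OF that] by simp
  ultimately show thesis by (intro that[of "(T, restrict ?g (pts T), X)"]) auto
qed

lemma presents_le:
  assumes T: "presents \<phi> T j" and "morphism_le A (rz T) \<psi>" "\<And>i. \<phi> i \<noteq> {} \<Longrightarrow> \<psi> (j i) = \<chi> i"
  shows "morphism_le A \<phi> \<chi>"
proof -
  have "morphism_le A (\<lambda>i. rz T (j i)) (\<lambda>i. \<psi> (j i))" by (rule le_reindex[OF assms(2)])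
  then show ?thesis using T assms(3) unfolding presents_def morphism_le_def by (metis equals0D)
qed

section \<open>Relations between assemblies and their realizers\<close>

lemma is_relation_iff: "is_relation C X Y S \<longleftrightarrow>
   fst S \<in> Arr C \<and> snd S \<in> Arr C \<and> src (fst S) = src (snd S) \<and> trg (fst S) = X \<and> trg (snd S) = Y \<and>
   (\<forall>w\<in>pts (src (fst S)). \<forall>w'\<in>pts (src (fst S)).
      fn (fst S) w = fn (fst S) w' \<and> fn (snd S) w = fn (snd S) w' \<longrightarrow> w = w')" (is "?L \<longleftrightarrow> ?R")
proof
  assume L: ?L
  obtain p q where S: "S = (p, q)" by (meson surj_pair)
  have *: "p \<in> Arr C" "q \<in> Arr C" "src p = src q" "trg p = X" "trg q = Y"
    and jm: "\<And>h h'. h \<in> Arr C \<Longrightarrow> h' \<in> Arr C \<Longrightarrow> src h = src h' \<Longrightarrow> trg h = src p \<Longrightarrow> trg h' = src p \<Longrightarrow>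
      p \<cdot>\<^bsub>C\<^esub> h = p \<cdot>\<^bsub>C\<^esub> h' \<Longrightarrow> q \<cdot>\<^bsub>C\<^esub> h = q \<cdot>\<^bsub>C\<^esub> h' \<Longrightarrow> h = h'"
    using L unfolding is_relation_def S by auto
  have "w = w'" if w: "w \<in> pts (src p)" "w' \<in> pts (src p)" and eq: "fn p w = fn p w'" "fn q w = fn q w'" for w w'
  proof -
    \<comment> \<open>Points are separated by arrows from a one-point assembly. If its point is
      realized by every element, a constant realizer tracks the arrow to any chosen point.\<close>
    let ?W = "src p" and ?\<phi> = "\<lambda>_::unit. UNIV :: 'a set"
    have asm: "is_assembly \<U> ?W" using * by (simp add: arr_iff)
    \<comment> \<open>The universe need not contain every singleton, but it contains this one, as a
      subset of a carrier.\<close>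
    have "{w} \<subseteq> pts ?W" "pts ?W \<in> \<U>" using w asm by (auto simp: is_assembly_def)
    then have "{w} \<in> \<U>" using univ unfolding set_universe_def by metis
    moreover have "{i. ?\<phi> i \<noteq> {}} \<approx> {w}"
      unfolding eqpoll_def by (rule exI[of _ "\<lambda>_. w"]) (auto simp: bij_betw_def inj_on_def)
    ultimately have "small \<U> {i. ?\<phi> i \<noteq> {}}" by (auto simp: small_def)
    then obtain T j where T: "presents ?\<phi> T j" by (rule presents_exists)
    have le: "morphism_le A ?\<phi> (\<lambda>i. rz ?W v)" if v: "v \<in> pts ?W" for v
    proof -
      obtain a where "a \<in> rz ?W v" using asm_mem[OF asm, THEN iffD1, OF v] by (metis ex_in_conv)
      then show ?thesis by (intro le_const[OF pca])
    qed
    obtain a where a: "a \<in> Arr C" "src a = T" "trg a = ?W" "fn a (j ()) = w"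
      using presents_arr[OF T asm le[OF w(1)]] UNIV_not_empty by metis
    obtain a' where a': "a' \<in> Arr C" "src a' = T" "trg a' = ?W" "fn a' (j ()) = w'"
      using presents_arr[OF T asm le[OF w(2)]] UNIV_not_empty by metis
    have pT: "pts T = {j ()}" using T by (simp add: presents_def UNIV_unit)
    have "compose (pts T) r (fn a) = compose (pts T) r (fn a')" if "r w = r w'" for r :: "'u \<Rightarrow> 'u"
      using that a(4) a'(4) by (auto simp: compose_def pT fun_eq_iff)
    then have "p \<cdot>\<^bsub>C\<^esub> a = p \<cdot>\<^bsub>C\<^esub> a'" "q \<cdot>\<^bsub>C\<^esub> a = q \<cdot>\<^bsub>C\<^esub> a'"
      using a(2) a'(2) eq unfolding Ass_simps by metis+
    then have "a = a'" using a(2,3) a'(2,3) by (intro jm[OF a(1) a'(1)]) simp_all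
    with a a' show "w = w'" by simp
  qed
  with * show ?R by (simp add: S)
next
  assume R: ?R
  obtain p q where S: "S = (p, q)" by (meson surj_pair)
  show ?L
    unfolding is_relation_def S prod.case
  proof (intro conjI ballI impI)
    fix h h' assume h: "h \<in> Arr C" "h' \<in> Arr C" and
      eq: "Dom C h = Dom C h' \<and> Cod C h = Dom C p \<and> Cod C h' = Dom C p \<and>
        p \<cdot>\<^bsub>C\<^esub> h = p \<cdot>\<^bsub>C\<^esub> h' \<and> q \<cdot>\<^bsub>C\<^esub> h = q \<cdot>\<^bsub>C\<^esub> h'"
    show "h = h'"
    proof (rule arr_eqI[OF h])
      fix x assume x: "x \<in> pts (src h)"
      have "compose (pts (src h)) (fn p) (fn h) x = compose (pts (src h)) (fn p) (fn h') x"
        "compose (pts (src h)) (fn q) (fn h) x = compose (pts (src h)) (fn q) (fn h') x" using eq by auto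
      then have "fn p (fn h x) = fn p (fn h' x)" "fn q (fn h x) = fn q (fn h' x)"
        using x by (auto simp: compose_def)
      moreover have "fn h x \<in> pts (src p)" "fn h' x \<in> pts (src p)"
        using x arr_mem[OF h(1)] arr_mem[OF h(2)] eq by auto
      ultimately show "fn h x = fn h' x" using R S by auto
    qed (use eq in auto)
  qed (use R S in auto)
qed

text \<open>By injectivity of the span no other point lies over the same pair, so the existential in
  \<open>span_rz\<close> collapses to \<open>w\<close>.\<close>

lemma span_rz_eq:
  assumes "is_relation C X Y S" "w \<in> pts (src (fst S))"
  shows "span_rz S (fn (fst S) w) (fn (snd S) w) = rz (src (fst S)) w"
  using assms asm_mem[of "src (fst S)"] unfolding is_relation_iff span_rz_def by (auto simp: arr_iff) blast

text \<open>A realizer of relatedness is a realizer of a point of the span, and the trackers of the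
  two legs turn it into realizers of the related points.\<close>

lemma span_rz_strict:
  assumes "is_relation C X Y S" "morphism_le A \<phi> (\<lambda>i. span_rz S (f i) (g i))"
  shows "morphism_le A \<phi> (\<lambda>i. rz X (f i))" "morphism_le A \<phi> (\<lambda>i. rz Y (g i))"
proof -
  have *: "morphism_le A (\<lambda>p. span_rz S (fst p) (snd p)) (\<lambda>p. rz X (fst p))"
    "morphism_le A (\<lambda>p. span_rz S (fst p) (snd p)) (\<lambda>p. rz Y (snd p))"
  proof -
    obtain p q where S: "S = (p, q)" by (meson surj_pair)
    have le: "morphism_le A (rz (src p)) (\<lambda>w. rz X (fn p w))" "morphism_le A (rz (src p)) (\<lambda>w. rz Y (fn q w))"
      using assms(1) arr_le[of p] arr_le[of q] by (auto simp: is_relation_iff S)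
    show "morphism_le A (\<lambda>p. span_rz S (fst p) (snd p)) (\<lambda>p. rz X (fst p))"
      using le(1) by (rule morphism_leE) (rule morphism_leI, auto simp: span_rz_def S)
    show "morphism_le A (\<lambda>p. span_rz S (fst p) (snd p)) (\<lambda>p. rz Y (snd p))"
      using le(2) by (rule morphism_leE) (rule morphism_leI, auto simp: span_rz_def S)
  qed
  show "morphism_le A \<phi> (\<lambda>i. rz X (f i))" "morphism_le A \<phi> (\<lambda>i. rz Y (g i))"
    using *[THEN le_reindex, of "\<lambda>i. (f i, g i)"] assms(2) by (auto intro: le_trans[OF pca])
qed

lemma holdsD:
  assumes "is_relation C X Y S" "holds C S x y"
  shows "x \<in> Arr C" "y \<in> Arr C" "src x = src y" "trg x = X" "trg y = Y"
proof -
  obtain p q where S: "S = (p, q)" by (meson surj_pair)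
  obtain h where h: "h \<in> Arr C" "trg h = src p" "p \<cdot>\<^bsub>C\<^esub> h = x" "q \<cdot>\<^bsub>C\<^esub> h = y"
    using assms(2) by (auto simp: holds_def S)
  show "x \<in> Arr C" "y \<in> Arr C" "src x = src y" "trg x = X" "trg y = Y"
    using h comp_arr[of h p] comp_arr[of h q] assms(1) by (auto simp: is_relation_iff S)
qed

text \<open>On points a factorization through the span is forced by injectivity, so its only content
  is a tracker, and that is the entailment.\<close>

lemma holds_iff:
  assumes S: "is_relation C X Y S" and xy: "x \<in> Arr C" "y \<in> Arr C" "src x = src y" "trg x = X" "trg y = Y"
  shows "holds C S x y \<longleftrightarrow> morphism_le A (rz (src x)) (\<lambda>t. span_rz S (fn x t) (fn y t))"
proof -
  obtain p q where pq: "S = (p, q)" by (meson surj_pair)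
  note R = S[unfolded is_relation_iff]
  have asmT: "is_assembly \<U> (src x)" using xy by (simp add: arr_iff)
  have asmW: "is_assembly \<U> (src p)" using R pq by (simp add: arr_iff)
  show ?thesis
  proof
    assume "holds C S x y"
    then obtain h where h: "h \<in> Arr C" "trg h = src p" "p \<cdot>\<^bsub>C\<^esub> h = x" "q \<cdot>\<^bsub>C\<^esub> h = y"
      by (auto simp: holds_def pq)
    have eq: "fn x t = fn p (fn h t)" "fn y t = fn q (fn h t)" if "t \<in> pts (src x)" for t
      using h that by (auto simp: compose_def)
    have "src h = src x" using h by auto
    with arr_le[OF h(1)] h(2) have "morphism_le A (rz (src x)) (\<lambda>t. rz (src p) (fn h t))" by simp
    then show "morphism_le A (rz (src x)) (\<lambda>t. span_rz S (fn x t) (fn y t))"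
    proof (subst le_cong_ne[where \<chi> = "\<lambda>t. rz (src p) (fn h t)"])
      fix t assume "rz (src x) t \<noteq> {}"
      then have t: "t \<in> pts (src x)" by (simp add: asm_mem[OF asmT])
      then have "fn h t \<in> pts (src p)" using arr_mem[OF h(1)] h by auto
      from span_rz_eq[OF S] this show "span_rz S (fn x t) (fn y t) = rz (src p) (fn h t)"
        by (simp add: pq eq[OF t])
    qed
  next
    assume le: "morphism_le A (rz (src x)) (\<lambda>t. span_rz S (fn x t) (fn y t))"
    have "\<exists>w. w \<in> pts (src p) \<and> fn p w = fn x t \<and> fn q w = fn y t" if "t \<in> pts (src x)" for t
    proof -
      have "span_rz S (fn x t) (fn y t) \<noteq> {}" using le_ne[OF le] that asm_mem[OF asmT] by blast
      then show ?thesis using asm_mem[OF asmW] by (auto simp: span_rz_def pq)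
    qed
    then obtain h where h: "\<And>t. t \<in> pts (src x) \<Longrightarrow> h t \<in> pts (src p) \<and> fn p (h t) = fn x t \<and> fn q (h t) = fn y t"
      by metis
    have eq: "span_rz S (fn x t) (fn y t) = rz (src p) (h t)" if "t \<in> pts (src x)" for t
      using span_rz_eq[OF S, of "h t"] h[OF that] by (simp add: pq)
    have "morphism_le A (rz (src x)) (\<lambda>t. rz (src p) (h t))"
      using le by (subst le_cong_ne[where \<chi> = "\<lambda>t. span_rz S (fn x t) (fn y t)"]) (auto simp: asm_mem[OF asmT, symmetric] eq)
    then have a: "(src x, restrict h (pts (src x)), src p) \<in> Arr C" (is "?a \<in> _")
      by (intro mk_arr asmT asmW)
    have pa: "p \<in> Arr C" "q \<in> Arr C" "src q = src p" "trg p = trg x" "trg q = trg y" using R pq xy by auto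
    have "p \<cdot>\<^bsub>C\<^esub> ?a = x"
      using pa xy by (intro arr_eqI comp_arr a) (auto simp: compose_def h)
    moreover have "q \<cdot>\<^bsub>C\<^esub> ?a = y"
      using pa xy by (intro arr_eqI comp_arr a) (auto simp: compose_def h)
    ultimately show "holds C S x y"
      unfolding holds_def pq prod.case by (intro bexI[OF _ a] conjI) (assumption | simp)+
  qed
qed

text \<open>The legs of \<open>S\<close> are the generic pair related by \<open>S\<close>; one
  relation is contained in another iff it holds of this pair.\<close>

lemma holds_iff_rel_le:
  assumes S: "is_relation C X Y S" and T: "is_relation C X Y T"
  shows "holds C T (fst S) (snd S) \<longleftrightarrow> rel_le A (span_rz S) (span_rz T)"
proof -
  have "holds C T (fst S) (snd S) \<longleftrightarrow>
    morphism_le A (rz (src (fst S))) (\<lambda>w. span_rz T (fn (fst S) w) (fn (snd S) w))"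
    using S by (intro holds_iff[OF T]) (auto simp: is_relation_iff)
  also have "\<dots> \<longleftrightarrow> rel_le A (span_rz S) (span_rz T)"
    unfolding morphism_le_def rel_le_def by (auto simp: span_rz_def[of S]) blast
  finally show ?thesis .
qed

text \<open>Comprehension: a family that entails the existence of both its arguments is the family
  of an actual span, on the nose and not only up to entailment.\<close>

lemma span_of_family:
  assumes "is_assembly \<U> X" "is_assembly \<U> Y"
    "morphism_le A (\<lambda>p. \<rho> (fst p) (snd p)) (\<lambda>p. rz X (fst p))"
    "morphism_le A (\<lambda>p. \<rho> (fst p) (snd p)) (\<lambda>p. rz Y (snd p))"
  obtains S where "is_relation C X Y S" "span_rz S = \<rho>"
proof -
  let ?\<phi> = "\<lambda>p. \<rho> (fst p) (snd p)"
  \<comment> \<open>Strictness bounds the support by a product of carriers, which makes it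
    small.\<close>
  have "{p. ?\<phi> p \<noteq> {}} \<subseteq> pts X \<times> pts Y"
    using le_ne[OF assms(3)] le_ne[OF assms(4)] asm_mem[OF assms(1)] asm_mem[OF assms(2)] by fastforce
  moreover have "small \<U> (pts X)" "small \<U> (pts Y)"
    using assms(1,2) by (auto intro!: small_mem simp: is_assembly_def)
  ultimately have "small \<U> {p. ?\<phi> p \<noteq> {}}" using small_subset small_Times univ by metis
  then obtain T j where T: "presents ?\<phi> T j" by (rule presents_exists)
  obtain p where p: "p \<in> Arr C" "src p = T" "trg p = X" "\<And>i. ?\<phi> i \<noteq> {} \<Longrightarrow> fn p (j i) = fst i"
    using presents_arr[OF T assms(1,3)] by metis
  obtain q where q: "q \<in> Arr C" "src q = T" "trg q = Y" "\<And>i. ?\<phi> i \<noteq> {} \<Longrightarrow> fn q (j i) = snd i"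
    using presents_arr[OF T assms(2,4)] by metis
  note asm = presentsD(1)[OF T] and rT = presentsD(2)[OF T] and pT = presentsD(3)[OF T]
  show thesis
  proof (rule that[of "(p, q)"])
    show "is_relation C X Y (p, q)"
      unfolding is_relation_iff
    proof (intro conjI ballI impI)
      fix w w' assume w: "w \<in> pts (src (fst (p, q)))" "w' \<in> pts (src (fst (p, q)))"
        and eq: "fn (fst (p, q)) w = fn (fst (p, q)) w' \<and> fn (snd (p, q)) w = fn (snd (p, q)) w'"
      obtain i where i: "?\<phi> i \<noteq> {}" "w = j i" using pT[of w] w(1) p(2) unfolding fst_conv by blast
      obtain i' where "?\<phi> i' \<noteq> {}" "w' = j i'" using pT[of w'] w(2) p(2) unfolding fst_conv by blast
      with i eq p(4) q(4) have "i = i'" by (intro prod_eqI) auto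
      with i \<open>w' = j i'\<close> show "w = w'" by simp
    qed (use p q in auto)
    show "span_rz (p, q) = \<rho>"
    proof (intro ext set_eqI iffI)
      fix x y b assume "b \<in> span_rz (p, q) x y"
      then obtain w where w: "b \<in> rz T w" "fn p w = x" "fn q w = y" by (auto simp: span_rz_def p)
      then have "w \<in> pts T" using asm_mem[OF asm] by blast
      then obtain i where i: "?\<phi> i \<noteq> {}" "w = j i" using pT by blast
      show "b \<in> \<rho> x y" using w rT[OF i(1)] p(4)[OF i(1)] q(4)[OF i(1)] i(2) by simp
    next
      fix x y b assume b: "b \<in> \<rho> x y"
      then have i: "?\<phi> (x, y) \<noteq> {}" by auto
      show "b \<in> span_rz (p, q) x y"
        using rT[OF i] p(4)[OF i] q(4)[OF i] b unfolding span_rz_def by (intro CollectI exI[of _ "j (x, y)"]) (simp add: p(2))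
    qed
  qed
qed


lemma univ_subset: "X \<in> \<U> \<Longrightarrow> Y \<subseteq> X \<Longrightarrow> Y \<in> \<U>"
  using univ unfolding set_universe_def by metis

section \<open>Regular epimorphisms as surjections with uniformly computable preimages\<close>

lemma regular_epiI:
  assumes e: "e \<in> Arr C" and le: "morphism_le A (rz (trg e)) (\<lambda>y. \<Union>x\<in>{x. fn e x = y}. rz (src e) x)"
  shows "regular_epi C e"
proof -
  let ?X = "src e" and ?Y = "trg e"
  have asm: "is_assembly \<U> ?X" "is_assembly \<U> ?Y" using arr_asm[OF e] by auto
  \<comment> \<open>The kernel pair of \<open>e\<close>, of which \<open>e\<close> turns out to be
    the coequalizer.\<close>
  define \<rho> where "\<rho> = (\<lambda>x x'. if fn e x = fn e x' then both A (rz ?X x) (rz ?X x') else {})"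
  have sub: "morphism_le A (\<lambda>p. \<rho> (fst p) (snd p)) (\<lambda>p. both A (rz ?X (fst p)) (rz ?X (snd p)))"
    by (rule le_sub[OF pca]) (auto simp: \<rho>_def)
  obtain S where S: "is_relation C ?X ?X S" "span_rz S = \<rho>"
    using span_of_family[OF asm(1) asm(1) le_both1[OF pca sub] le_both2[OF pca sub]] .
  obtain u v where uv: "S = (u, v)" by (meson surj_pair)
  have u: "u \<in> Arr C" "v \<in> Arr C" "src v = src u" "trg u = ?X" "trg v = ?X"
    using S(1) by (auto simp: is_relation_iff uv)
  have W: "fn e (fn u w) = fn e (fn v w)" if "w \<in> pts (src u)" for w
  proof -
    have "\<rho> (fn u w) (fn v w) \<noteq> {}"
      using span_rz_eq[OF S(1), of w] that asm_mem[OF arr_asm(1)[OF u(1)], of w] S(2) by (simp add: uv)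
    then show ?thesis by (auto simp: \<rho>_def split: if_splits)
  qed
  have "coequalizer C u v e"
    unfolding coequalizer_def
  proof (intro conjI ballI impI)
    show "e \<cdot>\<^bsub>C\<^esub> u = e \<cdot>\<^bsub>C\<^esub> v"
      using e u W by (intro arr_eqI comp_arr) (auto simp: compose_def)
  next
    fix g assume g: "g \<in> Arr C" and "Dom C g = Dom C e \<and> g \<cdot>\<^bsub>C\<^esub> u = g \<cdot>\<^bsub>C\<^esub> v"
    then have gs: "src g = ?X" and geq: "compose (pts (src u)) (fn g) (fn u) = compose (pts (src u)) (fn g) (fn v)"
      using u by auto
    have g_cong: "fn g x = fn g x'" if x: "x \<in> pts ?X" "x' \<in> pts ?X" "fn e x = fn e x'" for x x'
    proof -
      have "span_rz S x x' \<noteq> {}" using x asm_mem[OF asm(1)] by (simp add: S(2) \<rho>_def)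
      then obtain w where w: "rz (src u) w \<noteq> {}" "fn u w = x" "fn v w = x'"
        by (auto simp: span_rz_def uv)
      then have "w \<in> pts (src u)" using asm_mem[OF arr_asm(1)[OF u(1)]] by blast
      with fun_cong[OF geq, of w] w show ?thesis by (simp add: compose_def)
    qed
    have surj: "\<exists>x\<in>pts ?X. fn e x = y" if y: "y \<in> pts ?Y" for y
    proof -
      have "rz ?Y y \<noteq> {}" using y asm_mem[OF asm(2)] by blast
      from le_ne[OF le this] obtain x where "fn e x = y" "rz ?X x \<noteq> {}" by blast
      then show ?thesis using asm_mem[OF asm(1)] by blast
    qed
    define k where "k = (\<lambda>y. SOME x. x \<in> pts ?X \<and> fn e x = y)"
    have k: "k y \<in> pts ?X" "fn e (k y) = y" if "y \<in> pts ?Y" for y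
      using someI_ex[of "\<lambda>x. x \<in> pts ?X \<and> fn e x = y"] surj[OF that] by (auto simp: k_def)
    let ?h = "\<lambda>y. fn g (k y)"
    \<comment> \<open>The chosen preimage \<open>k y\<close> need not be computable:
      \<open>g\<close> is constant on the fibres of \<open>e\<close>, so a realizer of any point
      over \<open>y\<close> is sent by the tracker of \<open>g\<close> to a realizer of the value at
      \<open>k y\<close>.\<close>
    have "morphism_le A (\<lambda>y. \<Union>x\<in>{x. fn e x = y}. rz ?X x) (\<lambda>y. rz (trg g) (?h y))"
    proof -
      have "morphism_le A (rz ?X) (\<lambda>x. rz (trg g) (fn g x))" using arr_le[OF g] gs by simp
      then obtain s where s: "\<And>x b. b \<in> rz ?X x \<Longrightarrow> \<exists>c\<in>rz (trg g) (fn g x). A s b = Some c"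
        by (rule morphism_leE) blast
      have "?h (fn e x) = fn g x" if "b \<in> rz ?X x" for x b
      proof -
        have x: "x \<in> pts ?X" using that asm_mem[OF asm(1)] by blast
        then show ?thesis using k[OF arr_mem[OF e x]] by (intro g_cong) auto
      qed
      with s show ?thesis by (intro morphism_leI[of _ _ _ s]) fastforce
    qed
    with le have "morphism_le A (rz ?Y) (\<lambda>y. rz (trg g) (?h y))" by (rule le_trans[OF pca])
    then have h: "(?Y, restrict ?h (pts ?Y), trg g) \<in> Arr C" (is "?a \<in> _")
      using asm(2) arr_asm(2)[OF g] by (intro mk_arr)
    have ha: "?a \<cdot>\<^bsub>C\<^esub> e = g"
    proof (rule arr_eqI)
      show "?a \<cdot>\<^bsub>C\<^esub> e \<in> Arr C" using h e by (intro comp_arr) auto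
      fix x assume "x \<in> pts (src (?a \<cdot>\<^bsub>C\<^esub> e))"
      then have x: "x \<in> pts ?X" by simp
      then have "fn g (k (fn e x)) = fn g x" using k[OF arr_mem[OF e x]] by (intro g_cong) auto
      then show "fn (?a \<cdot>\<^bsub>C\<^esub> e) x = fn g x" using x arr_mem[OF e x] by (simp add: compose_def)
    qed (use g gs in auto)
    show "\<exists>!h. h \<in> Hom C (Cod C e) (Cod C g) \<and> h \<cdot>\<^bsub>C\<^esub> e = g"
    proof (rule ex1I[of _ ?a])
      show "?a \<in> Hom C (Cod C e) (Cod C g) \<and> ?a \<cdot>\<^bsub>C\<^esub> e = g" using h ha by (auto simp: Hom_def)
      fix h' assume h': "h' \<in> Hom C (Cod C e) (Cod C g) \<and> h' \<cdot>\<^bsub>C\<^esub> e = g"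
      show "h' = ?a"
      proof (rule arr_eqI)
        fix y assume "y \<in> pts (src h')"
        then have y: "y \<in> pts ?Y" using h' by (auto simp: Hom_def)
        have "compose (pts ?X) (fn h') (fn e) = fn g" using h' by auto
        from fun_cong[OF this, of "k y"] show "fn h' y = fn ?a y" using k[OF y] y by (simp add: compose_def)
      qed (use h h' in \<open>auto simp: Hom_def\<close>)
    qed
  qed (use e u in auto)
  then show ?thesis unfolding regular_epi_def by blast
qed

text \<open>\<open>e\<close> is compared with its image, realized by the realizers of preimages. The
  corestriction of \<open>e\<close> factors through the coequalizer by some \<open>h\<close>; by
  uniqueness \<open>h\<close> is a section of the inclusion of the image, so it is the identity on
  points, and its tracker is the desired entailment.\<close>

lemma regular_epiD:
  assumes "regular_epi C e"
  shows "e \<in> Arr C" "morphism_le A (rz (trg e)) (\<lambda>y. \<Union>x\<in>{x. fn e x = y}. rz (src e) x)"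
proof -
  obtain u v where co: "coequalizer C u v e" using assms by (auto simp: regular_epi_def)
  then show e: "e \<in> Arr C" by (simp add: coequalizer_def)
  have u: "u \<in> Arr C" "v \<in> Arr C" "src u = src v" "trg u = src e" "trg v = src e" "e \<cdot>\<^bsub>C\<^esub> u = e \<cdot>\<^bsub>C\<^esub> v"
    using co unfolding coequalizer_def Ass_simps(1,2) by - (elim conjE; assumption)+
  have univ_prop: "\<exists>!h. h \<in> Hom C (trg e) (trg g) \<and> h \<cdot>\<^bsub>C\<^esub> e = g"
    if "g \<in> Arr C" "src g = src e" "g \<cdot>\<^bsub>C\<^esub> u = g \<cdot>\<^bsub>C\<^esub> v" for g
    using co that unfolding coequalizer_def Ass_simps(1,2) by (elim conjE) (drule bspec, assumption, simp)
  let ?X = "src e" and ?Y = "trg e"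
  have asm: "is_assembly \<U> ?X" "is_assembly \<U> ?Y" using arr_asm[OF e] by auto
  let ?E = "\<lambda>y. \<Union>x\<in>{x. fn e x = y}. rz ?X x"
  \<comment> \<open>Same points as the set-theoretic image, but with the realizers inherited from
    the source.\<close>
  define I where "I = (fn e ` pts ?X, ?E)"
  have I: "is_assembly \<U> I"
  proof -
    have "fn e ` pts ?X \<subseteq> pts ?Y" using arr_mem[OF e] by auto
    moreover have "pts ?Y \<in> \<U>" using asm(2) by (auto simp: is_assembly_def)
    ultimately have "fn e ` pts ?X \<in> \<U>" by (rule univ_subset[rotated])
    moreover have "?E y \<noteq> {} \<longleftrightarrow> y \<in> fn e ` pts ?X" for y
      using asm_mem[OF asm(1)] by auto
    ultimately show ?thesis unfolding I_def is_assembly_def by auto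
  qed
  have "morphism_le A (rz ?X) (\<lambda>x. rz I (fn e x))" by (rule le_sub[OF pca]) (auto simp: I_def)
  then have g: "(?X, restrict (fn e) (pts ?X), I) \<in> Arr C" (is "?g \<in> _") by (intro mk_arr asm I)
  obtain s where s: "\<And>x b. b \<in> rz ?X x \<Longrightarrow> \<exists>c\<in>rz ?Y (fn e x). A s b = Some c"
    using arr_le[OF e] by (rule morphism_leE) blast
  have "morphism_le A (rz I) (\<lambda>y. rz ?Y y)"
    by (rule morphism_leI[of _ _ _ s]) (use s in \<open>auto simp: I_def\<close>)
  then have i: "(I, restrict (\<lambda>y. y) (pts I), ?Y) \<in> Arr C" (is "?i \<in> _") by (intro mk_arr asm I)
  have gu: "?g \<cdot>\<^bsub>C\<^esub> u = ?g \<cdot>\<^bsub>C\<^esub> v"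
  proof (rule arr_eqI)
    show "?g \<cdot>\<^bsub>C\<^esub> u \<in> Arr C" "?g \<cdot>\<^bsub>C\<^esub> v \<in> Arr C" using u g by (auto intro!: comp_arr simp del: Ass_simps(3))
    fix x assume "x \<in> pts (src (?g \<cdot>\<^bsub>C\<^esub> u))"
    then have x: "x \<in> pts (src u)" by simp
    have "compose (pts (src u)) (fn e) (fn u) = compose (pts (src v)) (fn e) (fn v)" using u by auto
    from fun_cong[OF this, of x] have "fn e (fn u x) = fn e (fn v x)" using x u by (simp add: compose_def)
    then show "fn (?g \<cdot>\<^bsub>C\<^esub> u) x = fn (?g \<cdot>\<^bsub>C\<^esub> v) x"
      using x u arr_mem[OF u(1)] arr_mem[OF u(2)] by (simp add: compose_def)
  qed (use u in auto)
  obtain h where h: "h \<in> Hom C ?Y I" "h \<cdot>\<^bsub>C\<^esub> e = ?g"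
    using univ_prop[OF g fst_conv gu, unfolded fst_conv snd_conv] by blast
  have hA: "h \<in> Arr C" "src h = ?Y" "trg h = I" using h(1) by (auto simp: Hom_def)
  have he: "fn h (fn e x) = fn e x" if "x \<in> pts ?X" for x
  proof -
    have "compose (pts ?X) (fn h) (fn e) = restrict (fn e) (pts ?X)" using h(2) by simp
    from fun_cong[OF this, of x] show ?thesis using that by (simp add: compose_def)
  qed
  have ih: "?i \<cdot>\<^bsub>C\<^esub> h = Ident C ?Y"
  proof -
    have id: "Ident C ?Y \<in> Arr C" using mk_arr[OF asm(2) asm(2) le_refl[OF pca], of] by (simp add: id_def)
    have ihA: "?i \<cdot>\<^bsub>C\<^esub> h \<in> Arr C" using i hA by (intro comp_arr) auto
    have "?i \<cdot>\<^bsub>C\<^esub> h \<in> Hom C ?Y ?Y \<and> (?i \<cdot>\<^bsub>C\<^esub> h) \<cdot>\<^bsub>C\<^esub> e = e"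
    proof
      show "?i \<cdot>\<^bsub>C\<^esub> h \<in> Hom C ?Y ?Y" using ihA hA by (simp add: Hom_def)
      show "(?i \<cdot>\<^bsub>C\<^esub> h) \<cdot>\<^bsub>C\<^esub> e = e"
        using ihA e hA by (intro arr_eqI comp_arr[OF e]) (auto simp: compose_def he arr_mem[OF e] I_def)
    qed
    moreover have "Ident C ?Y \<in> Hom C ?Y ?Y \<and> Ident C ?Y \<cdot>\<^bsub>C\<^esub> e = e"
    proof
      show "Ident C ?Y \<in> Hom C ?Y ?Y" using id by (simp add: Hom_def)
      show "Ident C ?Y \<cdot>\<^bsub>C\<^esub> e = e"
        using id e by (intro arr_eqI comp_arr[OF e]) (auto simp: compose_def arr_mem[OF e])
    qed
    ultimately show ?thesis using univ_prop[OF e _ u(6)] by blast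
  qed
  have "fn h y = y" if "y \<in> pts ?Y" for y
  proof -
    have "compose (pts ?Y) (restrict (\<lambda>y. y) (pts I)) (fn h) = restrict id (pts ?Y)" using ih hA by simp
    from fun_cong[OF this, of y] show ?thesis using that arr_mem[OF hA(1), of y] hA by (simp add: compose_def)
  qed
  then have "morphism_le A (rz ?Y) (\<lambda>y. rz I y)"
    using arr_le[OF hA(1)] hA
    by (subst le_cong_ne[where \<chi> = "\<lambda>y. rz I (fn h y)"]) (auto simp: asm_mem[OF asm(2), symmetric])
  then show "morphism_le A (rz ?Y) (\<lambda>y. \<Union>x\<in>{x. fn e x = y}. rz ?X x)" by (simp add: I_def)
qed

lemma regular_epi_fst_iff:
  assumes "is_relation C X Y P"
  shows "regular_epi C (fst P) \<longleftrightarrow> morphism_le A (rz X) (\<lambda>x. \<Union>y. span_rz P x y)"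
proof -
  have "(\<Union>y. span_rz P x y) = (\<Union>w\<in>{w. fn (fst P) w = x}. rz (src (fst P)) w)" for x
    by (auto simp: span_rz_def)
  then show ?thesis
    using assms regular_epiI[of "fst P"] regular_epiD[of "fst P"]
    by (auto simp: is_relation_iff)
qed

section \<open>Equivalence relations and functional relations on realizers\<close>

text \<open>As \<open>morphism_le\<close> has a single index, several variables are packed into one
  nested pair. For spans strictness is already given by \<open>span_rz_strict\<close>.\<close>

definition is_equivalence :: "('u, 'a) assembly \<Rightarrow> ('u \<Rightarrow> 'u \<Rightarrow> 'a set) \<Rightarrow> bool" where
  "is_equivalence X \<rho> \<longleftrightarrow> morphism_le A (rz X) (\<lambda>x. \<rho> x x) \<and>
     morphism_le A (\<lambda>p. \<rho> (fst p) (snd p)) (\<lambda>p. \<rho> (snd p) (fst p)) \<and>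
     morphism_le A (\<lambda>p. both A (\<rho> (fst p) (fst (snd p))) (\<rho> (fst (snd p)) (snd (snd p))))
       (\<lambda>p. \<rho> (fst p) (snd (snd p)))"

text \<open>The laws as sequent rules with an arbitrary context \<open>\<phi>\<close> and terms
  \<open>f\<close>, \<open>g\<close>, \<open>h\<close>: reindex the law along the tuple of terms and
  compose. Later arguments then need no tuples of variables.\<close>

lemma is_equivalenceD:
  assumes "is_equivalence X \<rho>"
  shows "morphism_le A \<phi> (\<lambda>i. rz X (f i)) \<Longrightarrow> morphism_le A \<phi> (\<lambda>i. \<rho> (f i) (f i))"
    "morphism_le A \<phi> (\<lambda>i. \<rho> (f i) (g i)) \<Longrightarrow> morphism_le A \<phi> (\<lambda>i. \<rho> (g i) (f i))"
    "morphism_le A \<phi> (\<lambda>i. \<rho> (f i) (g i)) \<Longrightarrow> morphism_le A \<phi> (\<lambda>i. \<rho> (g i) (h i)) \<Longrightarrow> morphism_le A \<phi> (\<lambda>i. \<rho> (f i) (h i))"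
proof -
  note R = assms[unfolded is_equivalence_def]
  show "morphism_le A \<phi> (\<lambda>i. rz X (f i)) \<Longrightarrow> morphism_le A \<phi> (\<lambda>i. \<rho> (f i) (f i))"
    using le_trans[OF pca _ le_reindex[OF R[THEN conjunct1], of f]] by simp
  show "morphism_le A \<phi> (\<lambda>i. \<rho> (f i) (g i)) \<Longrightarrow> morphism_le A \<phi> (\<lambda>i. \<rho> (g i) (f i))"
    using le_trans[OF pca _ le_reindex[OF R[THEN conjunct2, THEN conjunct1], of "\<lambda>i. (f i, g i)"]] by simp
  show "morphism_le A \<phi> (\<lambda>i. \<rho> (f i) (g i)) \<Longrightarrow> morphism_le A \<phi> (\<lambda>i. \<rho> (g i) (h i)) \<Longrightarrow> morphism_le A \<phi> (\<lambda>i. \<rho> (f i) (h i))"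
    using le_trans[OF pca le_bothI[OF pca] le_reindex[OF R[THEN conjunct2, THEN conjunct2], of "\<lambda>i. (f i, g i, h i)"]] by simp
qed


text \<open>The dictionary for generic elements: arrows out of a presented assembly are related iff
  the terms they represent are related over the presented family.\<close>

lemma holds_presented_iff:
  assumes T: "presents \<phi> T j" and S: "is_relation C X Y S"
    and a: "a \<in> Arr C" "src a = T" "trg a = X" "\<And>i. \<phi> i \<noteq> {} \<Longrightarrow> fn a (j i) = f i"
    and b: "b \<in> Arr C" "src b = T" "trg b = Y" "\<And>i. \<phi> i \<noteq> {} \<Longrightarrow> fn b (j i) = g i"
  shows "holds C S a b \<longleftrightarrow> morphism_le A \<phi> (\<lambda>i. span_rz S (f i) (g i))"
proof -
  have "holds C S a b \<longleftrightarrow> morphism_le A (rz T) (\<lambda>t. span_rz S (fn a t) (fn b t))"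
    using holds_iff[OF S a(1) b(1)] a b by simp
  also have "\<dots> \<longleftrightarrow> morphism_le A \<phi> (\<lambda>i. span_rz S (f i) (g i))"
  proof
    assume "morphism_le A (rz T) (\<lambda>t. span_rz S (fn a t) (fn b t))"
    from presents_le[OF T this, of "\<lambda>i. span_rz S (f i) (g i)"] a(4) b(4)
    show "morphism_le A \<phi> (\<lambda>i. span_rz S (f i) (g i))" by simp
  next
    assume "morphism_le A \<phi> (\<lambda>i. span_rz S (f i) (g i))"
    then obtain s where s: "\<And>i b. b \<in> \<phi> i \<Longrightarrow> \<exists>y\<in>span_rz S (f i) (g i). A s b = Some y"
      by (rule morphism_leE) blast
    show "morphism_le A (rz T) (\<lambda>t. span_rz S (fn a t) (fn b t))"
    proof (rule morphism_leI[of _ _ _ s])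
      fix t c assume c: "c \<in> rz T t"
      then have "t \<in> pts T" using asm_mem[OF presentsD(1)[OF T]] by blast
      then obtain i where i: "\<phi> i \<noteq> {}" "t = j i" using presentsD(3)[OF T] by blast
      with c have "c \<in> \<phi> i" using presentsD(2)[OF T i(1)] by simp
      from s[OF this] show "\<exists>y\<in>span_rz S (fn a t) (fn b t). A s c = Some y"
        using a(4)[OF i(1)] b(4)[OF i(1)] i(2) by simp
    qed
  qed
  finally show ?thesis .
qed

lemma small_pts: "is_assembly \<U> X \<Longrightarrow> small \<U> (pts X)"
  by (auto intro!: small_mem simp: is_assembly_def)

lemma span_rz_mem:
  assumes "is_relation C X Y S" "span_rz S x y \<noteq> {}"
  shows "x \<in> pts X" "y \<in> pts Y"
  using span_rz_strict[OF assms(1) le_refl[OF pca, of "\<lambda>i. span_rz S (fst i) (snd i)"], THEN le_ne, of "(x, y)"]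
    assms asm_mem[of X] asm_mem[of Y] arr_asm[of "fst S"] arr_asm[of "snd S"]
  by (auto simp: is_relation_iff)

lemma relation_asm:
  assumes "is_relation C X Y S"
  shows "is_assembly \<U> X" "is_assembly \<U> Y"
  using assms arr_asm[of "fst S"] arr_asm[of "snd S"] by (auto simp: is_relation_iff)

lemma ident_arr: "is_assembly \<U> X \<Longrightarrow> Ident C X \<in> Arr C"
  using mk_arr[of X X id] le_refl[OF pca, of "rz X"] by simp

text \<open>Each law is tested on its generic instance: reflexivity on the identity of
  \<open>X\<close>, symmetry on the assembly of related pairs, transitivity on that of composable
  related pairs. The laws on realizers conversely apply to all generalized elements through
  \<open>holds_iff\<close>.\<close>

lemma equiv_relation_iff: "equiv_relation C X R \<longleftrightarrow> is_relation C X X R \<and> is_equivalence X (span_rz R)"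
proof
  assume E: "equiv_relation C X R"
  then have R: "is_relation C X X R" by (simp add: equiv_relation_def)
  have X: "is_assembly \<U> X" using relation_asm[OF R] by simp
  note E' = E[unfolded equiv_relation_def Ass_simps(1,2), THEN conjunct2, THEN conjunct2]
  note refl = E'[THEN conjunct1, rule_format]
    and sym = E'[THEN conjunct2, THEN conjunct1, rule_format]
    and trans = E'[THEN conjunct2, THEN conjunct2, rule_format]
  have "is_equivalence X (span_rz R)"
    unfolding is_equivalence_def
  proof (intro conjI)
    have i: "Ident C X \<in> Arr C" by (rule ident_arr[OF X])
    then have "holds C R (Ident C X) (Ident C X)" by (rule refl) simp
    then have "morphism_le A (rz X) (\<lambda>t. span_rz R (restrict id (pts X) t) (restrict id (pts X) t))"
      using holds_iff[OF R i i] by simp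
    then show "morphism_le A (rz X) (\<lambda>x. span_rz R x x)"
      by (subst le_cong_ne[where \<chi> = "\<lambda>t. span_rz R (restrict id (pts X) t) (restrict id (pts X) t)"])
        (auto simp: asm_mem[OF X, symmetric])
  next
    let ?\<phi> = "\<lambda>p. span_rz R (fst p) (snd p)"
    have "{p. ?\<phi> p \<noteq> {}} \<subseteq> pts X \<times> pts X"
      unfolding mem_Times_iff subset_iff mem_Collect_eq both_eq_empty_iff using span_rz_mem[OF R] by blast
    then have "small \<U> {p. ?\<phi> p \<noteq> {}}"
      by (rule small_subset[OF univ, rotated]) (intro small_Times[OF univ] small_pts[OF X])
    then obtain T j where T: "presents ?\<phi> T j" by (rule presents_exists)
    note le = span_rz_strict[OF R le_refl[OF pca, of ?\<phi>]]
    obtain a where a: "a \<in> Arr C" "src a = T" "trg a = X" "\<And>i. ?\<phi> i \<noteq> {} \<Longrightarrow> fn a (j i) = fst i"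
      using presents_arr[OF T X le(1)] by metis
    obtain b where b: "b \<in> Arr C" "src b = T" "trg b = X" "\<And>i. ?\<phi> i \<noteq> {} \<Longrightarrow> fn b (j i) = snd i"
      using presents_arr[OF T X le(2)] by metis
    have "holds C R a b" using holds_presented_iff[OF T R a b] le_refl[OF pca] by blast
    then have "holds C R b a" by (rule sym)
    then show "morphism_le A ?\<phi> (\<lambda>p. span_rz R (snd p) (fst p))" using holds_presented_iff[OF T R b a] by blast
  next
    let ?\<phi> = "\<lambda>p. both A (span_rz R (fst p) (fst (snd p))) (span_rz R (fst (snd p)) (snd (snd p)))"
    have "{p. ?\<phi> p \<noteq> {}} \<subseteq> pts X \<times> pts X \<times> pts X"
      unfolding mem_Times_iff subset_iff mem_Collect_eq both_eq_empty_iff using span_rz_mem[OF R] by blast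
    then have "small \<U> {p. ?\<phi> p \<noteq> {}}"
      by (rule small_subset[OF univ, rotated]) (intro small_Times[OF univ] small_pts[OF X])
    then obtain T j where T: "presents ?\<phi> T j" by (rule presents_exists)
    note l1 = le_both1[OF pca le_refl[OF pca, of ?\<phi>]] and l2 = le_both2[OF pca le_refl[OF pca, of ?\<phi>]]
    obtain a where a: "a \<in> Arr C" "src a = T" "trg a = X" "\<And>i. ?\<phi> i \<noteq> {} \<Longrightarrow> fn a (j i) = fst i"
      using presents_arr[OF T X span_rz_strict(1)[OF R l1]] by metis
    obtain b where b: "b \<in> Arr C" "src b = T" "trg b = X" "\<And>i. ?\<phi> i \<noteq> {} \<Longrightarrow> fn b (j i) = fst (snd i)"
      using presents_arr[OF T X span_rz_strict(1)[OF R l2]] by metis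
    obtain c where c: "c \<in> Arr C" "src c = T" "trg c = X" "\<And>i. ?\<phi> i \<noteq> {} \<Longrightarrow> fn c (j i) = snd (snd i)"
      using presents_arr[OF T X span_rz_strict(2)[OF R l2]] by metis
    have "holds C R a b" "holds C R b c" using holds_presented_iff[OF T R a b] l1 holds_presented_iff[OF T R b c] l2 by blast+
    then have "holds C R a c" by (rule trans)
    then show "morphism_le A ?\<phi> (\<lambda>p. span_rz R (fst p) (snd (snd p)))" using holds_presented_iff[OF T R a c] by blast
  qed
  with R show "is_relation C X X R \<and> is_equivalence X (span_rz R)" by blast
next
  assume "is_relation C X X R \<and> is_equivalence X (span_rz R)"
  then have R: "is_relation C X X R" and E: "is_equivalence X (span_rz R)" by auto
  show "equiv_relation C X R"
    unfolding equiv_relation_def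
  proof (intro conjI ballI allI impI)
    show "X \<in> Obj C" using relation_asm[OF R] by simp
    show "is_relation C X X R" by (rule R)
  next
    fix x assume x: "x \<in> Arr C" "Cod C x = X"
    then show "holds C R x x" using is_equivalenceD(1)[OF E] arr_le[OF x(1)] by (subst holds_iff[OF R]) auto
  next
    fix x y assume h: "holds C R x y"
    note D = holdsD[OF R h]
    show "holds C R y x"
      using h is_equivalenceD(2)[OF E] holds_iff[OF R D(1,2,3,4,5)] holds_iff[OF R D(2,1) D(3)[symmetric] D(5,4)] D(3) by simp
  next
    fix x y z assume h: "holds C R x y" "holds C R y z"
    note D = holdsD[OF R h(1)] and D' = holdsD[OF R h(2)]
    have xz: "src x = src z" using D(3) D'(3) by simp
    have "morphism_le A (rz (src x)) (\<lambda>t. span_rz R (fn x t) (fn y t))" using h(1) holds_iff[OF R D] by simp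
    moreover have "morphism_le A (rz (src x)) (\<lambda>t. span_rz R (fn y t) (fn z t))"
      using h(2) holds_iff[OF R D'] D(3) by simp
    ultimately have "morphism_le A (rz (src x)) (\<lambda>t. span_rz R (fn x t) (fn z t))" by (rule is_equivalenceD(3)[OF E])
    then show "holds C R x z" using holds_iff[OF R D(1) D'(2) xz D(4) D'(5)] by simp
  qed
qed

text \<open>The first two clauses express strictness. They must be stated because
  \<open>\<tau>\<close> is an arbitrary family here; they are what allows a span to be built from
  it.\<close>

definition is_functional :: "('u, 'a) assembly \<Rightarrow> ('u, 'a) assembly \<Rightarrow> ('u \<Rightarrow> 'u \<Rightarrow> 'a set) \<Rightarrow> ('u \<Rightarrow> 'u \<Rightarrow> 'a set) \<Rightarrow>
    ('u \<Rightarrow> 'u \<Rightarrow> 'a set) \<Rightarrow> bool" where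
  "is_functional X Y \<rho> \<sigma> \<tau> \<longleftrightarrow>
     morphism_le A (\<lambda>p. \<tau> (fst p) (snd p)) (\<lambda>p. rz X (fst p)) \<and>
     morphism_le A (\<lambda>p. \<tau> (fst p) (snd p)) (\<lambda>p. rz Y (snd p)) \<and>
     morphism_le A (\<lambda>p. both A (\<rho> (fst p) (fst (snd p)))
         (both A (\<tau> (fst (snd p)) (fst (snd (snd p)))) (\<sigma> (fst (snd (snd p))) (snd (snd (snd p))))))
       (\<lambda>p. \<tau> (fst p) (snd (snd (snd p)))) \<and>
     morphism_le A (\<lambda>p. both A (\<tau> (fst p) (fst (snd p))) (\<tau> (fst p) (snd (snd p))))
       (\<lambda>p. \<sigma> (fst (snd p)) (snd (snd p))) \<and>
     morphism_le A (rz X) (\<lambda>x. \<Union>y. \<tau> x y)"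

lemma is_functionalD:
  assumes "is_functional X Y \<rho> \<sigma> \<tau>"
  shows "morphism_le A \<phi> (\<lambda>i. \<tau> (f i) (g i)) \<Longrightarrow> morphism_le A \<phi> (\<lambda>i. rz X (f i))"
    "morphism_le A \<phi> (\<lambda>i. \<tau> (f i) (g i)) \<Longrightarrow> morphism_le A \<phi> (\<lambda>i. rz Y (g i))"
    "morphism_le A \<phi> (\<lambda>i. \<rho> (f' i) (f i)) \<Longrightarrow> morphism_le A \<phi> (\<lambda>i. \<tau> (f i) (g i)) \<Longrightarrow>
      morphism_le A \<phi> (\<lambda>i. \<sigma> (g i) (g' i)) \<Longrightarrow> morphism_le A \<phi> (\<lambda>i. \<tau> (f' i) (g' i))"
    "morphism_le A \<phi> (\<lambda>i. \<tau> (f i) (g i)) \<Longrightarrow> morphism_le A \<phi> (\<lambda>i. \<tau> (f i) (g' i)) \<Longrightarrow>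
      morphism_le A \<phi> (\<lambda>i. \<sigma> (g i) (g' i))"
    "morphism_le A \<phi> (\<lambda>i. rz X (f i)) \<Longrightarrow> morphism_le A \<phi> (\<lambda>i. \<Union>y. \<tau> (f i) y)"
proof -
  note R = assms[unfolded is_functional_def]
  note R1 = R[THEN conjunct1] and R2 = R[THEN conjunct2, THEN conjunct1]
    and R3 = R[THEN conjunct2, THEN conjunct2, THEN conjunct1]
    and R4 = R[THEN conjunct2, THEN conjunct2, THEN conjunct2, THEN conjunct1]
    and R5 = R[THEN conjunct2, THEN conjunct2, THEN conjunct2, THEN conjunct2]
  show "morphism_le A \<phi> (\<lambda>i. \<tau> (f i) (g i)) \<Longrightarrow> morphism_le A \<phi> (\<lambda>i. rz X (f i))"
    using le_trans[OF pca _ le_reindex[OF R1, of "\<lambda>i. (f i, g i)"]] by simp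
  show "morphism_le A \<phi> (\<lambda>i. \<tau> (f i) (g i)) \<Longrightarrow> morphism_le A \<phi> (\<lambda>i. rz Y (g i))"
    using le_trans[OF pca _ le_reindex[OF R2, of "\<lambda>i. (f i, g i)"]] by simp
  show "morphism_le A \<phi> (\<lambda>i. \<rho> (f' i) (f i)) \<Longrightarrow> morphism_le A \<phi> (\<lambda>i. \<tau> (f i) (g i)) \<Longrightarrow>
      morphism_le A \<phi> (\<lambda>i. \<sigma> (g i) (g' i)) \<Longrightarrow> morphism_le A \<phi> (\<lambda>i. \<tau> (f' i) (g' i))"
    using le_trans[OF pca le_bothI[OF pca _ le_bothI[OF pca]] le_reindex[OF R3, of "\<lambda>i. (f' i, f i, g i, g' i)"]] by simp
  show "morphism_le A \<phi> (\<lambda>i. \<tau> (f i) (g i)) \<Longrightarrow> morphism_le A \<phi> (\<lambda>i. \<tau> (f i) (g' i)) \<Longrightarrow>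
      morphism_le A \<phi> (\<lambda>i. \<sigma> (g i) (g' i))"
    using le_trans[OF pca le_bothI[OF pca] le_reindex[OF R4, of "\<lambda>i. (f i, g i, g' i)"]] by simp
  show "morphism_le A \<phi> (\<lambda>i. rz X (f i)) \<Longrightarrow> morphism_le A \<phi> (\<lambda>i. \<Union>y. \<tau> (f i) y)"
    using le_trans[OF pca _ le_reindex[OF R5, of f]] by simp
qed

lemma is_functional_cong:
  assumes "is_functional X Y \<rho> \<sigma> \<tau>" "rel_le A \<tau> \<tau>'" "rel_le A \<tau>' \<tau>"
  shows "is_functional X Y \<rho> \<sigma> \<tau>'"
  unfolding is_functional_def
proof (intro conjI)
  note F = is_functionalD[OF assms(1)] and to = le_trans[OF pca _ rel_leD[OF assms(2)]] and from_ = le_trans[OF pca _ rel_leD[OF assms(3)]]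
  note r = le_refl[OF pca]
  show "morphism_le A (\<lambda>p. \<tau>' (fst p) (snd p)) (\<lambda>p. rz X (fst p))"
    by (rule F(1)[OF rel_leD[OF assms(3)]])
  show "morphism_le A (\<lambda>p. \<tau>' (fst p) (snd p)) (\<lambda>p. rz Y (snd p))"
    by (rule F(2)[OF rel_leD[OF assms(3)]])
  show "morphism_le A (\<lambda>p. both A (\<rho> (fst p) (fst (snd p)))
         (both A (\<tau>' (fst (snd p)) (fst (snd (snd p)))) (\<sigma> (fst (snd (snd p))) (snd (snd (snd p))))))
       (\<lambda>p. \<tau>' (fst p) (snd (snd (snd p))))"
    by (rule to, rule F(3)) (rule both_le1[OF pca], rule from_, rule le_both1[OF pca both_le2[OF pca]],
      rule le_both2[OF pca both_le2[OF pca]])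
  show "morphism_le A (\<lambda>p. both A (\<tau>' (fst p) (fst (snd p))) (\<tau>' (fst p) (snd (snd p))))
       (\<lambda>p. \<sigma> (fst (snd p)) (snd (snd p)))"
    by (rule F(4)) (rule from_, rule both_le1[OF pca], rule from_, rule both_le2[OF pca])
  have "morphism_le A (\<lambda>p. \<tau> (fst p) (snd p)) (\<lambda>p. \<Union>y. \<tau>' (fst p) y)"
    using rel_leD[OF assms(2), of fst snd] by (rule le_exI[OF pca, where f = snd])
  then have "morphism_le A (\<lambda>x. \<Union>y. \<tau> x y) (\<lambda>x. \<Union>y. \<tau>' x y)" by (rule le_ex_left)
  then show "morphism_le A (rz X) (\<lambda>x. \<Union>y. \<tau>' x y)" by (rule le_trans[OF pca F(5)[OF r]])
qed

text \<open>If \<open>\<tau>'\<close> relates x to y, totality of \<open>\<tau>\<close> gives some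
  y0 with \<open>\<tau>\<close> x y0, hence \<open>\<tau>'\<close> x y0; single-valuedness of
  \<open>\<tau>'\<close> makes y0 equivalent to y, and \<open>\<tau>\<close> respects this
  equivalence.\<close>

lemma is_functional_antisym:
  assumes "is_functional X Y \<rho> \<sigma> \<tau>" "is_functional X Y \<rho> \<sigma> \<tau>'" "rel_le A \<tau> \<tau>'" "is_equivalence X \<rho>"
  shows "rel_le A \<tau>' \<tau>"
  unfolding rel_le_def
proof (rule le_exE[OF pca])
  note F = is_functionalD[OF assms(1)] and F' = is_functionalD[OF assms(2)]
  let ?\<phi> = "\<lambda>p. \<tau>' (fst p) (snd p)"
  show "morphism_le A ?\<phi> (\<lambda>p. \<Union>y. \<tau> (fst p) y)" by (rule F(5)[OF F'(1)[OF le_refl[OF pca]]])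
  let ?\<psi> = "\<lambda>q. both A (?\<phi> (fst q)) (\<tau> (fst (fst q)) (snd q))"
  have 1: "morphism_le A ?\<psi> (\<lambda>q. \<tau>' (fst (fst q)) (snd (fst q)))" by (rule both_le1[OF pca])
  have 2: "morphism_le A ?\<psi> (\<lambda>q. \<tau> (fst (fst q)) (snd q))" by (rule both_le2[OF pca])
  have 3: "morphism_le A ?\<psi> (\<lambda>q. \<tau>' (fst (fst q)) (snd q))" by (rule le_trans[OF pca 2 rel_leD[OF assms(3)]])
  show "morphism_le A ?\<psi> (\<lambda>q. \<tau> (fst (fst q)) (snd (fst q)))"
    by (rule F(3)[OF is_equivalenceD(1)[OF assms(4) F(1)[OF 2]] 2 F'(4)[OF 3 1]])
qed

text \<open>Again by generic elements: single-valuedness is tested on the assembly of pairs of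
  values of one point, compatibility on that of quadruples. Totality is the description of regular
  epimorphisms on realizers.\<close>

lemma functional_relation_iff:
  assumes R: "is_relation C X X R" and S: "is_relation C Y Y S"
  shows "functional_relation C R S P \<longleftrightarrow> is_relation C X Y P \<and> is_functional X Y (span_rz R) (span_rz S) (span_rz P)"
proof -
  have X: "is_assembly \<U> X" "rel_carrier C R = X" and Y: "is_assembly \<U> Y" "rel_carrier C S = Y"
    using relation_asm[OF R] relation_asm[OF S] R S by (auto simp: is_relation_iff)
  show ?thesis
  proof
    assume L: "functional_relation C R S P"
    note L' = L[unfolded functional_relation_def X(2) Y(2)]
    note P = L'[THEN conjunct1]
      and comp = L'[THEN conjunct2, THEN conjunct1, rule_format]
      and sv = L'[THEN conjunct2, THEN conjunct2, THEN conjunct1, rule_format]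
      and ep = L'[THEN conjunct2, THEN conjunct2, THEN conjunct2]
    have "is_functional X Y (span_rz R) (span_rz S) (span_rz P)"
      unfolding is_functional_def
    proof (intro conjI)
      show "morphism_le A (\<lambda>p. span_rz P (fst p) (snd p)) (\<lambda>p. rz X (fst p))"
        "morphism_le A (\<lambda>p. span_rz P (fst p) (snd p)) (\<lambda>p. rz Y (snd p))"
        by (rule span_rz_strict[OF P le_refl[OF pca]])+
      show "morphism_le A (rz X) (\<lambda>x. \<Union>y. span_rz P x y)" using regular_epi_fst_iff[OF P] ep by blast
    next
      let ?\<phi> = "\<lambda>p. both A (span_rz P (fst p) (fst (snd p))) (span_rz P (fst p) (snd (snd p)))"
      have "{p. ?\<phi> p \<noteq> {}} \<subseteq> pts X \<times> pts Y \<times> pts Y"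
      unfolding mem_Times_iff subset_iff mem_Collect_eq both_eq_empty_iff using span_rz_mem[OF P] by blast
      then have "small \<U> {p. ?\<phi> p \<noteq> {}}"
        by (rule small_subset[OF univ, rotated]) (intro small_Times[OF univ] small_pts[OF X(1)] small_pts[OF Y(1)])
      then obtain T j where T: "presents ?\<phi> T j" by (rule presents_exists)
      note l1 = both_le1[OF pca, of "\<lambda>p. span_rz P (fst p) (fst (snd p))" "\<lambda>p. span_rz P (fst p) (snd (snd p))"]
        and l2 = both_le2[OF pca, of "\<lambda>p. span_rz P (fst p) (fst (snd p))" "\<lambda>p. span_rz P (fst p) (snd (snd p))"]
      obtain a where a: "a \<in> Arr C" "src a = T" "trg a = X" "\<And>i. ?\<phi> i \<noteq> {} \<Longrightarrow> fn a (j i) = fst i"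
        using presents_arr[OF T X(1) span_rz_strict(1)[OF P l1]] by metis
      obtain b where b: "b \<in> Arr C" "src b = T" "trg b = Y" "\<And>i. ?\<phi> i \<noteq> {} \<Longrightarrow> fn b (j i) = fst (snd i)"
        using presents_arr[OF T Y(1) span_rz_strict(2)[OF P l1]] by metis
      obtain c where c: "c \<in> Arr C" "src c = T" "trg c = Y" "\<And>i. ?\<phi> i \<noteq> {} \<Longrightarrow> fn c (j i) = snd (snd i)"
        using presents_arr[OF T Y(1) span_rz_strict(2)[OF P l2]] by metis
      have "holds C P a b" "holds C P a c" using holds_presented_iff[OF T P a b] l1 holds_presented_iff[OF T P a c] l2 by blast+
      then have "holds C S b c" by (rule sv)
      then show "morphism_le A ?\<phi> (\<lambda>p. span_rz S (fst (snd p)) (snd (snd p)))" using holds_presented_iff[OF T S b c] by blast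
    next
      let ?\<phi>1 = "\<lambda>p. span_rz R (fst p) (fst (snd p))" and ?\<phi>2 = "\<lambda>p. span_rz P (fst (snd p)) (fst (snd (snd p)))"
        and ?\<phi>3 = "\<lambda>p. span_rz S (fst (snd (snd p))) (snd (snd (snd p)))"
      let ?\<phi> = "\<lambda>p. both A (?\<phi>1 p) (both A (?\<phi>2 p) (?\<phi>3 p))"
      have "{p. ?\<phi> p \<noteq> {}} \<subseteq> pts X \<times> pts X \<times> pts Y \<times> pts Y"
        unfolding mem_Times_iff subset_iff mem_Collect_eq both_eq_empty_iff
        using span_rz_mem[OF P] span_rz_mem[OF R] span_rz_mem[OF S] by blast
      then have "small \<U> {p. ?\<phi> p \<noteq> {}}"
        by (rule small_subset[OF univ, rotated]) (intro small_Times[OF univ] small_pts[OF X(1)] small_pts[OF Y(1)])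
      then obtain T j where T: "presents ?\<phi> T j" by (rule presents_exists)
      note l1 = both_le1[OF pca, of ?\<phi>1 "\<lambda>p. both A (?\<phi>2 p) (?\<phi>3 p)"]
        and l23 = both_le2[OF pca, of ?\<phi>1 "\<lambda>p. both A (?\<phi>2 p) (?\<phi>3 p)"]
      note l2 = le_both1[OF pca l23] and l3 = le_both2[OF pca l23]
      obtain a where a: "a \<in> Arr C" "src a = T" "trg a = X" "\<And>i. ?\<phi> i \<noteq> {} \<Longrightarrow> fn a (j i) = fst i"
        using presents_arr[OF T X(1) span_rz_strict(1)[OF R l1]] by metis
      obtain b where b: "b \<in> Arr C" "src b = T" "trg b = X" "\<And>i. ?\<phi> i \<noteq> {} \<Longrightarrow> fn b (j i) = fst (snd i)"
        using presents_arr[OF T X(1) span_rz_strict(2)[OF R l1]] by metis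
      obtain c where c: "c \<in> Arr C" "src c = T" "trg c = Y" "\<And>i. ?\<phi> i \<noteq> {} \<Longrightarrow> fn c (j i) = fst (snd (snd i))"
        using presents_arr[OF T Y(1) span_rz_strict(2)[OF P l2]] by metis
      obtain d where d: "d \<in> Arr C" "src d = T" "trg d = Y" "\<And>i. ?\<phi> i \<noteq> {} \<Longrightarrow> fn d (j i) = snd (snd (snd i))"
        using presents_arr[OF T Y(1) span_rz_strict(2)[OF S l3]] by metis
      have "holds C R a b" "holds C P b c" "holds C S c d"
        using holds_presented_iff[OF T R a b] l1 holds_presented_iff[OF T P b c] l2 holds_presented_iff[OF T S c d] l3 by blast+
      then have "holds C P a d" by (rule comp)
      then show "morphism_le A ?\<phi> (\<lambda>p. span_rz P (fst p) (snd (snd (snd p))))" using holds_presented_iff[OF T P a d] by blast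
    qed
    with P show "is_relation C X Y P \<and> is_functional X Y (span_rz R) (span_rz S) (span_rz P)" by blast
  next
    assume "is_relation C X Y P \<and> is_functional X Y (span_rz R) (span_rz S) (span_rz P)"
    then have P: "is_relation C X Y P" and F: "is_functional X Y (span_rz R) (span_rz S) (span_rz P)" by auto
    show "functional_relation C R S P"
      unfolding functional_relation_def X(2) Y(2)
    proof (intro conjI allI impI)
      show "is_relation C X Y P" by (rule P)
      show "regular_epi C (fst P)"
        unfolding regular_epi_fst_iff[OF P] by (rule is_functionalD(5)[OF F le_refl[OF pca]])
    next
      fix x y y' assume h: "holds C P x y" "holds C P x y'"
      note D = holdsD[OF P h(1)] and D' = holdsD[OF P h(2)]
      have "morphism_le A (rz (src x)) (\<lambda>t. span_rz S (fn y t) (fn y' t))"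
        using h holds_iff[OF P D] holds_iff[OF P D'] by (intro is_functionalD(4)[OF F]) auto
      then show "holds C S y y'" using holds_iff[OF S D(2) D'(2) _ D(5) D'(5)] D(3) D'(3) by simp
    next
      fix x x' y y' assume h: "holds C R x' x" "holds C P x y" "holds C S y y'"
      note D1 = holdsD[OF R h(1)] and D2 = holdsD[OF P h(2)] and D3 = holdsD[OF S h(3)]
      have eq: "src x = src x'" "src y = src x'" "src y' = src x'" using D1(3) D2(3) D3(3) by auto
      have "morphism_le A (rz (src x')) (\<lambda>t. span_rz R (fn x' t) (fn x t))"
        "morphism_le A (rz (src x')) (\<lambda>t. span_rz P (fn x t) (fn y t))"
        "morphism_le A (rz (src x')) (\<lambda>t. span_rz S (fn y t) (fn y' t))"
        using h holds_iff[OF R D1] holds_iff[OF P D2] holds_iff[OF S D3] eq by simp_all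
      then have "morphism_le A (rz (src x')) (\<lambda>t. span_rz P (fn x' t) (fn y' t))" by (rule is_functionalD(3)[OF F])
      then show "holds C P x' y'" using holds_iff[OF P D1(1) D3(2) eq(3)[symmetric] D1(4) D3(5)] by simp
    qed
  qed
qed


section \<open>Composition of relations\<close>

definition rcomp :: "('u \<Rightarrow> 'u \<Rightarrow> 'a set) \<Rightarrow> ('u \<Rightarrow> 'u \<Rightarrow> 'a set) \<Rightarrow> 'u \<Rightarrow> 'u \<Rightarrow> 'a set" where
  "rcomp \<rho> \<sigma> x z = (\<Union>y. both A (\<rho> x y) (\<sigma> y z))"

lemma rcompI:
  assumes "morphism_le A \<phi> (\<lambda>i. \<rho> (f i) (g i))" "morphism_le A \<phi> (\<lambda>i. \<sigma> (g i) (h i))"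
  shows "morphism_le A \<phi> (\<lambda>i. rcomp \<rho> \<sigma> (f i) (h i))"
  unfolding rcomp_def using le_bothI[OF pca assms] by (rule le_exI[OF pca, where f = g])

lemma rcomp_leI:
  assumes "morphism_le A (\<lambda>p. both A (\<rho> (fst (fst p)) (snd p)) (\<sigma> (snd p) (snd (fst p)))) (\<lambda>p. \<tau> (fst (fst p)) (snd (fst p)))"
  shows "rel_le A (rcomp \<rho> \<sigma>) \<tau>"
  unfolding rel_le_def rcomp_def by (rule le_ex_left) (rule assms)

lemma rcomp_mono:
  assumes "rel_le A \<rho> \<rho>'" "rel_le A \<sigma> \<sigma>'"
  shows "rel_le A (rcomp \<rho> \<sigma>) (rcomp \<rho>' \<sigma>')"
  by (rule rcomp_leI, rule rcompI; rule le_trans[OF pca _ rel_leD])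
     (rule both_le1[OF pca] both_le2[OF pca] assms)+

lemma rel_le_refl: "rel_le A \<rho> \<rho>"
  unfolding rel_le_def by (rule le_refl[OF pca])

lemma rel_le_trans: "rel_le A \<rho> \<sigma> \<Longrightarrow> rel_le A \<sigma> \<tau> \<Longrightarrow> rel_le A \<rho> \<tau>"
  unfolding rel_le_def by (rule le_trans[OF pca])

text \<open>The regular image of the pullback is existential quantification over the middle point.
  From left to right the uniform preimages under \<open>e\<close> are used, from right to left the
  universal property of the pullback, applied to a generic composable pair.\<close>

lemma rel_compositeD:
  assumes P: "is_relation C X Y P" and Q: "is_relation C Y Z Q" and comp: "rel_composite C P Q H"
  shows "is_relation C X Z H" "rel_le A (span_rz H) (rcomp (span_rz P) (span_rz Q))" "rel_le A (rcomp (span_rz P) (span_rz Q)) (span_rz H)"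
proof -
  obtain p q where p: "P = (p, q)" by (meson surj_pair)
  obtain r s where r: "Q = (r, s)" by (meson surj_pair)
  obtain m n where m: "H = (m, n)" by (meson surj_pair)
  have PA: "p \<in> Arr C" "q \<in> Arr C" "src q = src p" "trg p = X" "trg q = Y"
    using P by (auto simp: is_relation_iff p)
  have QA: "r \<in> Arr C" "s \<in> Arr C" "src s = src r" "trg r = Y" "trg s = Z"
    using Q by (auto simp: is_relation_iff r)
  show H: "is_relation C X Z H" using comp PA QA by (simp add: rel_composite_def p r)
  have HA: "m \<in> Arr C" "n \<in> Arr C" "src n = src m" "trg m = X" "trg n = Z"
    using H by (auto simp: is_relation_iff m)
  obtain \<pi>1 \<pi>2 e where pb: "pullback C q r \<pi>1 \<pi>2" and e: "regular_epi C e" "src e = src \<pi>1" "trg e = src m"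
    "m \<cdot>\<^bsub>C\<^esub> e = p \<cdot>\<^bsub>C\<^esub> \<pi>1" "n \<cdot>\<^bsub>C\<^esub> e = s \<cdot>\<^bsub>C\<^esub> \<pi>2"
    using comp unfolding rel_composite_def p r m fst_conv snd_conv Ass_simps(1,2) by blast
  note eA = regular_epiD(1)[OF e(1)]
  have \<pi>: "\<pi>1 \<in> Arr C" "\<pi>2 \<in> Arr C" "src \<pi>1 = src \<pi>2" "trg \<pi>1 = src q" "trg \<pi>2 = src r" "q \<cdot>\<^bsub>C\<^esub> \<pi>1 = r \<cdot>\<^bsub>C\<^esub> \<pi>2"
    using pb unfolding pullback_def Ass_simps(1,2) by - (elim conjE; assumption)+
  have factor: "\<exists>h. h \<in> Hom C (src x) (src \<pi>1) \<and> \<pi>1 \<cdot>\<^bsub>C\<^esub> h = x \<and> \<pi>2 \<cdot>\<^bsub>C\<^esub> h = y"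
    if "x \<in> Arr C" "y \<in> Arr C" "src x = src y" "trg x = src q" "trg y = src r" "q \<cdot>\<^bsub>C\<^esub> x = r \<cdot>\<^bsub>C\<^esub> y" for x y
    using pb that unfolding pullback_def Ass_simps(1,2) by blast
  let ?V = "src e"
  have comp_fn: "fn (g \<cdot>\<^bsub>C\<^esub> f) x = fn g (fn f x)" if "x \<in> pts (src f)" for f g x
    using that by (simp add: compose_def)
  have v: "fn m (fn e v) = fn p (fn \<pi>1 v)" "fn n (fn e v) = fn s (fn \<pi>2 v)" "fn q (fn \<pi>1 v) = fn r (fn \<pi>2 v)"
    if "v \<in> pts ?V" for v
    using that comp_fn[of v e m] comp_fn[of v e n] comp_fn[of v \<pi>1 p] comp_fn[of v \<pi>2 s]
      comp_fn[of v \<pi>1 q] comp_fn[of v \<pi>2 r] e(2,4,5) \<pi>(3,6) by metis+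
  show "rel_le A (span_rz H) (rcomp (span_rz P) (span_rz Q))"
  proof -
    obtain a where a: "\<And>w b. b \<in> rz (src m) w \<Longrightarrow> \<exists>c\<in>(\<Union>v\<in>{v. fn e v = w}. rz ?V v). A a b = Some c"
      using regular_epiD(2)[OF e(1)] unfolding e(3) by (rule morphism_leE) blast
    \<comment> \<open>The intermediate family: realizers of points of the pullback lying over the
      given pair of ends, not yet split by the two projections.\<close>
    define \<kappa> where "\<kappa> = (\<lambda>i. {b. \<exists>v. b \<in> rz ?V v \<and> fn p (fn \<pi>1 v) = fst i \<and> fn s (fn \<pi>2 v) = snd i})"
    have "morphism_le A (\<lambda>i. span_rz H (fst i) (snd i)) \<kappa>"
    proof (rule morphism_leI[of _ _ _ a])
      fix i b assume "b \<in> span_rz H (fst i) (snd i)"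
      then obtain w where w: "b \<in> rz (src m) w" "fn m w = fst i" "fn n w = snd i" by (auto simp: span_rz_def m)
      obtain v' c where v': "fn e v' = w" "c \<in> rz ?V v'" "A a b = Some c" using a[OF w(1)] by blast
      then have "v' \<in> pts ?V" using asm_mem[OF arr_asm(1)[OF eA]] by blast
      from v[OF this] v' w show "\<exists>y\<in>\<kappa> i. A a b = Some y" by (auto simp: \<kappa>_def)
    qed
    moreover have "morphism_le A \<kappa> (\<lambda>i. rcomp (span_rz P) (span_rz Q) (fst i) (snd i))"
    proof -
      have "morphism_le A (rz ?V) (\<lambda>v. both A (rz (src p) (fn \<pi>1 v)) (rz (src r) (fn \<pi>2 v)))"
        using arr_le[OF \<pi>(1)] arr_le[OF \<pi>(2)] \<pi>(3,4,5) e(2) PA(3) by (intro le_bothI[OF pca]) simp_all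
      then obtain c where c: "\<And>v b. b \<in> rz ?V v \<Longrightarrow> \<exists>y\<in>both A (rz (src p) (fn \<pi>1 v)) (rz (src r) (fn \<pi>2 v)). A c b = Some y"
        by (rule morphism_leE) blast
      show ?thesis
      proof (rule morphism_leI[of _ _ _ c])
        fix i b assume "b \<in> \<kappa> i"
        then obtain v' where v': "b \<in> rz ?V v'" "fn p (fn \<pi>1 v') = fst i" "fn s (fn \<pi>2 v') = snd i"
          by (auto simp: \<kappa>_def)
        obtain y where y: "y \<in> both A (rz (src p) (fn \<pi>1 v')) (rz (src r) (fn \<pi>2 v'))" "A c b = Some y"
          using c[OF v'(1)] by blast
        have "v' \<in> pts ?V" using v'(1) asm_mem[OF arr_asm(1)[OF eA]] by blast
        note eq = v(3)[OF this]
        have "rz (src p) (fn \<pi>1 v') \<subseteq> span_rz P (fst i) (fn r (fn \<pi>2 v'))"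
          "rz (src r) (fn \<pi>2 v') \<subseteq> span_rz Q (fn r (fn \<pi>2 v')) (snd i)"
          using v' eq by (auto simp: span_rz_def p r)
        then have "y \<in> rcomp (span_rz P) (span_rz Q) (fst i) (snd i)" using y(1) unfolding rcomp_def both_def by blast
        with y(2) show "\<exists>y\<in>rcomp (span_rz P) (span_rz Q) (fst i) (snd i). A c b = Some y" by blast
      qed
    qed
    ultimately show ?thesis unfolding rel_le_def by (rule le_trans[OF pca])
  qed
  show "rel_le A (rcomp (span_rz P) (span_rz Q)) (span_rz H)"
  proof (rule rcomp_leI)
    let ?\<phi>1 = "\<lambda>i. span_rz P (fst (fst i)) (snd i)" and ?\<phi>2 = "\<lambda>i. span_rz Q (snd i) (snd (fst i))"
    let ?\<phi> = "\<lambda>i. both A (?\<phi>1 i) (?\<phi>2 i)"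
    have X: "is_assembly \<U> X" "is_assembly \<U> Y" "is_assembly \<U> Z"
      using relation_asm[OF P] relation_asm[OF Q] by auto
    have "{i. ?\<phi> i \<noteq> {}} \<subseteq> (pts X \<times> pts Z) \<times> pts Y"
      unfolding mem_Times_iff subset_iff mem_Collect_eq both_eq_empty_iff using span_rz_mem[OF P] span_rz_mem[OF Q] by blast
    then have "small \<U> {i. ?\<phi> i \<noteq> {}}"
      by (rule small_subset[OF univ, rotated]) (intro small_Times[OF univ] small_pts X)
    then obtain T j where T: "presents ?\<phi> T j" by (rule presents_exists)
    note l1 = both_le1[OF pca, of ?\<phi>1 ?\<phi>2] and l2 = both_le2[OF pca, of ?\<phi>1 ?\<phi>2]
    have "\<exists>w. span_rz P x y \<noteq> {} \<longrightarrow> w \<in> pts (src p) \<and> fn p w = x \<and> fn q w = y" for x y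
      using asm_mem[OF arr_asm(1)[OF PA(1)]] unfolding span_rz_def p fst_conv snd_conv by blast
    \<comment> \<open>Related points come from a point of the span, unique by injectivity; the guard
      keeps the selection total where nothing is related.\<close>
    then obtain w1 where w1: "\<And>x y. span_rz P x y \<noteq> {} \<Longrightarrow> w1 x y \<in> pts (src p) \<and> fn p (w1 x y) = x \<and> fn q (w1 x y) = y"
      by metis
    have "\<exists>w. span_rz Q x y \<noteq> {} \<longrightarrow> w \<in> pts (src r) \<and> fn r w = x \<and> fn s w = y" for x y
      using asm_mem[OF arr_asm(1)[OF QA(1)]] unfolding span_rz_def r fst_conv snd_conv by blast
    then obtain w2 where w2: "\<And>x y. span_rz Q x y \<noteq> {} \<Longrightarrow> w2 x y \<in> pts (src r) \<and> fn r (w2 x y) = x \<and> fn s (w2 x y) = y"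
      by metis
    have rl1: "span_rz P x y = rz (src p) (w1 x y)" if "span_rz P x y \<noteq> {}" for x y
      using span_rz_eq[OF P, of "w1 x y"] w1[OF that] by (simp add: p)
    have rl2: "span_rz Q x y = rz (src r) (w2 x y)" if "span_rz Q x y \<noteq> {}" for x y
      using span_rz_eq[OF Q, of "w2 x y"] w2[OF that] by (simp add: r)
    have le1: "morphism_le A ?\<phi> (\<lambda>i. rz (src p) (w1 (fst (fst i)) (snd i)))"
      using l1 rl1 by (subst le_cong_ne[where \<chi> = ?\<phi>1]) auto
    have le2: "morphism_le A ?\<phi> (\<lambda>i. rz (src r) (w2 (snd i) (snd (fst i))))"
      using l2 rl2 by (subst le_cong_ne[where \<chi> = ?\<phi>2]) auto
    obtain a where a: "a \<in> Arr C" "src a = T" "trg a = src p" "\<And>i. ?\<phi> i \<noteq> {} \<Longrightarrow> fn a (j i) = w1 (fst (fst i)) (snd i)"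
      using presents_arr[OF T arr_asm(1)[OF PA(1)] le1] by metis
    obtain b where b: "b \<in> Arr C" "src b = T" "trg b = src r" "\<And>i. ?\<phi> i \<noteq> {} \<Longrightarrow> fn b (j i) = w2 (snd i) (snd (fst i))"
      using presents_arr[OF T arr_asm(1)[OF QA(1)] le2] by metis
    have ab: "fn q (fn a (j i)) = snd i" "fn r (fn b (j i)) = snd i" "fn p (fn a (j i)) = fst (fst i)"
      "fn s (fn b (j i)) = snd (fst i)" if "?\<phi> i \<noteq> {}" for i
    proof -
      have "?\<phi>1 i \<noteq> {}" "?\<phi>2 i \<noteq> {}" using that by auto
      from w1[OF this(1)] w2[OF this(2)] a(4)[OF that] b(4)[OF that]
      show "fn q (fn a (j i)) = snd i" "fn r (fn b (j i)) = snd i" "fn p (fn a (j i)) = fst (fst i)"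
      "fn s (fn b (j i)) = snd (fst i)" by simp_all
    qed
    \<comment> \<open>Both composites send the code of an index to its middle point, so the pair
      factors through the pullback; composing with \<open>e\<close> lands in \<open>H\<close> over
      the right ends.\<close>
    have "q \<cdot>\<^bsub>C\<^esub> a = r \<cdot>\<^bsub>C\<^esub> b"
    proof (rule arr_eqI)
      show "q \<cdot>\<^bsub>C\<^esub> a \<in> Arr C" using PA a by (intro comp_arr) auto
      show "r \<cdot>\<^bsub>C\<^esub> b \<in> Arr C" using QA b by (intro comp_arr) auto
      fix t assume "t \<in> pts (src (q \<cdot>\<^bsub>C\<^esub> a))"
      then have t: "t \<in> pts T" using a by simp
      then obtain i where "?\<phi> i \<noteq> {}" "t = j i" using presentsD(3)[OF T] by blast
      then show "fn (q \<cdot>\<^bsub>C\<^esub> a) t = fn (r \<cdot>\<^bsub>C\<^esub> b) t"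
        using ab(1,2) t a(2) b(2) by (simp add: compose_def)
    qed (use PA QA a b in auto)
    then obtain h where h: "h \<in> Hom C T (src \<pi>1)" "\<pi>1 \<cdot>\<^bsub>C\<^esub> h = a" "\<pi>2 \<cdot>\<^bsub>C\<^esub> h = b"
      using factor[OF a(1) b(1)] a(2,3) b(2,3) PA(3) by auto
    have hA: "h \<in> Arr C" "src h = T" "trg h = ?V" using h(1) e(2) by (auto simp: Hom_def)
    have pm: "fn (m \<cdot>\<^bsub>C\<^esub> (e \<cdot>\<^bsub>C\<^esub> h)) (j i) = fst (fst i)" "fn (n \<cdot>\<^bsub>C\<^esub> (e \<cdot>\<^bsub>C\<^esub> h)) (j i) = snd (fst i)"
      if i: "?\<phi> i \<noteq> {}" for i
    proof -
      have t: "j i \<in> pts T" using presentsD(4)[OF T i] .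
      have t': "j i \<in> pts (src h)" "j i \<in> pts (src (e \<cdot>\<^bsub>C\<^esub> h))" using t hA(2) by simp_all
      have hv: "fn h (j i) \<in> pts ?V" using arr_mem[OF hA(1), of "j i"] t hA by simp
      have "fn a (j i) = fn \<pi>1 (fn h (j i))" "fn b (j i) = fn \<pi>2 (fn h (j i))"
        using comp_fn[OF t'(1), of \<pi>1] comp_fn[OF t'(1), of \<pi>2] unfolding h(2,3) by blast+
      then show "fn (m \<cdot>\<^bsub>C\<^esub> (e \<cdot>\<^bsub>C\<^esub> h)) (j i) = fst (fst i)" "fn (n \<cdot>\<^bsub>C\<^esub> (e \<cdot>\<^bsub>C\<^esub> h)) (j i) = snd (fst i)"
        using comp_fn[OF t'(2), of m] comp_fn[OF t'(2), of n] comp_fn[OF t'(1), of e] v(1,2)[OF hv] ab(3,4)[OF i] by metis+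
    qed
    have eh: "e \<cdot>\<^bsub>C\<^esub> h \<in> Arr C" "trg (e \<cdot>\<^bsub>C\<^esub> h) = src m" "src (e \<cdot>\<^bsub>C\<^esub> h) = T"
      using comp_arr[OF hA(1) eA hA(3)] e(3) hA by simp_all
    have meh: "m \<cdot>\<^bsub>C\<^esub> (e \<cdot>\<^bsub>C\<^esub> h) \<in> Arr C" "n \<cdot>\<^bsub>C\<^esub> (e \<cdot>\<^bsub>C\<^esub> h) \<in> Arr C"
      using comp_arr[OF eh(1) HA(1) eh(2)] comp_arr[OF eh(1) HA(2)] eh(2) HA(3) by metis+
    have st: "src (g \<cdot>\<^bsub>C\<^esub> f) = src f" "trg (g \<cdot>\<^bsub>C\<^esub> f) = trg g" for f g by simp_all
    have "holds C H (m \<cdot>\<^bsub>C\<^esub> (e \<cdot>\<^bsub>C\<^esub> h)) (n \<cdot>\<^bsub>C\<^esub> (e \<cdot>\<^bsub>C\<^esub> h))"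
      unfolding holds_def m prod.case using eh(1,2) unfolding Ass_simps(1,2) by blast
    then show "morphism_le A ?\<phi> (\<lambda>i. span_rz H (fst (fst i)) (snd (fst i)))"
      using holds_presented_iff[OF T H meh(1) _ _ pm(1) meh(2) _ _ pm(2)] eh(3) HA(4,5) unfolding st by blast
  qed
qed

end

section \<open>Arrows of the realizability topos\<close>

lemma exreg_Hom: "f \<in> Hom (exreg C) R S \<longleftrightarrow> R \<in> Obj (exreg C) \<and> S \<in> Obj (exreg C) \<and>
    (\<exists>P. functional_relation C R S P \<and> f = (R, rel_class C P, S))"
  unfolding Hom_def exreg_def by (cases f) (auto simp del: split_paired_Ex split_paired_All)

lemma category_simps:
  assumes "category D"
  shows "X \<in> Obj D \<Longrightarrow> Ident D X \<in> Hom D X X"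
    "f \<in> Hom D X Y \<Longrightarrow> g \<in> Hom D Y Z \<Longrightarrow> g \<cdot>\<^bsub>D\<^esub> f \<in> Hom D X Z"
    "f \<in> Hom D X Y \<Longrightarrow> f \<cdot>\<^bsub>D\<^esub> Ident D X = f"
    "f \<in> Hom D X Y \<Longrightarrow> Ident D Y \<cdot>\<^bsub>D\<^esub> f = f"
    "f \<in> Hom D X Y \<Longrightarrow> g \<in> Hom D Y Z \<Longrightarrow> h \<in> Hom D Z W \<Longrightarrow> h \<cdot>\<^bsub>D\<^esub> (g \<cdot>\<^bsub>D\<^esub> f) = (h \<cdot>\<^bsub>D\<^esub> g) \<cdot>\<^bsub>D\<^esub> f"
    "f \<in> Hom D X Y \<Longrightarrow> X \<in> Obj D" "f \<in> Hom D X Y \<Longrightarrow> Y \<in> Obj D"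
  using assms by (auto simp: category_def Hom_def)

abbreviation carrier_of :: "('u, 'a) rt_obj \<Rightarrow> ('u, 'a) assembly" where "carrier_of R \<equiv> trg (fst R)"

text \<open>The choice of a representing relation matters only up to entailment in both directions.\<close>

definition arr_rz :: "('u, 'a) rt_arr \<Rightarrow> 'u \<Rightarrow> 'u \<Rightarrow> 'a set" where
  "arr_rz f = span_rz (SOME P. P \<in> fst (snd f))"

context assemblies begin

abbreviation T where "T \<equiv> RT \<U> A"

definition rel_equiv :: "('u \<Rightarrow> 'u \<Rightarrow> 'a set) \<Rightarrow> ('u \<Rightarrow> 'u \<Rightarrow> 'a set) \<Rightarrow> bool" where
  "rel_equiv \<rho> \<sigma> \<longleftrightarrow> rel_le A \<rho> \<sigma> \<and> rel_le A \<sigma> \<rho>"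

lemma rel_equiv_refl: "rel_equiv \<rho> \<rho>" and rel_equiv_sym: "rel_equiv \<rho> \<sigma> \<Longrightarrow> rel_equiv \<sigma> \<rho>"
  by (auto simp: rel_equiv_def rel_le_refl)

lemma rel_equiv_trans: "rel_equiv \<rho> \<sigma> \<Longrightarrow> rel_equiv \<sigma> \<tau> \<Longrightarrow> rel_equiv \<rho> \<tau>"
  unfolding rel_equiv_def using rel_le_trans by blast

lemma rcomp_cong: "rel_equiv \<rho> \<rho>' \<Longrightarrow> rel_equiv \<sigma> \<sigma>' \<Longrightarrow> rel_equiv (rcomp \<rho> \<sigma>) (rcomp \<rho>' \<sigma>')"
  unfolding rel_equiv_def using rcomp_mono by blast

lemma RT_simps:
  "Dom T f = fst f" "Cod T f = snd (snd f)" "Ident T R = (R, rel_class C R, R)"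
  "g \<cdot>\<^bsub>T\<^esub> f = (fst f, {H. \<exists>P\<in>fst (snd f). \<exists>Q\<in>fst (snd g). rel_composite C P Q H}, snd (snd g))"
  unfolding RT_def exreg_def by (auto split: prod.splits)

lemma RT_obj: "R \<in> Obj T \<longleftrightarrow> is_relation C (carrier_of R) (carrier_of R) R \<and> is_equivalence (carrier_of R) (span_rz R)"
  unfolding RT_def exreg_def by (simp add: equiv_relation_iff)

lemma rel_class_iff:
  assumes P: "is_relation C X Y P"
  shows "Q \<in> rel_class C P \<longleftrightarrow> is_relation C X Y Q \<and> rel_equiv (span_rz P) (span_rz Q)"
proof -
  have X: "Cod C (fst P) = X" "Cod C (snd P) = Y" using P by (auto simp: is_relation_iff)
  show ?thesis
    unfolding rel_class_def mem_Collect_eq X rel_iso_def rel_equiv_def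
    using holds_iff_rel_le[OF P] holds_iff_rel_le[OF _ P] by blast
qed

lemma rel_class_eqI:
  assumes P: "is_relation C X Y P" and Q: "is_relation C X Y Q" and eq: "rel_equiv (span_rz P) (span_rz Q)"
  shows "rel_class C P = rel_class C Q"
  using rel_class_iff[OF P] rel_class_iff[OF Q] eq rel_equiv_sym rel_equiv_trans by blast

lemma RT_arr: "f \<in> Hom T R S \<longleftrightarrow> R \<in> Obj T \<and> S \<in> Obj T \<and>
    (\<exists>P. is_relation C (carrier_of R) (carrier_of S) P \<and> is_functional (carrier_of R) (carrier_of S) (span_rz R) (span_rz S) (span_rz P) \<and> f = (R, rel_class C P, S))"
proof -
  have "f \<in> Hom T R S \<longleftrightarrow> R \<in> Obj T \<and> S \<in> Obj T \<and> (\<exists>P. functional_relation C R S P \<and> f = (R, rel_class C P, S))"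
    unfolding RT_def by (rule exreg_Hom)
  also have "\<dots> \<longleftrightarrow> R \<in> Obj T \<and> S \<in> Obj T \<and>
    (\<exists>P. (is_relation C (carrier_of R) (carrier_of S) P \<and> is_functional (carrier_of R) (carrier_of S) (span_rz R) (span_rz S) (span_rz P)) \<and> f = (R, rel_class C P, S))"
    using functional_relation_iff[of "carrier_of R" R "carrier_of S" S] unfolding RT_obj by blast
  finally show ?thesis by blast
qed

text \<open>Any member of the class may serve as representative, in particular the one selected in
  \<open>arr_rz\<close>; whatever is known of one of them passes to \<open>arr_rz\<close> up to
  equivalence.\<close>

lemma RT_mem:
  assumes f: "f \<in> Hom T R S" and P: "P \<in> fst (snd f)"
  shows "is_relation C (carrier_of R) (carrier_of S) P" "rel_equiv (span_rz P) (arr_rz f)"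
    "is_functional (carrier_of R) (carrier_of S) (span_rz R) (span_rz S) (span_rz P)" "f = (R, rel_class C P, S)"
proof -
  obtain P0 where P0: "is_relation C (carrier_of R) (carrier_of S) P0" "is_functional (carrier_of R) (carrier_of S) (span_rz R) (span_rz S) (span_rz P0)"
    "f = (R, rel_class C P0, S)" using f unfolding RT_arr by blast
  have mem: "Q \<in> fst (snd f) \<longleftrightarrow> is_relation C (carrier_of R) (carrier_of S) Q \<and> rel_equiv (span_rz P0) (span_rz Q)" for Q
    using rel_class_iff[OF P0(1)] P0(3) by simp
  have "(SOME P. P \<in> fst (snd f)) \<in> fst (snd f)" using P by (rule someI)
  then have "rel_equiv (span_rz P0) (arr_rz f)" unfolding mem arr_rz_def by blast
  then show "is_relation C (carrier_of R) (carrier_of S) P" "rel_equiv (span_rz P) (arr_rz f)"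
    using P rel_equiv_sym rel_equiv_trans unfolding mem by blast+
  have e: "rel_equiv (span_rz P0) (span_rz P)" using P mem by blast
  then show "is_functional (carrier_of R) (carrier_of S) (span_rz R) (span_rz S) (span_rz P)" using is_functional_cong[OF P0(2)] unfolding rel_equiv_def by blast
  show "f = (R, rel_class C P, S)"
    using rel_class_eqI[OF P0(1) \<open>is_relation C (carrier_of R) (carrier_of S) P\<close> e] P0(3) by simp
qed

lemma RT_rep:
  assumes f: "f \<in> Hom T R S"
  obtains P where "P \<in> fst (snd f)" "is_relation C (carrier_of R) (carrier_of S) P" "rel_equiv (span_rz P) (arr_rz f)" "f = (R, rel_class C P, S)"
proof -
  obtain P where P: "is_relation C (carrier_of R) (carrier_of S) P" "f = (R, rel_class C P, S)"
    using f unfolding RT_arr by blast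
  then have "P \<in> fst (snd f)" using rel_class_iff[OF P(1)] rel_equiv_refl by simp
  from that[OF this RT_mem(1,2,4)[OF f this]] show thesis .
qed

lemma RT_obj_of: "f \<in> Hom T R S \<Longrightarrow> R \<in> Obj T" "f \<in> Hom T R S \<Longrightarrow> S \<in> Obj T"
  unfolding RT_arr by blast+

lemma arr_rz_functional:
  assumes f: "f \<in> Hom T R S"
  shows "is_functional (carrier_of R) (carrier_of S) (span_rz R) (span_rz S) (arr_rz f)"
proof -
  obtain P where P: "P \<in> fst (snd f)" by (rule RT_rep[OF f])
  show ?thesis using is_functional_cong[OF RT_mem(3)[OF f P]] RT_mem(2)[OF f P] unfolding rel_equiv_def by blast
qed

text \<open>One entailment suffices, as comparable functional relations are equivalent. This halves
  all later proofs of equality of arrows.\<close>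

lemma RT_eqI:
  assumes f: "f \<in> Hom T R S" and g: "g \<in> Hom T R S" and le: "rel_le A (arr_rz f) (arr_rz g)"
  shows "f = g"
proof -
  have "is_equivalence (carrier_of R) (span_rz R)" using RT_obj_of(1)[OF f] unfolding RT_obj by blast
  then have "rel_equiv (arr_rz f) (arr_rz g)"
    using is_functional_antisym[OF arr_rz_functional[OF f] arr_rz_functional[OF g] le] le unfolding rel_equiv_def by blast
  moreover obtain P where P: "is_relation C (carrier_of R) (carrier_of S) P" "rel_equiv (span_rz P) (arr_rz f)" "f = (R, rel_class C P, S)"
    by (rule RT_rep[OF f])
  moreover obtain Q where Q: "is_relation C (carrier_of R) (carrier_of S) Q" "rel_equiv (span_rz Q) (arr_rz g)" "g = (R, rel_class C Q, S)"
    by (rule RT_rep[OF g])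
  ultimately have "rel_equiv (span_rz P) (span_rz Q)" using rel_equiv_sym rel_equiv_trans by blast
  from rel_class_eqI[OF P(1) Q(1) this] P(3) Q(3) show ?thesis by simp
qed

text \<open>Arrows are defined by formulas: strictness, contained in \<open>is_functional\<close>,
  turns the formula into a span.\<close>

lemma RT_exists:
  assumes "R \<in> Obj T" "S \<in> Obj T" and F: "is_functional (carrier_of R) (carrier_of S) (span_rz R) (span_rz S) \<rho>"
  obtains f where "f \<in> Hom T R S" "rel_equiv (arr_rz f) \<rho>"
proof -
  have X: "is_assembly \<U> (carrier_of R)" "is_assembly \<U> (carrier_of S)"
    using relation_asm assms(1,2) unfolding RT_obj by blast+
  obtain P where P: "is_relation C (carrier_of R) (carrier_of S) P" "span_rz P = \<rho>"
    using span_of_family[OF X F[unfolded is_functional_def, THEN conjunct1] F[unfolded is_functional_def, THEN conjunct2, THEN conjunct1]] .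
  have f: "(R, rel_class C P, S) \<in> Hom T R S" unfolding RT_arr using assms P by blast
  moreover have "P \<in> fst (snd (R, rel_class C P, S))" using rel_class_iff[OF P(1)] P(1) rel_equiv_refl by simp
  from RT_mem(2)[OF f this] have "rel_equiv (arr_rz (R, rel_class C P, S)) \<rho>" using P(2) rel_equiv_sym by blast
  ultimately show thesis by (rule that)
qed

lemma arr_rz_ident:
  assumes "category T" "R \<in> Obj T"
  shows "rel_equiv (arr_rz (Ident T R)) (span_rz R)"
proof -
  have R: "is_relation C (carrier_of R) (carrier_of R) R" using assms(2) unfolding RT_obj by blast
  have "Ident T R \<in> Hom T R R" using category_simps(1)[OF assms] .
  moreover have "R \<in> fst (snd (Ident T R))"
    unfolding RT_simps fst_conv snd_conv using rel_class_iff[OF R] R rel_equiv_refl by simp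
  ultimately show ?thesis using RT_mem(2) rel_equiv_sym by blast
qed

text \<open>The category laws make the composite an arrow, whose class therefore has a member; that
  member is a composite of some representatives of \<open>f\<close> and \<open>g\<close>, and their
  choice does not matter.\<close>

lemma arr_rz_comp:
  assumes "category T" and f: "f \<in> Hom T R S" and g: "g \<in> Hom T S W"
  shows "rel_equiv (arr_rz (g \<cdot>\<^bsub>T\<^esub> f)) (rcomp (arr_rz f) (arr_rz g))"
proof -
  have gf: "g \<cdot>\<^bsub>T\<^esub> f \<in> Hom T R W" using category_simps(2)[OF assms] .
  then obtain H where H: "H \<in> fst (snd (g \<cdot>\<^bsub>T\<^esub> f))" "rel_equiv (span_rz H) (arr_rz (g \<cdot>\<^bsub>T\<^esub> f))" by (rule RT_rep)
  from H(1) obtain P Q where PQ: "P \<in> fst (snd f)" "Q \<in> fst (snd g)" "rel_composite C P Q H"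
    unfolding RT_simps by auto
  note P = RT_mem(1,2)[OF f PQ(1)] and Q = RT_mem(1,2)[OF g PQ(2)]
  have "rel_equiv (span_rz H) (rcomp (span_rz P) (span_rz Q))" using rel_compositeD(2,3)[OF P(1) Q(1) PQ(3)] unfolding rel_equiv_def by blast
  with H(2) rcomp_cong[OF P(2) Q(2)] show ?thesis using rel_equiv_sym rel_equiv_trans by blast
qed

text \<open>The standard embedding of assemblies into the completion: an assembly with equality as
  its equivalence relation.\<close>

definition diagonal :: "('u, 'a) assembly \<Rightarrow> ('u, 'a) rt_obj" where
  "diagonal X = (Ident C X, Ident C X)"

lemma diagonal:
  assumes X: "is_assembly \<U> X"
  shows "diagonal X \<in> Obj T" "carrier_of (diagonal X) = X" "span_rz (diagonal X) x y = (if x = y then rz X x else {})"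
proof -
  show c: "carrier_of (diagonal X) = X" by (simp add: diagonal_def)
  show span_rz: "span_rz (diagonal X) x y = (if x = y then rz X x else {})" for x y
    using asm_mem[OF X] by (auto simp: span_rz_def diagonal_def restrict_def split: if_splits)
  have "is_relation C X X (diagonal X)"
    unfolding is_relation_iff using ident_arr[OF X] by (auto simp: diagonal_def)
  moreover have "is_equivalence X (span_rz (diagonal X))"
    unfolding is_equivalence_def
  proof (intro conjI)
    show "morphism_le A (rz X) (\<lambda>x. span_rz (diagonal X) x x)" unfolding span_rz by (simp add: le_refl[OF pca])
    show "morphism_le A (\<lambda>p. span_rz (diagonal X) (fst p) (snd p)) (\<lambda>p. span_rz (diagonal X) (snd p) (fst p))"
      unfolding span_rz by (rule le_sub[OF pca]) auto
    show "morphism_le A (\<lambda>p. both A (span_rz (diagonal X) (fst p) (fst (snd p))) (span_rz (diagonal X) (fst (snd p)) (snd (snd p))))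
       (\<lambda>p. span_rz (diagonal X) (fst p) (snd (snd p)))"
      by (rule le_trans[OF pca le_sub[OF pca] both_le1[OF pca, where \<psi> = "\<lambda>p. span_rz (diagonal X) (fst (snd p)) (snd (snd p))"]])
         (auto simp: span_rz)
  qed
  ultimately show "diagonal X \<in> Obj T" unfolding RT_obj c by blast
qed

end

section \<open>Adjunctions with fully faithful right adjoint\<close>

text \<open>The second and third properties say that composition with \<open>\<epsilon>\<close> is
  bijective on arrows coming from the left adjoint. The last two are the two directions in which the
  criterion for full faithfulness is used: a section of \<open>\<epsilon>\<close> is enough for
  building \<open>\<delta>\<close>, while a two-sided inverse is supplied in return.\<close>

lemma counit_of_adjunction:
  assumes adj: "left_adjoint C D F G"
  obtains \<epsilon> where "\<And>Y. Y \<in> Obj D \<Longrightarrow> \<epsilon> Y \<in> Hom D (on_obj F (on_obj G Y)) Y"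
    "\<And>X Y c. X \<in> Obj C \<Longrightarrow> Y \<in> Obj D \<Longrightarrow> c \<in> Hom D (on_obj F X) Y \<Longrightarrow>
      \<exists>k\<in>Hom C X (on_obj G Y). \<epsilon> Y \<cdot>\<^bsub>D\<^esub> on_arr F k = c"
    "\<And>X Y k k'. X \<in> Obj C \<Longrightarrow> Y \<in> Obj D \<Longrightarrow> k \<in> Hom C X (on_obj G Y) \<Longrightarrow> k' \<in> Hom C X (on_obj G Y) \<Longrightarrow>
      \<epsilon> Y \<cdot>\<^bsub>D\<^esub> on_arr F k = \<epsilon> Y \<cdot>\<^bsub>D\<^esub> on_arr F k' \<Longrightarrow> k = k'"
    "\<And>Y. fully_faithful D C G \<Longrightarrow> Y \<in> Obj D \<Longrightarrow>
      \<exists>h\<in>Hom D Y (on_obj F (on_obj G Y)). \<epsilon> Y \<cdot>\<^bsub>D\<^esub> h = Ident D Y"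
    "(\<And>Y. Y \<in> Obj D \<Longrightarrow> \<exists>h\<in>Hom D Y (on_obj F (on_obj G Y)).
      \<epsilon> Y \<cdot>\<^bsub>D\<^esub> h = Ident D Y \<and> h \<cdot>\<^bsub>D\<^esub> \<epsilon> Y = Ident D (on_obj F (on_obj G Y))) \<Longrightarrow> fully_faithful D C G"
proof -
  have FF: "is_functor C D F" and GG: "is_functor D C G" using adj by (auto simp: left_adjoint_def)
  have C: "category C" and D: "category D" using FF by (auto simp: is_functor_def)
  note cC = category_simps[OF C] and cD = category_simps[OF D]
  have Fo: "on_obj F X \<in> Obj D" "on_arr F (Ident C X) = Ident D (on_obj F X)" if "X \<in> Obj C" for X
    using FF that by (auto simp: is_functor_def)
  have Go: "on_obj G X \<in> Obj C" "on_arr G (Ident D X) = Ident C (on_obj G X)" if "X \<in> Obj D" for X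
    using GG that by (auto simp: is_functor_def)
  have Fa: "on_arr F f \<in> Hom D (on_obj F X) (on_obj F Y)" if "f \<in> Hom C X Y" for f X Y
    using FF that by (auto simp: is_functor_def Hom_def)
  have Ga: "on_arr G f \<in> Hom C (on_obj G X) (on_obj G Y)" if "f \<in> Hom D X Y" for f X Y
    using GG that by (auto simp: is_functor_def Hom_def)
  have Gc: "on_arr G (g \<cdot>\<^bsub>D\<^esub> f) = on_arr G g \<cdot>\<^bsub>C\<^esub> on_arr G f" if "f \<in> Hom D X Y" "g \<in> Hom D Y Z" for f g X Y Z
    using GG that by (auto simp: is_functor_def Hom_def)
  obtain \<Phi> where bij: "\<And>X Y. X \<in> Obj C \<Longrightarrow> Y \<in> Obj D \<Longrightarrow>
      bij_betw (\<Phi> X Y) (Hom D (on_obj F X) Y) (Hom C X (on_obj G Y))"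
    and nat: "\<And>X X' Y Y' g f h. X \<in> Obj C \<Longrightarrow> X' \<in> Obj C \<Longrightarrow> Y \<in> Obj D \<Longrightarrow> Y' \<in> Obj D \<Longrightarrow>
      g \<in> Hom C X' X \<Longrightarrow> f \<in> Hom D (on_obj F X) Y \<Longrightarrow> h \<in> Hom D Y Y' \<Longrightarrow>
      \<Phi> X' Y' (h \<cdot>\<^bsub>D\<^esub> f \<cdot>\<^bsub>D\<^esub> on_arr F g) = on_arr G h \<cdot>\<^bsub>C\<^esub> \<Phi> X Y f \<cdot>\<^bsub>C\<^esub> g"
    using adj unfolding left_adjoint_def by metis
  define \<epsilon> where "\<epsilon> Y = inv_into (Hom D (on_obj F (on_obj G Y)) Y) (\<Phi> (on_obj G Y) Y) (Ident C (on_obj G Y))" for Y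
  have \<epsilon>: "\<epsilon> Y \<in> Hom D (on_obj F (on_obj G Y)) Y" "\<Phi> (on_obj G Y) Y (\<epsilon> Y) = Ident C (on_obj G Y)"
    if Y: "Y \<in> Obj D" for Y
  proof -
    have "Ident C (on_obj G Y) \<in> \<Phi> (on_obj G Y) Y ` Hom D (on_obj F (on_obj G Y)) Y"
      using bij[OF Go(1)[OF Y] Y] cC(1)[OF Go(1)[OF Y]] by (simp add: bij_betw_def)
    then show "\<epsilon> Y \<in> Hom D (on_obj F (on_obj G Y)) Y" "\<Phi> (on_obj G Y) Y (\<epsilon> Y) = Ident C (on_obj G Y)"
      unfolding \<epsilon>_def by (rule inv_into_into, rule f_inv_into_f)
  qed
  have \<Phi>k: "\<Phi> X Y (\<epsilon> Y \<cdot>\<^bsub>D\<^esub> on_arr F k) = k" if "X \<in> Obj C" "Y \<in> Obj D" "k \<in> Hom C X (on_obj G Y)" for X Y k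
    using nat[OF Go(1) that(1) that(2) that(2) that(3) \<epsilon>(1) cD(1)] that cD(4)[OF \<epsilon>(1)] \<epsilon>(2) Go(2)
      cC(4)[OF cC(1)[OF Go(1)]] cC(4)[OF that(3)] by simp
  \<comment> \<open>On arrows \<open>G\<close> is precomposition with the counit followed by the
    bijection \<open>\<Phi>\<close>. So it is bijective on hom-sets whenever the counit is
    invertible.\<close>
  have \<Phi>f: "\<Phi> (on_obj G Y) Z (f \<cdot>\<^bsub>D\<^esub> \<epsilon> Y) = on_arr G f" if Y: "Y \<in> Obj D" and Z: "Z \<in> Obj D" and f: "f \<in> Hom D Y Z" for Y Z f
    using nat[OF Go(1)[OF Y] Go(1)[OF Y] Y Z cC(1)[OF Go(1)[OF Y]] \<epsilon>(1)[OF Y] f] Fo(2)[OF Go(1)[OF Y]]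
      cD(3)[OF cD(2)[OF \<epsilon>(1)[OF Y] f]] \<epsilon>(2)[OF Y] cC(3)[OF Ga[OF f]] by simp
  show thesis
  proof (rule that[of \<epsilon>])
    fix X Y c assume XY: "X \<in> Obj C" "Y \<in> Obj D" and c: "c \<in> Hom D (on_obj F X) Y"
    have k: "\<Phi> X Y c \<in> Hom C X (on_obj G Y)" using bij[OF XY] c by (auto simp: bij_betw_def)
    have "\<epsilon> Y \<cdot>\<^bsub>D\<^esub> on_arr F (\<Phi> X Y c) \<in> Hom D (on_obj F X) Y" by (rule cD(2)[OF Fa[OF k] \<epsilon>(1)[OF XY(2)]])
    with \<Phi>k[OF XY k] bij[OF XY] c have "\<epsilon> Y \<cdot>\<^bsub>D\<^esub> on_arr F (\<Phi> X Y c) = c" by (auto simp: bij_betw_def inj_on_def)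
    with k show "\<exists>k\<in>Hom C X (on_obj G Y). \<epsilon> Y \<cdot>\<^bsub>D\<^esub> on_arr F k = c" by blast
  next
    fix X Y k k' assume "X \<in> Obj C" "Y \<in> Obj D" "k \<in> Hom C X (on_obj G Y)" "k' \<in> Hom C X (on_obj G Y)"
      "\<epsilon> Y \<cdot>\<^bsub>D\<^esub> on_arr F k = \<epsilon> Y \<cdot>\<^bsub>D\<^esub> on_arr F k'"
    then show "k = k'" using \<Phi>k by metis
  next
    fix Y assume ff: "fully_faithful D C G" and Y: "Y \<in> Obj D"
    let ?F = "on_obj F (on_obj G Y)"
    have F: "?F \<in> Obj D" using Fo(1)[OF Go(1)[OF Y]] .
    \<comment> \<open>The unit at the direct image of \<open>Y\<close>. Fullness presents it as the
      image of some \<open>h\<close>; the triangle identity and faithfulness make \<open>h\<close> a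
      section of the counit.\<close>
    have "\<Phi> (on_obj G Y) ?F (Ident D ?F) \<in> Hom C (on_obj G Y) (on_obj G ?F)" (is "?\<eta> \<in> _")
      using bij[OF Go(1)[OF Y] F] cD(1)[OF F] by (auto simp: bij_betw_def)
    moreover have "on_arr G ` Hom D Y ?F = Hom C (on_obj G Y) (on_obj G ?F)"
      using ff Y F unfolding fully_faithful_def bij_betw_def by blast
    ultimately obtain h where h: "h \<in> Hom D Y ?F" "on_arr G h = ?\<eta>" by (metis imageE)
    have "on_arr G (\<epsilon> Y \<cdot>\<^bsub>D\<^esub> h) = on_arr G (\<epsilon> Y) \<cdot>\<^bsub>C\<^esub> ?\<eta>" using Gc[OF h(1) \<epsilon>(1)[OF Y]] h(2) by simp
    also have "\<dots> = \<Phi> (on_obj G Y) Y (\<epsilon> Y)"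
      using nat[OF Go(1)[OF Y] Go(1)[OF Y] F Y cC(1)[OF Go(1)[OF Y]] cD(1)[OF F] \<epsilon>(1)[OF Y]]
        Fo(2)[OF Go(1)[OF Y]] cD(3)[OF \<epsilon>(1)[OF Y]] cC(3)[OF cC(2)[OF \<open>?\<eta> \<in> _\<close> Ga[OF \<epsilon>(1)[OF Y]]]] by simp
    also have "\<dots> = on_arr G (Ident D Y)" using \<epsilon>(2)[OF Y] Go(2)[OF Y] by simp
    finally have "on_arr G (\<epsilon> Y \<cdot>\<^bsub>D\<^esub> h) = on_arr G (Ident D Y)" .
    moreover have "inj_on (on_arr G) (Hom D Y Y)" using ff Y unfolding fully_faithful_def bij_betw_def by blast
    ultimately have "\<epsilon> Y \<cdot>\<^bsub>D\<^esub> h = Ident D Y"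
      using cD(2)[OF h(1) \<epsilon>(1)[OF Y]] cD(1)[OF Y] by (auto simp: inj_on_def)
    with h(1) show "\<exists>h\<in>Hom D Y ?F. \<epsilon> Y \<cdot>\<^bsub>D\<^esub> h = Ident D Y" by blast
  next
    assume iso: "\<And>Y. Y \<in> Obj D \<Longrightarrow> \<exists>h\<in>Hom D Y (on_obj F (on_obj G Y)).
      \<epsilon> Y \<cdot>\<^bsub>D\<^esub> h = Ident D Y \<and> h \<cdot>\<^bsub>D\<^esub> \<epsilon> Y = Ident D (on_obj F (on_obj G Y))"
    show "fully_faithful D C G"
      unfolding fully_faithful_def
    proof (intro ballI)
      fix Y Z assume Y: "Y \<in> Obj D" and Z: "Z \<in> Obj D"
      let ?F = "on_obj F (on_obj G Y)"
      obtain h where h: "h \<in> Hom D Y ?F" "\<epsilon> Y \<cdot>\<^bsub>D\<^esub> h = Ident D Y" "h \<cdot>\<^bsub>D\<^esub> \<epsilon> Y = Ident D ?F"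
        using iso[OF Y] by blast
      note e = \<epsilon>(1)[OF Y]
      have "bij_betw (\<lambda>f. f \<cdot>\<^bsub>D\<^esub> \<epsilon> Y) (Hom D Y Z) (Hom D ?F Z)"
      proof (rule bij_betw_byWitness[where f' = "\<lambda>g. g \<cdot>\<^bsub>D\<^esub> h"])
        show "\<forall>f\<in>Hom D Y Z. f \<cdot>\<^bsub>D\<^esub> \<epsilon> Y \<cdot>\<^bsub>D\<^esub> h = f"
          using cD(5)[OF h(1) e] h(2) cD(3) by metis
        show "\<forall>g\<in>Hom D ?F Z. g \<cdot>\<^bsub>D\<^esub> h \<cdot>\<^bsub>D\<^esub> \<epsilon> Y = g"
          using cD(5)[OF e h(1)] h(3) cD(3) by metis
        show "(\<lambda>f. f \<cdot>\<^bsub>D\<^esub> \<epsilon> Y) ` Hom D Y Z \<subseteq> Hom D ?F Z" using cD(2)[OF e] by blast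
        show "(\<lambda>g. g \<cdot>\<^bsub>D\<^esub> h) ` Hom D ?F Z \<subseteq> Hom D Y Z" using cD(2)[OF h(1)] by blast
      qed
      from bij_betw_trans[OF this bij[OF Go(1)[OF Y] Z]]
      show "bij_betw (on_arr G) (Hom D Y Z) (Hom C (on_obj G Y) (on_obj G Z))"
        using \<Phi>f[OF Y Z] by (subst bij_betw_cong[where g = "\<Phi> (on_obj G Y) Z \<circ> (\<lambda>f. f \<cdot>\<^bsub>D\<^esub> \<epsilon> Y)"]) auto
    qed
  qed (rule \<epsilon>(1))
qed

lemma img_both:
  assumes "pca A" "pca B" "applicative_morphism A B \<gamma>"
    "morphism_le B \<chi> (\<lambda>i. \<Union>(\<gamma> ` \<phi> i))" "morphism_le B \<chi> (\<lambda>i. \<Union>(\<gamma> ` \<psi> i))"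
  shows "morphism_le B \<chi> (\<lambda>i. \<Union>(\<gamma> ` both A (\<phi> i) (\<psi> i)))"
  using le_trans[OF assms(2) le_bothI[OF assms(2,4,5)] img_both_le[OF assms(1-3)]] .

text \<open>Entailments use realizers acting on pairs, applicative morphisms use curried ones; this
  passes from the former to the latter.\<close>

lemma le_curry:
  assumes "pca A" "morphism_le A (\<lambda>i. both A (\<phi> i) (\<psi> i)) \<chi>"
  shows "\<exists>r. \<forall>i. \<forall>a\<in>\<phi> i. \<forall>a'\<in>\<psi> i. \<exists>y\<in>\<chi> i. tapp A (A r a) (Some a') = Some y"
proof -
  obtain s where s: "\<And>i b. b \<in> both A (\<phi> i) (\<psi> i) \<Longrightarrow> \<exists>y\<in>\<chi> i. A s b = Some y"
    using assms(2) by (rule morphism_leE) blast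
  obtain p where p: "\<And>x y. tapp A (A p x) (Some y) = Some (pairing A x y)"
    using is_pairing_pairing[OF assms(1)] by (auto simp: is_pairing_def)
  define t where "t = PApp (PCon s) (PApp (PApp (PCon p) (PVar 0)) (PVar 1))"
  obtain r where r: "\<And>x. \<exists>d. A r x = Some d \<and>
      (\<forall>y z. peval A (\<lambda>n. if n = 0 then x else if n = 1 then y else undefined) t = Some z \<longrightarrow> A d y = Some z)"
    using combinatory_completeness2[OF assms(1)] by metis
  have "tapp A (A r a) (Some a') = Some y" if "A s (pairing A a a') = Some y" for a a' y
    using r[of a] that p by (auto simp: t_def)
  with s show ?thesis by (intro exI[of _ r]) (fastforce simp: both_def)
qed

text \<open>Application is itself realized when every element is its own realizer. The guard empties
  the family where the application does not have the value \<open>h i\<close>.\<close>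

lemma app_le:
  assumes "pca B"
  shows "morphism_le B (\<lambda>i. if B (f i) (g i) = Some (h i) then both B {f i} {g i} else {}) (\<lambda>i. {h i})"
proof -
  obtain l where l: "\<And>x y. B l (pairing B x y) = Some x"
    using is_pairing_pairing[OF assms] by (auto simp: is_pairing_def)
  obtain q where q: "\<And>x y. B q (pairing B x y) = Some y"
    using is_pairing_pairing[OF assms] by (auto simp: is_pairing_def)
  obtain c where c: "\<And>x z. peval B (\<lambda>_. x) (PApp (PApp (PCon l) (PVar 0)) (PApp (PCon q) (PVar 0))) = Some z \<Longrightarrow> B c x = Some z"
    using combinatory_completeness1[OF assms] by blast
  show ?thesis by (rule morphism_leI[of _ _ _ c]) (auto simp: both_def l q split: if_splits intro!: c)
qed

section \<open>The candidate section of a dense morphism\<close>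

text \<open>The largest family \<open>\<delta>\<close> for which \<open>m\<close> realizes the
  entailment from \<open>\<gamma>\<delta>\<close> to the identity.\<close>

definition dense_section :: "'b papp \<Rightarrow> ('a \<Rightarrow> 'b set) \<Rightarrow> 'b \<Rightarrow> 'b \<Rightarrow> 'a set" where
  "dense_section B \<gamma> m b = {a. set_app_defined B m (\<gamma> a) \<and> set_app B m (\<gamma> a) \<subseteq> {b}}"

text \<open>The transposition rule: density turns a realizer \<open>t\<close> over \<open>B\<close>
  into some \<open>a\<close> over \<open>A\<close> whose values are sent by \<open>m\<close> into
  those of \<open>t\<close>. With \<open>dense_section_le\<close> it makes the candidate behave as a
  right adjoint to the image on singletons.\<close>

lemma dense_le:
  assumes m: "\<And>b. \<exists>a. \<forall>a'. set_app_defined B b (\<gamma> a') \<longrightarrow>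
        (\<exists>c. A a a' = Some c \<and> set_app_defined B m (\<gamma> c) \<and> set_app B m (\<gamma> c) \<subseteq> set_app B b (\<gamma> a'))"
    and le: "morphism_le B (\<lambda>i. \<Union>(\<gamma> ` \<phi> i)) (\<lambda>i. {g i})"
  shows "morphism_le A \<phi> (\<lambda>i. dense_section B \<gamma> m (g i))"
proof -
  obtain t where t: "\<And>i b. b \<in> \<Union>(\<gamma> ` \<phi> i) \<Longrightarrow> \<exists>y\<in>{g i}. B t b = Some y"
    using le by (rule morphism_leE) blast
  obtain a where a: "\<And>a'. set_app_defined B t (\<gamma> a') \<Longrightarrow>
        \<exists>c. A a a' = Some c \<and> set_app_defined B m (\<gamma> c) \<and> set_app B m (\<gamma> c) \<subseteq> set_app B t (\<gamma> a')"
    using m[of t] by blast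
  show ?thesis
  proof (rule morphism_leI[of _ _ _ a])
    fix i a' assume "a' \<in> \<phi> i"
    then have *: "B t b = Some (g i)" if "b \<in> \<gamma> a'" for b using t that by blast
    then have "set_app_defined B t (\<gamma> a')" "set_app B t (\<gamma> a') \<subseteq> {g i}"
      by (auto simp: set_app_defined_def set_app_def)
    with a show "\<exists>y\<in>dense_section B \<gamma> m (g i). A a a' = Some y" unfolding dense_section_def by fast
  qed
qed

lemma dense_section_le: "morphism_le B (\<lambda>b. \<Union>(\<gamma> ` dense_section B \<gamma> m b)) (\<lambda>b. {b})"
  by (rule morphism_leI[of _ _ _ m]) (auto simp: dense_section_def set_app_defined_def set_app_def)

text \<open>By transposition the realizer can be sought in \<open>B\<close>. There \<open>m\<close>
  recovers both arguments from the images of their codes, and it remains to apply one to the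
  other.\<close>

lemma dense_section_applicative:
  assumes AB: "pca A" "pca B" "applicative_morphism A B \<gamma>"
    and m: "\<And>b. \<exists>a. \<forall>a'. set_app_defined B b (\<gamma> a') \<longrightarrow>
        (\<exists>c. A a a' = Some c \<and> set_app_defined B m (\<gamma> c) \<and> set_app B m (\<gamma> c) \<subseteq> set_app B b (\<gamma> a'))"
    and ne: "\<And>b. dense_section B \<gamma> m b \<noteq> {}"
  shows "applicative_morphism B A (dense_section B \<gamma> m)"
proof -
  let ?d = "dense_section B \<gamma> m"
  \<comment> \<open>An index is a triple of function, argument and result; the guard leaves only
    correct triples inhabited, which expresses the premise that the application is defined.\<close>
  let ?on = "\<lambda>i S. if B (fst i) (fst (snd i)) = Some (snd (snd i)) then S else {}"
  let ?\<phi> = "\<lambda>i. ?on i (?d (fst i))" and ?\<psi> = "\<lambda>i. ?on i (?d (fst (snd i)))"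
  let ?\<xi> = "\<lambda>i. both A (?\<phi> i) (?\<psi> i)"
  let ?\<eta> = "\<lambda>i. \<Union>(\<gamma> ` ?\<xi> i)"
  have \<phi>1: "morphism_le A ?\<xi> (\<lambda>i. ?d (fst i))"
    by (rule le_trans[OF AB(1) both_le1[OF AB(1)] le_sub[OF AB(1)]]) auto
  have \<phi>2: "morphism_le A ?\<xi> (\<lambda>i. ?d (fst (snd i)))"
    by (rule le_trans[OF AB(1) both_le2[OF AB(1)] le_sub[OF AB(1)]]) auto
  have 1: "morphism_le B ?\<eta> (\<lambda>i. {fst i})"
    by (rule le_trans[OF AB(2) img_le[OF AB(2,3) \<phi>1] le_reindex[OF dense_section_le]])
  have 2: "morphism_le B ?\<eta> (\<lambda>i. {fst (snd i)})"
    by (rule le_trans[OF AB(2) img_le[OF AB(2,3) \<phi>2] le_reindex[OF dense_section_le]])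
  have "morphism_le B ?\<eta> (\<lambda>i. ?on i (both B {fst i} {fst (snd i)}))"
    using le_bothI[OF AB(2) 1 2]
    by (subst le_cong_ne[where \<chi> = "\<lambda>i. both B {fst i} {fst (snd i)}"]) (auto split: if_splits)
  then have "morphism_le B ?\<eta> (\<lambda>i. {snd (snd i)})" by (rule le_trans[OF AB(2) _ app_le[OF AB(2)]])
  then have "morphism_le A ?\<xi> (\<lambda>i. ?d (snd (snd i)))" by (rule dense_le[OF m])
  from le_curry[OF AB(1) this] obtain r where
    r: "\<forall>i. \<forall>a\<in>?\<phi> i. \<forall>a'\<in>?\<psi> i. \<exists>y\<in>?d (snd (snd i)). tapp A (A r a) (Some a') = Some y" ..
  have "\<forall>b b' c. B b b' = Some c \<longrightarrow> (\<forall>a\<in>?d b. \<forall>a'\<in>?d b'. \<exists>y\<in>?d c. tapp A (A r a) (Some a') = Some y)"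
  proof (intro allI impI)
    fix b b' c assume "B b b' = Some c"
    with r[rule_format, of _ "(b, b', c)"] show "\<forall>a\<in>?d b. \<forall>a'\<in>?d b'. \<exists>y\<in>?d c. tapp A (A r a) (Some a') = Some y"
      by simp
  qed
  with ne show ?thesis unfolding applicative_morphism_def by blast
qed

section \<open>The inverse image functor and its counit\<close>

lemma image_assembly:
  assumes "\<And>a. \<gamma> a \<noteq> {}" "is_assembly \<U> X"
  shows "is_assembly \<U> (assembly_image \<gamma> X)"
  using assms by (auto simp: is_assembly_def assembly_image_def)

lemma assembly_image_simps [simp]:
  "pts (assembly_image \<gamma> X) = pts X" "rz (assembly_image \<gamma> X) = (\<lambda>x. \<Union>(\<gamma> ` rz X x))"
  by (auto simp: assembly_image_def)

context assemblies begin

text \<open>The arrow given by \<open>u\<close> followed by the quotient map from the carrier onto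
  \<open>R\<close>. Its graph relates \<open>k\<close> to all points equivalent to
  \<open>fn u k\<close>.\<close>

lemma arrow_of:
  assumes u: "u \<in> Arr C" "trg u = carrier_of R" and R: "R \<in> Obj T"
  obtains f where "f \<in> Hom T (diagonal (src u)) R" "rel_equiv (arr_rz f) (\<lambda>k x. both A (rz (src u) k) (span_rz R (fn u k) x))"
proof -
  let ?U = "src u"
  let ?\<tau> = "\<lambda>k x. both A (rz ?U k) (span_rz R (fn u k) x)"
  have U: "is_assembly \<U> ?U" using arr_asm(1)[OF u(1)] .
  note D = diagonal[OF U]
  have R': "is_relation C (carrier_of R) (carrier_of R) R" and E: "is_equivalence (carrier_of R) (span_rz R)" using R unfolding RT_obj by auto
  note r = le_refl[OF pca]
  have t1: "morphism_le A \<phi> (\<lambda>i. rz ?U (f i))" and t2: "morphism_le A \<phi> (\<lambda>i. span_rz R (fn u (f i)) (g i))"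
    if "morphism_le A \<phi> (\<lambda>i. ?\<tau> (f i) (g i))" for \<phi> :: "'i \<Rightarrow> 'a set" and f g
    using le_both1[OF pca that] le_both2[OF pca that] .
  have ux: "morphism_le A \<phi> (\<lambda>i. span_rz R (fn u (f i)) (fn u (f i)))" if "morphism_le A \<phi> (\<lambda>i. rz ?U (f i))"
    for \<phi> :: "'i \<Rightarrow> 'a set" and f
    using le_trans[OF pca that le_reindex[OF arr_le[OF u(1)], of f]] u(2) by (intro is_equivalenceD(1)[OF E]) simp
  have "is_functional ?U (carrier_of R) (span_rz (diagonal ?U)) (span_rz R) ?\<tau>"
    unfolding is_functional_def
  proof (intro conjI)
    show "morphism_le A (\<lambda>p. ?\<tau> (fst p) (snd p)) (\<lambda>p. rz ?U (fst p))" by (rule t1[OF r])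
    show "morphism_le A (\<lambda>p. ?\<tau> (fst p) (snd p)) (\<lambda>p. rz (carrier_of R) (snd p))"
      by (rule span_rz_strict(2)[OF R' t2[OF r]])
    show "morphism_le A (rz ?U) (\<lambda>x. \<Union>y. ?\<tau> x y)"
      by (rule le_exI[OF pca, where f = "fn u"], rule le_bothI[OF pca r ux[OF r]])
    show "morphism_le A (\<lambda>p. both A (?\<tau> (fst p) (fst (snd p))) (?\<tau> (fst p) (snd (snd p))))
      (\<lambda>p. span_rz R (fst (snd p)) (snd (snd p)))"
      by (rule is_equivalenceD(3)[OF E]) (rule is_equivalenceD(2)[OF E t2[OF both_le1[OF pca]]], rule t2[OF both_le2[OF pca]])
    let ?\<phi> = "\<lambda>p. both A (span_rz (diagonal ?U) (fst p) (fst (snd p)))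
         (both A (?\<tau> (fst (snd p)) (fst (snd (snd p)))) (span_rz R (fst (snd (snd p))) (snd (snd (snd p)))))"
    have 1: "morphism_le A ?\<phi> (\<lambda>p. ?\<tau> (fst (snd p)) (fst (snd (snd p))))"
      and 2: "morphism_le A ?\<phi> (\<lambda>p. span_rz R (fst (snd (snd p))) (snd (snd (snd p))))"
      by (rule le_both1[OF pca both_le2[OF pca]], rule le_both2[OF pca both_le2[OF pca]])
    have "morphism_le A ?\<phi> (\<lambda>p. ?\<tau> (fst (snd p)) (snd (snd (snd p))))"
      by (rule le_bothI[OF pca t1[OF 1] is_equivalenceD(3)[OF E t2[OF 1] 2]])
    then show "morphism_le A ?\<phi> (\<lambda>p. ?\<tau> (fst p) (snd (snd (snd p))))"
      by (subst le_cong_ne[where \<chi> = "\<lambda>p. ?\<tau> (fst (snd p)) (snd (snd (snd p)))"]) (auto simp: D(3) split: if_splits)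
  qed
  then have "is_functional (carrier_of (diagonal ?U)) (carrier_of R) (span_rz (diagonal ?U)) (span_rz R) ?\<tau>" unfolding D(2) .
  from RT_exists[OF D(1) R this] that show thesis by blast
qed

end

section \<open>The inverse image on realizers\<close>

locale applicative = SA: assemblies \<U> A + SB: assemblies \<U> B
  for \<U> :: "'u set set" and A :: "'a papp" and B :: "'b papp" +
  fixes \<gamma> :: "'a \<Rightarrow> 'b set"
  assumes app: "applicative_morphism A B \<gamma>"
begin

abbreviation F where "F \<equiv> RT_functor \<U> B \<gamma>"
abbreviation img :: "'a set \<Rightarrow> 'b set" where "img S \<equiv> \<Union>(\<gamma> ` S)"

lemma ne: "\<gamma> a \<noteq> {}"
  using app by (simp add: applicative_morphism_def)

lemmas img_le' = img_le[OF SB.pca app]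
lemmas img_both' = img_both[OF SA.pca SB.pca app]

lemma img_rel_le: "rel_le A \<rho> \<sigma> \<Longrightarrow> rel_le B (\<lambda>x y. img (\<rho> x y)) (\<lambda>x y. img (\<sigma> x y))"
  unfolding rel_le_def by (rule img_le')

lemma F_span: "on_obj F (p, q) = ((assembly_image \<gamma> (src p), fn p, assembly_image \<gamma> (trg p)),
    (assembly_image \<gamma> (src q), fn q, assembly_image \<gamma> (trg q)))"
  by (simp add: RT_functor_def exreg_functor_def Let_def Ass_functor_def split: prod.splits)

lemma F_obj: "carrier_of (on_obj F R) = assembly_image \<gamma> (carrier_of R)" "span_rz (on_obj F R) x y = img (span_rz R x y)"
proof -
  obtain p q where R: "R = (p, q)" by (meson surj_pair)
  show "carrier_of (on_obj F R) = assembly_image \<gamma> (carrier_of R)" unfolding R F_span by simp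
  show "span_rz (on_obj F R) x y = img (span_rz R x y)" unfolding R F_span span_rz_def by auto
qed

lemma F_arr: "on_arr F f = (on_obj F (fst f), (\<Union>P\<in>fst (snd f). rel_class SB.C (on_obj F P)), on_obj F (snd (snd f)))"
  by (simp add: RT_functor_def exreg_functor_def Let_def split: prod.splits)

lemma F_rel:
  assumes "is_relation SA.C X Y P"
  shows "is_relation SB.C (assembly_image \<gamma> X) (assembly_image \<gamma> Y) (on_obj F P)"
proof -
  obtain p q where P: "P = (p, q)" by (meson surj_pair)
  have arr: "(assembly_image \<gamma> (src f), fn f, assembly_image \<gamma> (trg f)) \<in> Arr SB.C" if "f \<in> Arr SA.C" for f
    using that img_le'[OF SA.arr_le[OF that]]
    unfolding SA.arr_iff SB.arr_iff by (simp add: image_assembly[of \<gamma>, OF ne])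
  show ?thesis using assms arr[of p] arr[of q] unfolding SA.is_relation_iff SB.is_relation_iff P F_span by simp
qed

lemma arr_rz_F:
  assumes "is_functor SA.T SB.T F" and f: "f \<in> Hom SA.T R S"
  shows "on_arr F f \<in> Hom SB.T (on_obj F R) (on_obj F S)"
    "SB.rel_equiv (arr_rz (on_arr F f)) (\<lambda>x y. img (arr_rz f x y))"
proof -
  show Ff: "on_arr F f \<in> Hom SB.T (on_obj F R) (on_obj F S)"
    using assms by (auto simp: is_functor_def Hom_def)
  obtain P where P: "P \<in> fst (snd f)" "is_relation SA.C (carrier_of R) (carrier_of S) P" "SA.rel_equiv (span_rz P) (arr_rz f)"
    by (rule SA.RT_rep[OF f])
  have "on_obj F P \<in> rel_class SB.C (on_obj F P)"
    using SB.rel_class_iff[OF F_rel[OF P(2)]] F_rel[OF P(2)] SB.rel_equiv_refl by blast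
  then have "on_obj F P \<in> fst (snd (on_arr F f))" unfolding F_arr fst_conv snd_conv using P(1) by blast
  from SB.RT_mem(2)[OF Ff this] have 1: "SB.rel_equiv (span_rz (on_obj F P)) (arr_rz (on_arr F f))" .
  have 2: "span_rz (on_obj F P) = (\<lambda>x y. img (span_rz P x y))" by (intro ext F_obj(2))
  have "SB.rel_equiv (\<lambda>x y. img (span_rz P x y)) (\<lambda>x y. img (arr_rz f x y))"
    using P(3) img_rel_le unfolding SA.rel_equiv_def SB.rel_equiv_def by blast
  then show "SB.rel_equiv (arr_rz (on_arr F f)) (\<lambda>x y. img (arr_rz f x y))"
    by (rule SB.rel_equiv_trans[OF SB.rel_equiv_sym[OF 1[unfolded 2]]])
qed

section \<open>From an inclusion to a section of the applicative morphism\<close>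

lemma inclusion_imp_section:
  assumes adj: "left_adjoint SA.T SB.T F G" and ff: "fully_faithful SB.T SA.T G"
    and small: "small \<U> (UNIV :: 'b set)" and dense: "computationally_dense A B \<gamma>"
  shows "\<exists>\<delta>. applicative_morphism B A \<delta> \<and> morphism_equiv B (morphism_comp \<gamma> \<delta>) morphism_id"
proof -
  have functors: "is_functor SA.T SB.T F" "is_functor SB.T SA.T G" using adj by (auto simp: left_adjoint_def)
  have cat: "category SB.T" using functors by (simp add: is_functor_def)
  obtain m where m: "\<And>b. \<exists>a. \<forall>a'. set_app_defined B b (\<gamma> a') \<longrightarrow>
        (\<exists>c. A a a' = Some c \<and> set_app_defined B m (\<gamma> c) \<and> set_app B m (\<gamma> c) \<subseteq> set_app B b (\<gamma> a'))"
    using dense unfolding computationally_dense_def by blast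
  let ?d = "dense_section B \<gamma> m"
  obtain Y j where Yj: "SB.presents (\<lambda>b. {b}) Y j"
    using SB.presents_exists[of "\<lambda>b. {b}"] small by auto
  have Y: "is_assembly \<U> Y" and rzY: "rz Y (j b) = {b}" and ptsY: "y \<in> pts Y \<Longrightarrow> \<exists>b. y = j b" for b y
    using SB.presentsD(1,2,3)[OF Yj] by auto
  have inj: "b = b'" if "j b = j b'" for b b' by (metis that rzY singleton_inject)
  define Z where "Z = SB.diagonal Y"
  note Z = SB.diagonal[OF Y, folded Z_def]
  obtain \<epsilon> where \<epsilon>: "\<epsilon> \<in> Hom SB.T (on_obj F (on_obj G Z)) Z"
    and ex: "\<exists>h\<in>Hom SB.T Z (on_obj F (on_obj G Z)). \<epsilon> \<cdot>\<^bsub>SB.T\<^esub> h = Ident SB.T Z"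
  proof (rule counit_of_adjunction[OF adj], goal_cases)
    case (1 \<epsilon>)
    from 1(1)[OF 1(2)[OF Z(1)] 1(5)[OF ff Z(1)]] show ?case .
  qed
  obtain h where h: "h \<in> Hom SB.T Z (on_obj F (on_obj G Z))" "\<epsilon> \<cdot>\<^bsub>SB.T\<^esub> h = Ident SB.T Z" using ex by blast
  define X where "X = carrier_of (on_obj G Z)"
  define P where "P = arr_rz \<epsilon>"
  have P: "SB.is_functional (assembly_image \<gamma> X) Y (span_rz (on_obj F (on_obj G Z))) (span_rz Z) P"
    using SB.arr_rz_functional[OF \<epsilon>] unfolding F_obj(1) Z(2) X_def[symmetric] P_def[symmetric] .
  note PD = SB.is_functionalD[OF P]
  note rA = le_refl[OF SA.pca] and rB = le_refl[OF SB.pca]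
  \<comment> \<open>Equality of \<open>Z\<close> is discrete and the coding \<open>j\<close> is
    injective, so single-valuedness of the counit determines the element itself.\<close>
  have sv: "b = b'" if "P x (j b) \<noteq> {}" "P x (j b') \<noteq> {}" for x b b'
  proof -
    have "morphism_le B (\<lambda>_::unit. both B (P x (j b)) (P x (j b'))) (\<lambda>_. span_rz Z (j b) (j b'))"
      by (rule PD(4)) (rule both_le1[OF SB.pca], rule both_le2[OF SB.pca])
    from le_ne[OF this] that have "span_rz Z (j b) (j b') \<noteq> {}" by simp
    then show ?thesis using inj by (simp add: Z(3) split: if_splits)
  qed
  \<comment> \<open>Since \<open>h\<close> is a section, every \<open>b\<close> yields some x that
    the counit sends to the code of \<open>b\<close>.\<close>
  have id1: "rel_le B (arr_rz (Ident SB.T Z)) (SB.rcomp (arr_rz h) P)"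
    using SB.arr_rz_comp[OF cat h(1) \<epsilon>] unfolding h(2) SB.rel_equiv_def P_def by blast
  have "morphism_le B (\<lambda>b. {b}) (\<lambda>b. span_rz Z (j b) (j b))" by (simp add: Z(3) rzY rB)
  then have "morphism_le B (\<lambda>b. {b}) (\<lambda>b. arr_rz (Ident SB.T Z) (j b) (j b))"
    by (rule le_trans[OF SB.pca _ rel_leD]) (use SB.arr_rz_ident[OF cat Z(1)] in \<open>simp add: SB.rel_equiv_def\<close>)
  from le_trans[OF SB.pca this rel_leD[OF id1]] have "morphism_le B (\<lambda>b. {b}) (\<lambda>b. \<Union>x. both B (arr_rz h (j b) x) (P x (j b)))"
    unfolding SB.rcomp_def .
  moreover have "morphism_le B (\<lambda>b. \<Union>x. both B (arr_rz h (j b) x) (P x (j b))) (\<lambda>b. img (?d b))"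
  proof (rule le_ex_left, rule le_trans[OF SB.pca both_le2[OF SB.pca]])
    \<comment> \<open>At an element \<open>b\<close> and a point x these are the realizers of x in
      \<open>A\<close>, provided that the counit sends x to the code of \<open>b\<close>. Being a
      family over \<open>A\<close>, it can be transposed by \<open>dense_le\<close>.\<close>
    let ?\<phi> = "\<lambda>i. if P (snd i) (j (fst i)) \<noteq> {} then rz X (snd i) else {}"
    have 1: "morphism_le B (\<lambda>i. img (?\<phi> i)) (\<lambda>i. {fst i})"
    proof -
      let ?\<psi> = "\<lambda>x. \<Union>y. P x y"
      have "morphism_le B (\<lambda>x. img (rz X x)) ?\<psi>"
        using PD(5)[of "\<lambda>x. img (rz X x)" "\<lambda>x. x", unfolded assembly_image_simps, OF rB] .
      moreover have "morphism_le B ?\<psi> (\<lambda>x. {b. P x (j b) \<noteq> {}})"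
      proof -
        \<comment> \<open>A realizer of a point of \<open>Y\<close> is the very element coded by it.
          So strictness of \<open>P\<close> computes an element to whose code x is sent; by
          \<open>sv\<close> it is the given one.\<close>
        have "morphism_le B (\<lambda>i. P (fst i) (snd i)) (\<lambda>i. rz Y (snd i))" by (rule PD(2)[OF rB])
        then obtain s where s: "\<And>i b. b \<in> P (fst i) (snd i) \<Longrightarrow> \<exists>c\<in>rz Y (snd i). B s b = Some c"
          by (rule morphism_leE) blast
        show ?thesis
        proof (rule morphism_leI[of _ _ _ s])
          fix x b assume "b \<in> ?\<psi> x"
          then obtain y where y: "b \<in> P x y" by blast
          from s[of b "(x, y)"] y obtain c where c: "c \<in> rz Y y" "B s b = Some c" by auto
          then have "y \<in> pts Y" using SB.asm_mem[OF Y] by blast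
          then obtain b' where b': "y = j b'" using ptsY by blast
          then have "c = b'" using c rzY by simp
          with y b' c show "\<exists>c\<in>{b. P x (j b) \<noteq> {}}. B s b = Some c" by blast
        qed
      qed
      ultimately have "morphism_le B (\<lambda>x. img (rz X x)) (\<lambda>x. {b. P x (j b) \<noteq> {}})" by (rule le_trans[OF SB.pca])
      then obtain s where s: "\<And>x b. b \<in> img (rz X x) \<Longrightarrow> \<exists>c\<in>{b. P x (j b) \<noteq> {}}. B s b = Some c"
        by (rule morphism_leE) blast
      show ?thesis
      proof (rule morphism_leI[of _ _ _ s])
        fix i b assume b: "b \<in> img (?\<phi> i)"
        then have i: "P (snd i) (j (fst i)) \<noteq> {}" and "b \<in> img (rz X (snd i))" by (auto split: if_splits)
        from s[OF this(2)] obtain c where c: "P (snd i) (j c) \<noteq> {}" "B s b = Some c" by blast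
        from sv[OF i c(1)] c(2) show "\<exists>y\<in>{fst i}. B s b = Some y" by simp
      qed
    qed
    have 2: "morphism_le B (\<lambda>i. P (snd i) (j (fst i))) (\<lambda>i. img (?\<phi> i))"
      using PD(1)[OF rB, of snd "\<lambda>i. j (fst i)"]
      by (subst le_cong_ne[where \<chi> = "\<lambda>i. img (rz X (snd i))"]) auto
    show "morphism_le B (\<lambda>i. P (snd i) (j (fst i))) (\<lambda>i. img (?d (fst i)))"
      by (rule le_trans[OF SB.pca 2 img_le'[OF dense_le[OF m 1]]])
  qed
  ultimately have le: "morphism_le B (\<lambda>b. {b}) (\<lambda>b. img (?d b))" by (rule le_trans[OF SB.pca])
  have "?d b \<noteq> {}" for b using le_ne[OF le, of b] by auto
  then have "applicative_morphism B A ?d" by (intro dense_section_applicative[OF SA.pca SB.pca app m])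
  moreover have "morphism_equiv B (morphism_comp \<gamma> ?d) morphism_id"
  proof -
    have "morphism_comp \<gamma> ?d = (\<lambda>b. img (?d b))" "(morphism_id :: 'b \<Rightarrow> _) = (\<lambda>b. {b})"
      by (simp_all add: fun_eq_iff morphism_comp_def morphism_id_def)
    then show ?thesis using le dense_section_le unfolding morphism_equiv_def by metis
  qed
  ultimately show ?thesis by blast
qed

section \<open>From a section to an invertible counit\<close>

lemma section_imp_inclusion:
  assumes adj: "left_adjoint SA.T SB.T F G" and \<delta>: "applicative_morphism B A \<delta>"
    and eqv: "morphism_equiv B (morphism_comp \<gamma> \<delta>) morphism_id"
  shows "fully_faithful SB.T SA.T G"
proof (rule counit_of_adjunction[OF adj], goal_cases)
  case (1 \<epsilon>)
  note eps = 1(1) and cover = 1(2) and mono = 1(3)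
  note rA = le_refl[OF SA.pca] and rB = le_refl[OF SB.pca] and tB = le_trans[OF SB.pca]
  have functors: "is_functor SA.T SB.T F" "is_functor SB.T SA.T G" using adj by (auto simp: left_adjoint_def)
  have cat: "category SA.T" "category SB.T" using functors by (auto simp: is_functor_def)
  have Fo: "on_obj F R \<in> Obj SB.T" if "R \<in> Obj SA.T" for R using functors(1) that by (simp add: is_functor_def)
  have Go: "on_obj G R \<in> Obj SA.T" if "R \<in> Obj SB.T" for R using functors(2) that by (simp add: is_functor_def)
  have \<delta>ne: "\<delta> b \<noteq> {}" for b using \<delta> by (simp add: applicative_morphism_def)
  let ?dl = "\<lambda>S. \<Union>(\<delta> ` S)"
  \<comment> \<open>With \<open>d2\<close>, this says that passing to \<open>A\<close> along
    \<open>\<delta>\<close> and back along \<open>\<gamma>\<close> does not change a family over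
    \<open>B\<close>, over any index type.\<close>
  have d1: "morphism_le B (\<lambda>i. img (?dl (\<phi> i))) \<phi>" for \<phi> :: "'i \<Rightarrow> 'b set"
  proof -
    have "morphism_le B (morphism_comp \<gamma> \<delta>) morphism_id" using eqv by (simp add: morphism_equiv_def)
    then obtain s where s: "\<And>i b. b \<in> morphism_comp \<gamma> \<delta> i \<Longrightarrow> \<exists>y\<in>morphism_id i. B s b = Some y"
      by (rule morphism_leE) blast
    show ?thesis
      by (rule morphism_leI[of _ _ _ s]) (use s in \<open>fastforce simp: morphism_comp_def morphism_id_def\<close>)
  qed
  have d2: "morphism_le B \<phi> (\<lambda>i. img (?dl (\<phi> i)))" for \<phi> :: "'i \<Rightarrow> 'b set"
  proof -
    have "morphism_le B morphism_id (morphism_comp \<gamma> \<delta>)" using eqv by (simp add: morphism_equiv_def)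
    then obtain s where s: "\<And>i b. b \<in> morphism_id i \<Longrightarrow> \<exists>y\<in>morphism_comp \<gamma> \<delta> i. B s b = Some y"
      by (rule morphism_leE) blast
    show ?thesis
      by (rule morphism_leI[of _ _ _ s]) (use s in \<open>fastforce simp: morphism_comp_def morphism_id_def\<close>)
  qed
  show ?case
  proof (rule 1(5))
    fix Z assume Z: "Z \<in> Obj SB.T"
    define W where "W = on_obj G Z"
    define X where "X = carrier_of W"
    define Y where "Y = carrier_of Z"
    define P where "P = arr_rz (\<epsilon> Z)"
    have W: "W \<in> Obj SA.T" unfolding W_def by (rule Go[OF Z])
    have e: "\<epsilon> Z \<in> Hom SB.T (on_obj F W) Z" using eps[OF Z] by (simp add: W_def)
    have WR: "is_relation SA.C X X W" and WE: "SA.is_equivalence X (span_rz W)" using W unfolding SA.RT_obj X_def by auto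
    have ZR: "is_relation SB.C Y Y Z" and ZE: "SB.is_equivalence Y (span_rz Z)" using Z unfolding SB.RT_obj Y_def by auto
    have X: "is_assembly \<U> X" and Y: "is_assembly \<U> Y"
      using SA.relation_asm[OF WR] SB.relation_asm[OF ZR] by auto
    have FW: "on_obj F W \<in> Obj SB.T" by (rule Fo[OF W])
    have rzF: "span_rz (on_obj F R) = (\<lambda>x y. img (span_rz R x y))" for R by (intro ext F_obj(2))
    have FE: "SB.is_equivalence (assembly_image \<gamma> X) (\<lambda>x y. img (span_rz W x y))"
      using FW unfolding SB.RT_obj F_obj(1) X_def[symmetric] rzF by blast
    note FED = SB.is_equivalenceD[OF FE, unfolded assembly_image_simps] and ZED = SB.is_equivalenceD[OF ZE]
    have P: "SB.is_functional (assembly_image \<gamma> X) Y (\<lambda>x y. img (span_rz W x y)) (span_rz Z) P"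
      using SB.arr_rz_functional[OF e] unfolding F_obj(1) rzF X_def[symmetric] Y_def[symmetric] P_def[symmetric] .
    note PD = SB.is_functionalD[OF P, unfolded assembly_image_simps]

    have surj: "morphism_le B (rz Y) (\<lambda>y. \<Union>x. P x y)"
    proof -
      define V where "V = assembly_image \<delta> Y"
      have V: "is_assembly \<U> V" unfolding V_def by (rule image_assembly[OF \<delta>ne Y])
      note DV = SA.diagonal[OF V]
      have carrier_of: "carrier_of (on_obj F (SA.diagonal V)) = assembly_image \<gamma> V" unfolding F_obj(1) DV(2) ..
      \<comment> \<open>The relation of \<open>Z\<close> itself serves as graph: as a map out of
        \<open>Y\<close> it is the quotient map, and the isomorphism of \<open>Y\<close> with its
        transported copy is the identity on points. \<open>d2\<close> gives strictness in the
        source, \<open>d1\<close> totality.\<close>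
      have "SB.is_functional (assembly_image \<gamma> V) Y (\<lambda>x y. img (span_rz (SA.diagonal V) x y)) (span_rz Z) (span_rz Z)"
        unfolding SB.is_functional_def
      proof (intro conjI)
        show "morphism_le B (\<lambda>p. span_rz Z (fst p) (snd p)) (\<lambda>p. rz (assembly_image \<gamma> V) (fst p))"
          using tB[OF SB.span_rz_strict(1)[OF ZR rB] d2] by (simp add: V_def)
        show "morphism_le B (\<lambda>p. span_rz Z (fst p) (snd p)) (\<lambda>p. rz Y (snd p))" by (rule SB.span_rz_strict(2)[OF ZR rB])
        show "morphism_le B (\<lambda>p. both B (span_rz Z (fst p) (fst (snd p))) (span_rz Z (fst p) (snd (snd p))))
          (\<lambda>p. span_rz Z (fst (snd p)) (snd (snd p)))"
          by (rule ZED(3)) (rule ZED(2)[OF both_le1[OF SB.pca]], rule both_le2[OF SB.pca])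
        have "morphism_le B (\<lambda>x. img (?dl (rz Y x))) (\<lambda>x. \<Union>y. span_rz Z x y)"
          by (rule le_exI[OF SB.pca, where f = "\<lambda>x. x"], rule ZED(1)[OF d1])
        then show "morphism_le B (rz (assembly_image \<gamma> V)) (\<lambda>x. \<Union>y. span_rz Z x y)" by (simp add: V_def)
        let ?\<phi> = "\<lambda>p. both B (img (span_rz (SA.diagonal V) (fst p) (fst (snd p))))
           (both B (span_rz Z (fst (snd p)) (fst (snd (snd p)))) (span_rz Z (fst (snd (snd p))) (snd (snd (snd p)))))"
        have "morphism_le B ?\<phi> (\<lambda>p. span_rz Z (fst (snd p)) (snd (snd (snd p))))"
          by (rule ZED(3)) (rule le_both1[OF SB.pca both_le2[OF SB.pca]], rule le_both2[OF SB.pca both_le2[OF SB.pca]])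
        then show "morphism_le B ?\<phi> (\<lambda>p. span_rz Z (fst p) (snd (snd (snd p))))"
          by (subst le_cong_ne[where \<chi> = "\<lambda>p. span_rz Z (fst (snd p)) (snd (snd (snd p)))"]) (auto simp: DV(3) split: if_splits)
      qed
      then have "SB.is_functional (carrier_of (on_obj F (SA.diagonal V))) (carrier_of Z) (span_rz (on_obj F (SA.diagonal V))) (span_rz Z) (span_rz Z)"
        unfolding carrier_of rzF Y_def .
      from SB.RT_exists[OF Fo[OF DV(1)] Z this]
      obtain c where c: "c \<in> Hom SB.T (on_obj F (SA.diagonal V)) Z" "SB.rel_equiv (arr_rz c) (span_rz Z)" .
      obtain k where k: "k \<in> Hom SA.T (SA.diagonal V) W" "\<epsilon> Z \<cdot>\<^bsub>SB.T\<^esub> on_arr F k = c"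
        using cover[OF DV(1) Z c(1)] unfolding W_def by blast
      have "SB.rel_equiv (arr_rz c) (SB.rcomp (arr_rz (on_arr F k)) P)"
        using SB.arr_rz_comp[OF cat(2) arr_rz_F(1)[OF functors(1) k(1)] e] unfolding k(2) P_def .
      with c(2) have "rel_le B (span_rz Z) (SB.rcomp (arr_rz (on_arr F k)) P)"
        using SB.rel_equiv_sym SB.rel_equiv_trans unfolding SB.rel_equiv_def by blast
      from tB[OF ZED(1)[OF rB] rel_leD[OF this]]
      have "morphism_le B (rz Y) (\<lambda>y. \<Union>x. both B (arr_rz (on_arr F k) y x) (P x y))"
        unfolding SB.rcomp_def .
      moreover have "morphism_le B (\<lambda>y. \<Union>x. both B (arr_rz (on_arr F k) y x) (P x y)) (\<lambda>y. \<Union>x. P x y)"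
        by (rule le_ex_left, rule le_exI[OF SB.pca, where f = snd], rule both_le2[OF SB.pca])
      ultimately show ?thesis by (rule tB)
    qed

    \<comment> \<open>The third component is realized by elements of \<open>A\<close> only thanks to \<open>\<delta>\<close>.\<close>
    define \<kappa> where "\<kappa> = (\<lambda>x x'. \<Union>y. both B (P x y) (P x' y))"
    define \<rho> where "\<rho> = (\<lambda>x x'. both A (both A (rz X x) (rz X x')) (?dl (\<kappa> x x')))"
    \<comment> \<open>The span exists because the first two components of \<open>\<rho>\<close> make
      it strict over \<open>A\<close>.\<close>
    obtain N where N: "is_relation SA.C X X N" "span_rz N = \<rho>"
      using SA.span_of_family[OF X X, of \<rho>] le_both1[OF SA.pca both_le1[OF SA.pca]] le_both2[OF SA.pca both_le1[OF SA.pca]]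
      unfolding \<rho>_def by metis
    obtain u v where uv: "N = (u, v)" by (meson surj_pair)
    have u: "u \<in> Arr SA.C" "trg u = carrier_of W" and v: "v \<in> Arr SA.C" "trg v = carrier_of W" and src: "src v = src u"
      using N(1) unfolding SA.is_relation_iff uv X_def by auto
    define U where "U = src u"
    have U: "is_assembly \<U> U" unfolding U_def by (rule SA.arr_asm(1)[OF u(1)])
    note DU = SA.diagonal[OF U]
    \<comment> \<open>\<open>a\<close> and \<open>b\<close> are the two legs of \<open>N\<close>,
      each followed by the quotient map onto \<open>W\<close>.\<close>
    obtain a where a: "a \<in> Hom SA.T (SA.diagonal U) W" "SA.rel_equiv (arr_rz a) (\<lambda>k x. both A (rz U k) (span_rz W (fn u k) x))"
      using SA.arrow_of[OF u W] unfolding U_def by blast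
    obtain b where b: "b \<in> Hom SA.T (SA.diagonal U) W" "SA.rel_equiv (arr_rz b) (\<lambda>k x. both A (rz U k) (span_rz W (fn v k) x))"
      using SA.arrow_of[OF v W] unfolding src U_def by blast
    have rzU: "rz U k = \<rho> (fn u k) (fn v k)" if "k \<in> pts U" for k
      using SA.span_rz_eq[OF N(1), of k] that N(2) by (simp add: uv U_def)
    have U\<rho>: "morphism_le A (rz U) (\<lambda>k. \<rho> (fn u k) (fn v k))"
      by (rule le_sub[OF SA.pca]) (metis rzU SA.asm_mem[OF U] empty_subsetI order_refl)
    have compat: "morphism_le B \<phi> (\<lambda>i. P (fn w (f i)) (g i))"
      if "morphism_le B \<phi> (\<lambda>i. img (both A (rz U (f i)) (span_rz W (fn w (f i)) (x i))))" "morphism_le B \<phi> (\<lambda>i. P (x i) (g i))"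
      for \<phi> :: "'i \<Rightarrow> 'b set" and f g x w
      by (rule PD(3)[OF tB[OF that(1) img_le'[OF both_le2[OF SA.pca]]] that(2) ZED(1)[OF PD(2)[OF that(2)]]])

    have "\<epsilon> Z \<cdot>\<^bsub>SB.T\<^esub> on_arr F a = \<epsilon> Z \<cdot>\<^bsub>SB.T\<^esub> on_arr F b"
    proof (rule SB.RT_eqI)
      note Fa = arr_rz_F[OF functors(1) a(1)] and Fb = arr_rz_F[OF functors(1) b(1)]
      show "\<epsilon> Z \<cdot>\<^bsub>SB.T\<^esub> on_arr F a \<in> Hom SB.T (on_obj F (SA.diagonal U)) Z"
        "\<epsilon> Z \<cdot>\<^bsub>SB.T\<^esub> on_arr F b \<in> Hom SB.T (on_obj F (SA.diagonal U)) Z"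
        by (rule category_simps(2)[OF cat(2) Fa(1) e], rule category_simps(2)[OF cat(2) Fb(1) e])
      let ?\<tau> = "\<lambda>w k x. img (both A (rz U k) (span_rz W (fn w k) x))"
      have "rel_le A (arr_rz a) (\<lambda>k x. both A (rz U k) (span_rz W (fn u k) x))" "rel_le A (\<lambda>k x. both A (rz U k) (span_rz W (fn v k) x)) (arr_rz b)"
        using a(2) b(2) by (auto simp: SA.rel_equiv_def)
      note this[THEN img_rel_le]
      then have le: "rel_le B (arr_rz (on_arr F a)) (?\<tau> u)" "rel_le B (?\<tau> v) (arr_rz (on_arr F b))"
        using Fa(2) Fb(2) SB.rel_le_trans unfolding SB.rel_equiv_def by blast+
      have "rel_le B (SB.rcomp (?\<tau> u) P) (SB.rcomp (?\<tau> v) P)"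
      proof (rule SB.rcomp_leI)
        let ?\<phi> = "\<lambda>p. both B (?\<tau> u (fst (fst p)) (snd p)) (P (snd p) (snd (fst p)))"
        let ?k = "\<lambda>p. fst (fst p)" and ?y = "\<lambda>p. snd (fst p)"
        have 1: "morphism_le B ?\<phi> (\<lambda>p. ?\<tau> u (?k p) (snd p))" by (rule both_le1[OF SB.pca])
        have Pu: "morphism_le B ?\<phi> (\<lambda>p. P (fn u (?k p)) (?y p))" by (rule compat[OF 1 both_le2[OF SB.pca]])
        have Uk: "morphism_le B ?\<phi> (\<lambda>p. img (rz U (?k p)))"
          by (rule tB[OF 1 img_le'[OF both_le1[OF SA.pca]]])
        \<comment> \<open>A realizer of a point of \<open>U\<close> contains a transported realizer
          of \<open>\<kappa>\<close>; \<open>d1\<close> turns it back into a common value of the two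
          legs under the counit.\<close>
        have "morphism_le B (\<lambda>k. img (rz U k)) (\<lambda>k. img (?dl (\<kappa> (fn u k) (fn v k))))"
          by (rule img_le', rule le_both2[OF SA.pca U\<rho>[unfolded \<rho>_def]])
        from tB[OF tB[OF Uk le_reindex[OF this]] d1]
        have \<kappa>: "morphism_le B ?\<phi> (\<lambda>p. \<Union>y. both B (P (fn u (?k p)) y) (P (fn v (?k p)) y))"
          unfolding \<kappa>_def .
        \<comment> \<open>The common value and the given one are both values of
          \<open>fn u k\<close>, hence equivalent; so the given one is also a value of
          \<open>fn v k\<close>.\<close>
        have Pv: "morphism_le B ?\<phi> (\<lambda>p. P (fn v (?k p)) (?y p))"
        proof (rule le_exE[OF SB.pca \<kappa>])
          let ?\<psi> = "\<lambda>q. both B (?\<phi> (fst q)) (both B (P (fn u (?k (fst q))) (snd q)) (P (fn v (?k (fst q))) (snd q)))"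
          have 1: "morphism_le B ?\<psi> (\<lambda>q. P (fn u (?k (fst q))) (?y (fst q)))"
            by (rule tB[OF both_le1[OF SB.pca] le_reindex[OF Pu]])
          have 2: "morphism_le B ?\<psi> (\<lambda>q. P (fn u (?k (fst q))) (snd q))"
            by (rule le_both1[OF SB.pca both_le2[OF SB.pca]])
          have 3: "morphism_le B ?\<psi> (\<lambda>q. P (fn v (?k (fst q))) (snd q))"
            by (rule le_both2[OF SB.pca both_le2[OF SB.pca]])
          show "morphism_le B ?\<psi> (\<lambda>q. P (fn v (?k (fst q))) (?y (fst q)))"
            by (rule PD(3)[OF FED(1)[OF PD(1)[OF 3]] 3 PD(4)[OF 2 1]])
        qed
        \<comment> \<open>By reflexivity \<open>fn v k\<close> itself can be the middle point of the
          second composite.\<close>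
        have "morphism_le A (rz U) (\<lambda>k. both A (rz U k) (span_rz W (fn v k) (fn v k)))"
          by (rule le_bothI[OF SA.pca rA SA.is_equivalenceD(1)[OF WE]])
            (use SA.arr_le[OF v(1)] v(2) in \<open>simp add: src U_def X_def\<close>)
        from tB[OF Uk le_reindex[OF img_le'[OF this]]]
        have "morphism_le B ?\<phi> (\<lambda>p. ?\<tau> v (?k p) (fn v (?k p)))" .
        then show "morphism_le B ?\<phi> (\<lambda>p. SB.rcomp (?\<tau> v) P (?k p) (?y p))"
          using Pv by (rule SB.rcompI)
      qed
      then have "rel_le B (SB.rcomp (arr_rz (on_arr F a)) P) (SB.rcomp (arr_rz (on_arr F b)) P)"
        using SB.rel_le_trans[OF SB.rcomp_mono[OF le(1) SB.rel_le_refl]] SB.rel_le_trans[OF _ SB.rcomp_mono[OF le(2) SB.rel_le_refl]]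
        by blast
      then show "rel_le B (arr_rz (\<epsilon> Z \<cdot>\<^bsub>SB.T\<^esub> on_arr F a)) (arr_rz (\<epsilon> Z \<cdot>\<^bsub>SB.T\<^esub> on_arr F b))"
        using SB.arr_rz_comp[OF cat(2) Fa(1) e] SB.arr_rz_comp[OF cat(2) Fb(1) e] SB.rel_le_trans
        unfolding SB.rel_equiv_def P_def by blast
    qed
    from mono[OF DU(1) Z a(1)[unfolded W_def] b(1)[unfolded W_def] this] have ab: "a = b" .

    have "rel_le A \<rho> (span_rz W)"
    proof -
      have "rel_le A (\<lambda>k x. both A (rz U k) (span_rz W (fn u k) x)) (\<lambda>k x. both A (rz U k) (span_rz W (fn v k) x))"
        using a(2) b(2) SA.rel_le_trans unfolding ab SA.rel_equiv_def by blast
      \<comment> \<open>Now that the graphs of \<open>a\<close> and \<open>b\<close> agree,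
        evaluating them at \<open>fn u k\<close> turns reflexivity there into the equivalence of
        \<open>fn v k\<close> and \<open>fn u k\<close>.\<close>
      from rel_leD[OF this, of "\<lambda>k. k" "fn u"]
      have 1: "morphism_le A (\<lambda>k. both A (rz U k) (span_rz W (fn u k) (fn u k))) (\<lambda>k. both A (rz U k) (span_rz W (fn v k) (fn u k)))" .
      have "morphism_le A (rz U) (\<lambda>k. both A (rz U k) (span_rz W (fn u k) (fn u k)))"
        by (rule le_bothI[OF SA.pca rA SA.is_equivalenceD(1)[OF WE]])
          (use SA.arr_le[OF u(1)] u(2) in \<open>simp add: U_def X_def\<close>)
      from SA.is_equivalenceD(2)[OF WE le_both2[OF SA.pca le_trans[OF SA.pca this 1]]]
      have "morphism_le A (rz (src u)) (\<lambda>k. span_rz W (fn u k) (fn v k))" unfolding U_def .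
      then have "holds SA.C W u v"
        using SA.holds_iff[OF WR u(1) v(1) src[symmetric]] u(2) v(2) unfolding X_def by blast
      then show ?thesis using SA.holds_iff_rel_le[OF N(1) WR] N(2) by (simp add: uv)
    qed
    then have \<rho>W: "rel_le B (\<lambda>x y. img (\<rho> x y)) (\<lambda>x y. img (span_rz W x y))" by (rule img_rel_le)
    \<comment> \<open>The common value gives \<open>\<kappa>\<close>, which \<open>d2\<close>
      transports under \<open>\<gamma>\<close>; since the image preserves conjunction, all
      components of \<open>\<rho>\<close> are then available there.\<close>
    have inj: "morphism_le B \<phi> (\<lambda>i. img (span_rz W (f i) (g i)))"
      if P1: "morphism_le B \<phi> (\<lambda>i. P (f i) (h i))" and P2: "morphism_le B \<phi> (\<lambda>i. P (g i) (h i))"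
      for \<phi> :: "'i \<Rightarrow> 'b set" and f g h
    proof -
      have "morphism_le B \<phi> (\<lambda>i. \<kappa> (f i) (g i))"
        unfolding \<kappa>_def by (rule le_exI[OF SB.pca, where f = h], rule le_bothI[OF SB.pca P1 P2])
      then have "morphism_le B \<phi> (\<lambda>i. img (?dl (\<kappa> (f i) (g i))))" by (rule tB[OF _ d2])
      from img_both'[OF img_both'[OF PD(1)[OF P1] PD(1)[OF P2]] this]
      have "morphism_le B \<phi> (\<lambda>i. img (\<rho> (f i) (g i)))" unfolding \<rho>_def .
      then show ?thesis by (rule tB[OF _ rel_leD[OF \<rho>W]])
    qed

    have "SB.is_functional Y (assembly_image \<gamma> X) (span_rz Z) (\<lambda>x y. img (span_rz W x y)) (\<lambda>y x. P x y)"
      unfolding SB.is_functional_def assembly_image_simps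
    proof (intro conjI)
      show "morphism_le B (\<lambda>p. P (snd p) (fst p)) (\<lambda>p. rz Y (fst p))" by (rule PD(2)[OF rB])
      show "morphism_le B (\<lambda>p. P (snd p) (fst p)) (\<lambda>p. img (rz X (snd p)))" by (rule PD(1)[OF rB])
      show "morphism_le B (\<lambda>p. both B (P (fst (snd p)) (fst p)) (P (snd (snd p)) (fst p)))
        (\<lambda>p. img (span_rz W (fst (snd p)) (snd (snd p))))"
        by (rule inj[OF both_le1[OF SB.pca] both_le2[OF SB.pca]])
      show "morphism_le B (rz Y) (\<lambda>y. \<Union>x. P x y)" by (rule surj)
      let ?\<phi> = "\<lambda>p. both B (span_rz Z (fst p) (fst (snd p)))
           (both B (P (fst (snd (snd p))) (fst (snd p))) (img (span_rz W (fst (snd (snd p))) (snd (snd (snd p))))))"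
      show "morphism_le B ?\<phi> (\<lambda>p. P (snd (snd (snd p))) (fst p))"
        by (rule PD(3)[OF FED(2)[OF le_both2[OF SB.pca both_le2[OF SB.pca]]] le_both1[OF SB.pca both_le2[OF SB.pca]]
              ZED(2)[OF both_le1[OF SB.pca]]])
    qed
    then have "SB.is_functional (carrier_of Z) (carrier_of (on_obj F W)) (span_rz Z) (span_rz (on_obj F W)) (\<lambda>y x. P x y)"
      unfolding F_obj(1) rzF X_def Y_def .
    from SB.RT_exists[OF Z FW this]
    obtain h where h: "h \<in> Hom SB.T Z (on_obj F W)" "SB.rel_equiv (arr_rz h) (\<lambda>y x. P x y)" .
    have "\<epsilon> Z \<cdot>\<^bsub>SB.T\<^esub> h = Ident SB.T Z"
    proof (rule SB.RT_eqI[OF category_simps(2)[OF cat(2) h(1) e] category_simps(1)[OF cat(2) Z]])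
      have "rel_le B (SB.rcomp (\<lambda>y x. P x y) P) (span_rz Z)"
        by (rule SB.rcomp_leI) (rule PD(4)[OF both_le1[OF SB.pca] both_le2[OF SB.pca]])
      then show "rel_le B (arr_rz (\<epsilon> Z \<cdot>\<^bsub>SB.T\<^esub> h)) (arr_rz (Ident SB.T Z))"
        using SB.arr_rz_comp[OF cat(2) h(1) e, folded P_def] SB.rcomp_cong[OF h(2) SB.rel_equiv_refl] SB.arr_rz_ident[OF cat(2) Z] SB.rel_le_trans
        unfolding SB.rel_equiv_def by meson
    qed
    moreover have "h \<cdot>\<^bsub>SB.T\<^esub> \<epsilon> Z = Ident SB.T (on_obj F W)"
    proof (rule SB.RT_eqI[OF category_simps(2)[OF cat(2) e h(1)] category_simps(1)[OF cat(2) FW]])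
      have "rel_le B (SB.rcomp P (\<lambda>y x. P x y)) (span_rz (on_obj F W))"
        unfolding rzF by (rule SB.rcomp_leI) (rule inj[OF both_le1[OF SB.pca] both_le2[OF SB.pca]])
      then show "rel_le B (arr_rz (h \<cdot>\<^bsub>SB.T\<^esub> \<epsilon> Z)) (arr_rz (Ident SB.T (on_obj F W)))"
        using SB.arr_rz_comp[OF cat(2) e h(1), folded P_def] SB.rcomp_cong[OF SB.rel_equiv_refl h(2)] SB.arr_rz_ident[OF cat(2) FW] SB.rel_le_trans
        unfolding SB.rel_equiv_def by meson
    qed
    ultimately show "\<exists>h\<in>Hom SB.T Z (on_obj F (on_obj G Z)). \<epsilon> Z \<cdot>\<^bsub>SB.T\<^esub> h = Ident SB.T Z \<and>
      h \<cdot>\<^bsub>SB.T\<^esub> \<epsilon> Z = Ident SB.T (on_obj F (on_obj G Z))"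
      using h(1) unfolding W_def by blast
  qed
qed

end

theorem corollary2p5:
  fixes A :: "'a papp" and B :: "'b papp" and \<gamma> :: "'a \<Rightarrow> 'b set"
    and \<U> :: "'u set set"
    and direct_image :: "(('u, 'b) rt_obj, ('u, 'b) rt_arr, ('u, 'a) rt_obj, ('u, 'a) rt_arr) cfunctor"
  assumes "set_universe \<U>" and "small \<U> (UNIV :: 'a set)" and "small \<U> (UNIV :: 'b set)"
    and "pca A" and "pca B"
    and "applicative_morphism A B \<gamma>" and "computationally_dense A B \<gamma>"
    and induced: "geometric_morphism (RT \<U> B) (RT \<U> A) (RT_functor \<U> B \<gamma>) direct_image"
  shows "geometric_inclusion (RT \<U> B) (RT \<U> A) (RT_functor \<U> B \<gamma>) direct_image \<longleftrightarrow>
    (\<exists>\<delta>. applicative_morphism B A \<delta> \<and>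
         morphism_equiv B (morphism_comp \<gamma> \<delta>) morphism_id)"
proof -
  interpret applicative \<U> A B \<gamma>
    using assms by unfold_locales
  have adj: "left_adjoint (RT \<U> A) (RT \<U> B) (RT_functor \<U> B \<gamma>) direct_image"
    using induced by (simp add: geometric_morphism_def)
  show ?thesis
    using inclusion_imp_section[OF adj _ assms(3,7)] section_imp_inclusion[OF adj] induced
    unfolding geometric_inclusion_def by blast
qed

end
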